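(* Let $h$ be a non-constant entire function on $\mathbb{C}$ whose order satisfies $\rho(h)\neq 1$ (the case $\rho(h)=\infty$ is allowed). Let $L_1$ and $L_2$ be two $L$-functions (elements of the extended Selberg class $\mathcal{S}^{\sharp}$). If $L_1-h$ and $L_2-h$ have the same zeros counting multiplicities, then $L_1\equiv L_2$.
   Context: An $L$-function means an element of the extended Selberg class $\mathcal{S}^{\sharp}$, i.e. a Dirichlet series $L(s)=\sum_{n=1}^{\infty}\frac{a(n)}{n^s}$ with $a(1)=1$, identified with its meromorphic continuation to $\mathbb{C}$, satisfying: (i) Ramanujan hypothesis: $a(n)\ll n^{\varepsilon}$ for every $\varepsilon>0$; (ii) Analytic continuation: there is a non-negative integer $k$ such that $(s-1)^kL(s)$ is an entire function of finite order; (iii) Functional equation: $\Lambda_L(s)=\omega\overline{\Lambda_L(1-\overline{s})}$, where $\Lambda_L(s)=L(s)Q^s\prod_{j=1}^{K}\Gamma(\lambda_js+\mu_j)$ with constants $Q>0$, $\lambda_j>0$, $\mathrm{Re}\,\mu_j\ge 0$, $|\omega|=1$ (the empty product, $K=0$, is allowed). No Euler product is assumed. For a meromorphic function $f$ on $\mathbb{C}$, let $m(r,f)=\frac{1}{2\pi}\int_0^{2\pi}\log^+|f(re^{i\theta})|\,d\theta$, $N(r,f)=\int_0^r\frac{n(t,f)-n(0,f)}{t}\,dt+n(0,f)\log r$, where $\log^+x=\max\{\log x,0\}$ and $n(t,f)$ is the number of poles of $f$ in $|z|\le t$ counting multiplicity, and $T(r,f)=m(r,f)+N(r,f)$. The order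 of $f$ is $\rho(f)=\limsup_{r\to\infty}\frac{\log^+T(r,f)}{\log r}\in[0,\infty]$. "Same zeros counting multiplicities" means that a point of $\mathbb{C}$ is a zero of multiplicity $m$ of one function if and only if it is a zero of multiplicity $m$ of the other. *)

theory Defs
  imports "HOL-Complex_Analysis.Complex_Analysis" "HOL-Library.Landau_Symbols"
begin

section \<open>Nevanlinna characteristic and order of growth\<close>

definition log_plus :: "real \<Rightarrow> real" where
  "log_plus x = max (ln x) 0"

definition proximity_fun :: "(complex \<Rightarrow> complex) \<Rightarrow> real \<Rightarrow> real" where
  "proximity_fun f r =
     1 / (2 * pi) * integral {0..2 * pi} (\<lambda>\<theta>. log_plus (norm (f (of_real r * cis \<theta>))))"

text \<open>At a pole, \<^const>\<open>zorder\<close> is minus the multiplicity.\<close>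

definition pole_count :: "(complex \<Rightarrow> complex) \<Rightarrow> real \<Rightarrow> nat" where
  "pole_count f t = (\<Sum>z | is_pole f z \<and> norm z \<le> t. nat (- zorder f z))"

definition integrated_pole_count :: "(complex \<Rightarrow> complex) \<Rightarrow> real \<Rightarrow> real" where
  "integrated_pole_count f r =
     integral {0..r} (\<lambda>t. (real (pole_count f t) - real (pole_count f 0)) / t)
       + real (pole_count f 0) * ln r"

definition nevanlinna_char :: "(complex \<Rightarrow> complex) \<Rightarrow> real \<Rightarrow> real" where
  "nevanlinna_char f r = proximity_fun f r + integrated_pole_count f r"

definition growth_order :: "(complex \<Rightarrow> complex) \<Rightarrow> ereal" where
  "growth_order f = Limsup at_top (\<lambda>r. ereal (log_plus (nevanlinna_char f r) / ln r))"

section \<open>The extended Selberg class\<close>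

text \<open>
  The completed function is a meromorphic function on the plane. Poles of the Gamma factors can
  meet zeros of \<open>L\<close>, where the pointwise product is not the value of that meromorphic function;
  \<^const>\<open>remove_sings\<close> supplies the limit at such points and the value 0 at genuine poles.
\<close>

definition completed_L ::
  "real \<Rightarrow> nat \<Rightarrow> (nat \<Rightarrow> real) \<Rightarrow> (nat \<Rightarrow> complex) \<Rightarrow> (complex \<Rightarrow> complex) \<Rightarrow> complex \<Rightarrow> complex"
where
  "completed_L Q K lam mu L =
     remove_sings
       (\<lambda>s. L s * of_real Q powr s * (\<Prod>j<K. Gamma (of_real (lam j) * s + mu j)))"

definition ramanujan_hypothesis :: "(nat \<Rightarrow> complex) \<Rightarrow> bool" where
  "ramanujan_hypothesis a \<longleftrightarrow> (\<forall>\<epsilon>>0. (\<lambda>n. norm (a n)) \<in> O(\<lambda>n. real n powr \<epsilon>))"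

definition selberg_continuation :: "(complex \<Rightarrow> complex) \<Rightarrow> bool" where
  "selberg_continuation L \<longleftrightarrow>
     (\<exists>(k::nat) g. g holomorphic_on UNIV \<and> growth_order g < \<infinity> \<and>
        (\<forall>s. s \<noteq> 1 \<longrightarrow> g s = (s - 1) ^ k * L s))"

definition selberg_functional_equation :: "(complex \<Rightarrow> complex) \<Rightarrow> bool" where
  "selberg_functional_equation L \<longleftrightarrow>
     (\<exists>Q K lam mu \<omega>. Q > 0 \<and> (\<forall>j<K. lam j > 0 \<and> Re (mu j) \<ge> 0) \<and> norm \<omega> = 1 \<and>
        (\<forall>s. completed_L Q K lam mu L s = \<omega> * cnj (completed_L Q K lam mu L (1 - cnj s))))"

text \<open>
  Members are the meromorphic continuations themselves, in the normal form given by
  \<^const>\<open>nicely_meromorphic_on\<close> (no removable singularities, value 0 at poles), so that equality of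
  members as HOL functions is equality of meromorphic functions. The half-plane \<open>Re s > 1\<close> is where
  the Ramanujan hypothesis makes the series converge. The value \<open>a 0\<close> is irrelevant.
\<close>

definition extended_selberg_class :: "(complex \<Rightarrow> complex) set" where
  "extended_selberg_class =
     {L. L nicely_meromorphic_on UNIV \<and>
         (\<exists>a :: nat \<Rightarrow> complex. a 1 = 1 \<and> ramanujan_hypothesis a \<and>
            (\<forall>s. Re s > 1 \<longrightarrow> (\<lambda>n. a (Suc n) / of_nat (Suc n) powr s) sums L s)) \<and>
         selberg_continuation L \<and> selberg_functional_equation L}"

section \<open>Zeros with multiplicity\<close>

text \<open>
  \<^const>\<open>isolated_zero\<close> is defined through the limit at the point. Hence the arbitrary HOL value of a
  function at one of its poles never counts as a zero.
\<close>

definition zero_of_mult :: "(complex \<Rightarrow> complex) \<Rightarrow> complex \<Rightarrow> nat \<Rightarrow> bool" where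
  "zero_of_mult f z m \<longleftrightarrow> isolated_zero f z \<and> zorder f z = int m"

definition same_zeros_with_mult :: "(complex \<Rightarrow> complex) \<Rightarrow> (complex \<Rightarrow> complex) \<Rightarrow> bool" where
  "same_zeros_with_mult f g \<longleftrightarrow> (\<forall>z m. zero_of_mult f z m \<longleftrightarrow> zero_of_mult g z m)"

end

theory Submission
  imports Defs "HOL-Real_Asymp.Real_Asymp"
begin

text \<open>
  Multiplied by a power of \<open>s - 1\<close>, every \<open>L\<close>-function is entire of order at most 1: it is bounded
  for \<open>Re s \<ge> 2\<close>, the functional equation controls \<open>Re s \<le> -1\<close>, and Phragmen--Lindelof bridges
  the strip. If \<open>L1 - h\<close> and \<open>L2 - h\<close> have the same zeros, their quotient is
  \<open>F = (s - 1)^m exp \<phi>\<close> with \<open>\<phi>\<close> entire, where \<open>m \<ge> 0\<close> after exchanging \<open>L1\<close> and \<open>L2\<close> if necessary,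
  and \<open>L1 - L2 = (F - 1) (L2 - h)\<close>. Thus \<open>F - 1\<close>
  has no more zeros than a function of order 1; as \<open>F\<close> essentially omits 0 and \<open>\<infinity>\<close>, a version of the
  second main theorem forces \<open>F\<close> to have order at most 1, so \<open>\<phi>\<close> is affine, and
  \<open>h = L2 - (L1 - L2) / (F - 1)\<close> has order at most 1 as well, hence less than 1. A non-constant
  entire function of order less than 1 is unbounded on every vertical line, whereas \<open>L1\<close> and \<open>L2\<close>
  are bounded on \<open>Re s = c \<ge> 2\<close>; therefore \<open>F\<close> tends to 1 along a sequence on each of these lines,
  and this is only possible if \<open>F = 1\<close>.
\<close>

section \<open>Borel--Caratheodory, Blaschke factors and quotients\<close>

text \<open>Reciprocals of Gamma factors grow as fast as exp (|s| ln |s|), so order at most 1 can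
  only mean a bound exp (C (1 + |s|)^p) for every p > 1; this is why exponents p < q with a gap,
  rather than 1 itself, run through the estimates. Such pointwise bounds replace the Nevanlinna
  characteristic, which serves only to read off the growth of a given entire function and to return
  to \<open>growth_order\<close>. What they do not give directly is a bound for an entire quotient D
  / A, because A may vanish; exchanging its zeros for Blaschke factors and applying Harnack's
  inequality to the logarithm of what is left does. The factor (s - 1)^m appears because possible
  poles of L1 and L2 at 1 may make the orders of vanishing there, after clearing denominators,
  differ although the zeros of L1 - h and L2 - h agree. Order 1 has to be excluded because exp is
  bounded on vertical lines.\<close>

lemma Borel_Caratheodory:
  assumes hol: "f holomorphic_on ball 0 R"
    and le: "\<And>w. norm w < R \<Longrightarrow> Re (f w) \<le> S"
    and z: "norm z \<le> r" and r: "r < R"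
  shows "norm (f z - f 0) \<le> 2 * (S - Re (f 0)) * r / (R - r)"
proof -
  have R: "R > 0" and r0: "r \<ge> 0"
    using z r norm_ge_zero[of z] by linarith+
  \<comment> \<open>The strict inequality puts the image of \<open>k\<close> into the open
    half-plane Re < A and makes A positive even when f is constant; A tends to S - Re (f 0) by
    \<open>dense_ge\<close> below.\<close>
  have *: "norm (f z - f 0) * (R - r) \<le> 2 * A * r" if A: "A > S - Re (f 0)" for A
  proof -
    define k where "k = (\<lambda>w. f (of_real R * w) - f 0)"
    have A0: "A > 0" using A le[of 0] R by simp
    have in_ball: "norm (of_real R * w) < R" if "norm w < 1" for w :: complex
      using that R by (simp add: norm_mult)
    have Rek: "Re (k w) < A" if "norm w < 1" for w
      using le[OF in_ball[OF that]] A by (simp add: k_def)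
    have nk: "norm (k w) < norm (2 * of_real A - k w)" if "norm w < 1" for w
    proof -
      have "(norm (2 * of_real A - k w))\<^sup>2 - (norm (k w))\<^sup>2 = 4 * A * (A - Re (k w))"
        unfolding cmod_power2 by (simp add: power2_eq_square algebra_simps)
      also have "\<dots> > 0" using Rek[OF that] A0 by simp
      finally show ?thesis by (simp add: power2_less_imp_less)
    qed
    \<comment> \<open>The Moebius map x / (2 A - x) sends the half-plane Re x < A to the unit disc
      and fixes 0, which is the normalisation of Schwarz's lemma.\<close>
    define g where "g = (\<lambda>w. k w / (2 * of_real A - k w))"
    have holk: "k holomorphic_on ball 0 1"
      unfolding k_def
      by (intro holomorphic_intros holomorphic_on_compose_gen[OF _ hol, unfolded o_def])
         (use in_ball in auto)
    have nz: "2 * of_real A - k w \<noteq> 0" if "norm w < 1" for w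
      using nk[OF that] by (metis norm_ge_zero norm_zero not_less)
    have "g holomorphic_on ball 0 1"
      unfolding g_def by (intro holomorphic_intros holk) (use nz in auto)
    moreover have "g 0 = 0" by (simp add: g_def k_def)
    moreover have "norm (g w) < 1" if "norm w < 1" for w
      using nk[OF that] nz[OF that] by (simp add: g_def norm_divide)
    moreover have zR: "norm (z / of_real R) < 1"
      using z r R by (simp add: norm_divide)
    ultimately have "norm (g (z / of_real R)) \<le> norm (z / of_real R)"
      by (rule Schwarz_Lemma)
    moreover have "k (z / of_real R) = f z - f 0" using R by (simp add: k_def)
    ultimately have "norm (f z - f 0) / norm (2 * of_real A - (f z - f 0)) \<le> norm z / R"
      using R by (simp add: g_def norm_divide)
    hence "norm (f z - f 0) \<le> norm z / R * norm (2 * of_real A - (f z - f 0))"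
      using nz[OF zR] \<open>k (z / of_real R) = f z - f 0\<close> by (simp add: divide_le_eq)
    also have "norm (2 * of_real A - (f z - f 0)) \<le> 2 * A + norm (f z - f 0)"
      using norm_triangle_ineq4[of "2 * of_real A" "f z - f 0"] A0 by (simp add: norm_mult)
    finally have "norm (f z - f 0) \<le> norm z / R * (2 * A + norm (f z - f 0))"
      using R by (meson mult_left_mono divide_nonneg_pos norm_ge_zero order_trans)
    hence "norm (f z - f 0) * (R - norm z) \<le> 2 * A * norm z"
      using R by (simp add: field_simps)
    moreover have "norm (f z - f 0) * (R - r) \<le> norm (f z - f 0) * (R - norm z)"
      using z by (intro mult_left_mono) auto
    moreover have "2 * A * norm z \<le> 2 * A * r" using z A0 by simp
    ultimately show ?thesis by linarith
  qed
  have "norm (f z - f 0) * (R - r) \<le> 2 * (S - Re (f 0)) * r"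
  proof (cases "r = 0")
    case True thus ?thesis using z by simp
  next
    case False
    hence "r > 0" using r0 by simp
    have "norm (f z - f 0) * (R - r) / (2 * r) \<le> S - Re (f 0)"
      by (rule dense_ge) (use * \<open>r > 0\<close> in \<open>auto simp: field_simps\<close>)
    thus ?thesis using \<open>r > 0\<close> by (simp add: field_simps)
  qed
  thus ?thesis using r by (simp add: field_simps)
qed

text \<open>Cauchy's estimate on a disc of radius d = (R - r) / 2 about z, on which the preceding
  inequality is used with r + d; the remaining distance to R is again d, hence the square in the
  denominator.\<close>

lemma Borel_Caratheodory_deriv:
  assumes hol: "f holomorphic_on ball 0 R"
    and le: "\<And>w. norm w < R \<Longrightarrow> Re (f w) \<le> S"
    and z: "norm z \<le> r" and r: "r < R"
  shows "norm (deriv f z) \<le> 8 * R * (S - Re (f 0)) / (R - r)\<^sup>2"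
proof -
  define d where "d = (R - r) / 2"
  have d: "d > 0" using r by (simp add: d_def)
  have r0: "r \<ge> 0" using z norm_ge_zero[of z] by linarith
  have SR: "S - Re (f 0) \<ge> 0" using le[of 0] r r0 by simp
  have sub: "norm w \<le> r + d" if "norm (w - z) \<le> d" for w
    using norm_triangle_ineq[of "w - z" z] that z by simp
  have sub': "cball z d \<subseteq> ball 0 R"
  proof
    fix w assume "w \<in> cball z d"
    hence "norm w \<le> r + d" by (intro sub) (simp add: dist_norm norm_minus_commute)
    thus "w \<in> ball 0 R" using r by (simp add: d_def field_simps)
  qed
  have 1: "norm (f w - f 0) \<le> 4 * R * (S - Re (f 0)) / (R - r)" if "norm (w - z) \<le> d" for w
  proof -
    have "norm (f w - f 0) \<le> 2 * (S - Re (f 0)) * (r + d) / (R - (r + d))"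
      by (rule Borel_Caratheodory[OF hol le sub[OF that]]) (use r in \<open>auto simp: d_def field_simps\<close>)
    also have "\<dots> \<le> 2 * (S - Re (f 0)) * R / d"
      using SR d r r0 by (intro frac_le mult_left_mono mult_nonneg_nonneg) (auto simp: d_def field_simps)
    finally show ?thesis by (simp add: d_def mult_ac)
  qed
  have holg: "(\<lambda>w. f w - f 0) holomorphic_on cball z d"
    by (intro holomorphic_intros holomorphic_on_subset[OF hol sub'])
  have "norm ((deriv ^^ 1) (\<lambda>w. f w - f 0) z) \<le> fact 1 * (4 * R * (S - Re (f 0)) / (R - r)) / d ^ 1"
  proof (rule Cauchy_inequality)
    show "(\<lambda>w. f w - f 0) holomorphic_on ball z d"
      using holg ball_subset_cball holomorphic_on_subset by blast
    show "continuous_on (cball z d) (\<lambda>w. f w - f 0)"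
      using holg holomorphic_on_imp_continuous_on by blast
  qed (use d 1 in \<open>auto simp: norm_minus_commute\<close>)
  moreover have "deriv (\<lambda>w. f w - f 0) z = deriv f z"
  proof -
    have "z \<in> cball z d" using d by simp
    hence "z \<in> ball 0 R" using sub' by blast
    then have "f field_differentiable at z"
      using hol holomorphic_on_imp_differentiable_at by blast
    thus ?thesis by (simp add: deriv_diff)
  qed
  ultimately show ?thesis by (simp add: d_def power2_eq_square)
qed

text \<open>Borel-Caratheodory for - f with S = 0; the constant 1 + 2 r / (R - r) is (R + r) / (R -
  r).\<close>

lemma Harnack_upper:
  assumes hol: "f holomorphic_on ball 0 R"
    and ge: "\<And>w. norm w < R \<Longrightarrow> 0 \<le> Re (f w)"
    and z: "norm z \<le> r" and r: "r < R"
  shows "Re (f z) \<le> (R + r) / (R - r) * Re (f 0)"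
proof -
  have "norm ((\<lambda>w. - f w) z - (\<lambda>w. - f w) 0) \<le> 2 * (0 - Re (- f 0)) * r / (R - r)"
    by (rule Borel_Caratheodory) (use assms in \<open>auto intro!: holomorphic_intros\<close>)
  hence "norm (f z - f 0) \<le> 2 * Re (f 0) * r / (R - r)"
    by (simp add: norm_minus_commute)
  moreover have "Re (f z) - Re (f 0) \<le> norm (f z - f 0)"
    using complex_Re_le_cmod[of "f z - f 0"] by simp
  ultimately have "Re (f z) \<le> Re (f 0) + 2 * Re (f 0) * r / (R - r)" by linarith
  also have "\<dots> = (R + r) / (R - r) * Re (f 0)"
    using r by (simp add: field_simps)
  finally show ?thesis .
qed

section \<open>Zeros in a disc, Blaschke factors and bounds for quotients\<close>

lemma maximum_modulus_cball:
  assumes hol: "f holomorphic_on ball 0 R'" and R: "0 < R" "R < R'"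
    and le: "\<And>w. norm w = R \<Longrightarrow> norm (f w) \<le> B" and z: "norm z \<le> R"
  shows "norm (f z) \<le> B"
proof (rule maximum_modulus_frontier[of f "cball 0 R"])
  have sub: "cball 0 R \<subseteq> ball (0::complex) R'" using R by auto
  show "f holomorphic_on interior (cball 0 R)"
    by (rule holomorphic_on_subset[OF hol]) (use sub in auto)
  show "continuous_on (closure (cball 0 R)) f"
    by (rule holomorphic_on_imp_continuous_on, rule holomorphic_on_subset[OF hol]) (use sub in auto)
  fix w assume "w \<in> frontier (cball (0::complex) R)"
  hence "norm w = R" using R by (simp add: frontier_cball)
  thus "norm (f w) \<le> B" by (rule le)
qed (use z in auto)

lemma holomorphic_factor_root:
  assumes "f holomorphic_on S" "open S" and root: "f a = 0"
  obtains g where "g holomorphic_on S" "\<And>z. f z = (z - a) * g z"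
proof
  show "(\<lambda>z. if z = a then deriv f a else (f z - f a) / (z - a)) holomorphic_on S"
    by (rule pole_lemma_open) fact+
qed (use root in auto)

lemma Blaschke_norm_on_circle:
  fixes z a :: complex
  assumes "norm z = \<rho>"
  shows "norm (of_real \<rho> ^ 2 - cnj a * z) = \<rho> * norm (z - a)"
proof -
  have "of_real \<rho> ^ 2 = z * cnj z"
    using assms by (simp add: complex_norm_square[symmetric])
  hence "of_real \<rho> ^ 2 - cnj a * z = z * cnj (z - a)" by (simp add: algebra_simps)
  thus ?thesis using assms by (metis complex_mod_cnj norm_mult)
qed

text \<open>On the circle the factor (\<rho>^2 - cnj a z) / \<rho> has the modulus of z - a, so
  replacing the chosen zeros by such factors keeps the bound M there; the maximum principle carries
  it inside.\<close>

lemma Blaschke_bound: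
  assumes hol: "g holomorphic_on ball 0 R'" and f: "\<And>z. f z = (\<Prod>i<n. z - a i) * g z"
    and \<rho>: "0 < \<rho>" "\<rho> < R'"
    and M: "\<And>z. norm z = \<rho> \<Longrightarrow> norm (f z) \<le> M" and z: "norm z \<le> \<rho>"
  shows "norm (g z * (\<Prod>i<n. (of_real \<rho> ^ 2 - cnj (a i) * z) / of_real \<rho>)) \<le> M"
proof (rule maximum_modulus_cball[where R = \<rho> and R' = R' and z = z and
      f = "\<lambda>z. g z * (\<Prod>i<n. (of_real \<rho> ^ 2 - cnj (a i) * z) / of_real \<rho>)"])
  show "(\<lambda>z. g z * (\<Prod>i<n. (of_real \<rho> ^ 2 - cnj (a i) * z) / of_real \<rho>)) holomorphic_on ball 0 R'"
    using \<rho> by (intro holomorphic_intros hol) auto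
  fix w :: complex assume w: "norm w = \<rho>"
  have "norm ((of_real \<rho> ^ 2 - cnj (a i) * w) / of_real \<rho>) = norm (w - a i)" for i
    using Blaschke_norm_on_circle[OF w, of "a i"] \<rho> by (simp add: norm_divide)
  hence "norm (g w * (\<Prod>i<n. (of_real \<rho> ^ 2 - cnj (a i) * w) / of_real \<rho>)) = norm (f w)"
    by (simp add: f norm_mult prod_norm[symmetric])
  also have "\<dots> \<le> M" by (rule M[OF w])
  finally show "norm (g w * (\<Prod>i<n. (of_real \<rho> ^ 2 - cnj (a i) * w) / of_real \<rho>)) \<le> M" .
qed (use \<rho> z in auto)

text \<open>Jensen's inequality in product form: at 0 each Blaschke factor has modulus \<rho>,
  whereas each removed zero contributes at most R.\<close>

lemma zero_count_bound:
  assumes hol: "g holomorphic_on ball 0 R'" and f: "\<And>z. f z = (\<Prod>i<n. z - a i) * g z"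
    and a: "\<And>i. i < n \<Longrightarrow> norm (a i) \<le> R" and R: "0 < R" "R < \<rho>" "\<rho> < R'"
    and M: "\<And>z. norm z = \<rho> \<Longrightarrow> norm (f z) \<le> M"
  shows "(\<rho> / R) ^ n * norm (f 0) \<le> M"
proof -
  have "norm (g 0 * (\<Prod>i<n. (of_real \<rho> ^ 2 - cnj (a i) * 0) / of_real \<rho>)) \<le> M"
    by (rule Blaschke_bound[OF hol f _ _ M]) (use R in auto)
  hence g0: "\<rho> ^ n * norm (g 0) \<le> M"
    using R by (simp add: norm_mult norm_power norm_divide power2_eq_square mult.commute)
  have "norm (f 0) = (\<Prod>i<n. norm (a i)) * norm (g 0)"
    by (simp add: f norm_mult prod_norm[symmetric])
  also have "\<dots> \<le> R ^ n * norm (g 0)"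
    using prod_mono[of "{..<n}" "\<lambda>i. norm (a i)" "\<lambda>_. R"] a by (intro mult_right_mono) auto
  finally have "(\<rho> / R) ^ n * norm (f 0) \<le> (\<rho> / R) ^ n * (R ^ n * norm (g 0))"
    using R by (intro mult_left_mono) auto
  also have "\<dots> = \<rho> ^ n * norm (g 0)" using R by (simp add: power_divide)
  finally show ?thesis using g0 by linarith
qed

text \<open>Zeros are split off one at a time as linear factors, so no multiplicities have to be
  handled. \<open>zero_count_bound\<close> limits the number n of factors, and for the largest
  possible n the cofactor g cannot vanish on the closed disc.\<close>

lemma holomorphic_zero_factorization:
  assumes hol: "f holomorphic_on ball 0 R'" and f0: "f 0 \<noteq> 0" and R: "0 < R" "R < R'"
  obtains n :: nat and a and g :: "complex \<Rightarrow> complex"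
  where "g holomorphic_on ball 0 R'" "\<And>z. f z = (\<Prod>i<n. z - a i) * g z"
    "\<And>i. i < n \<Longrightarrow> norm (a i) \<le> R" "\<And>z. norm z \<le> R \<Longrightarrow> g z \<noteq> 0"
proof -
  define Q where "Q = (\<lambda>n::nat. \<exists>a g. g holomorphic_on ball 0 R' \<and> (\<forall>z. f z = (\<Prod>i<n. z - a i) * g z)
    \<and> (\<forall>i<n. norm (a i) \<le> R))"
  obtain \<rho> where \<rho>: "R < \<rho>" "\<rho> < R'" using R dense by blast
  have "compact (f ` sphere 0 \<rho>)"
    by (intro compact_continuous_image holomorphic_on_imp_continuous_on holomorphic_on_subset[OF hol])
       (use \<rho> in auto)
  then obtain M where M: "\<And>z. norm z = \<rho> \<Longrightarrow> norm (f z) \<le> M"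
    using compact_imp_bounded bounded_iff by (metis (no_types, opaque_lifting) image_eqI mem_sphere_0)
  have gt1: "\<rho> / R > 1" using R \<rho> by simp
  obtain N where N: "M / norm (f 0) < (\<rho> / R) ^ N" using real_arch_pow[OF gt1] by auto
  have bound: "n \<le> N" if "Q n" for n
  proof (rule ccontr)
    assume "\<not> n \<le> N"
    from that obtain a g where "g holomorphic_on ball 0 R'" "\<And>z. f z = (\<Prod>i<n. z - a i) * g z"
      "\<And>i. i < n \<Longrightarrow> norm (a i) \<le> R" unfolding Q_def by blast
    from zero_count_bound[OF this R(1) \<rho> M] have "(\<rho> / R) ^ n * norm (f 0) \<le> M" by blast
    moreover have "(\<rho> / R) ^ N \<le> (\<rho> / R) ^ n"
      using \<open>\<not> n \<le> N\<close> gt1 by (intro power_increasing) auto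
    ultimately show False using N f0
      by (meson divide_less_eq less_le_not_le mult_right_mono norm_ge_zero order_trans zero_less_norm_iff)
  qed
  have "Q 0" unfolding Q_def by (rule exI[of _ undefined], rule exI[of _ f]) (use hol in auto)
  obtain n where n: "Q n" "\<And>m. Q m \<Longrightarrow> m \<le> n"
    using GreatestI_nat[of Q, OF \<open>Q 0\<close>] Greatest_le_nat[of Q] bound by metis
  from n(1) obtain a g where g: "g holomorphic_on ball 0 R'" "\<And>z. f z = (\<Prod>i<n. z - a i) * g z"
      "\<And>i. i < n \<Longrightarrow> norm (a i) \<le> R" unfolding Q_def by blast
  show thesis
  proof (rule that[OF g])
    fix z :: complex assume z: "norm z \<le> R"
    show "g z \<noteq> 0"
    proof
      assume "g z = 0"
      then obtain g' where g': "g' holomorphic_on ball 0 R'" "\<And>w. g w = (w - z) * g' w"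
        using holomorphic_factor_root[OF g(1) open_ball] by blast
      have "Q (Suc n)" unfolding Q_def
        by (rule exI[of _ "a(n := z)"], rule exI[of _ g']) (use g g' z in \<open>auto simp: less_Suc_eq\<close>)
      with n(2) show False by fastforce
    qed
  qed auto
qed

lemma holomorphic_log_on_ball:
  assumes "f holomorphic_on ball 0 R" "\<And>z. norm z < R \<Longrightarrow> f z \<noteq> 0"
  obtains g where "g holomorphic_on ball 0 R" "\<And>z. norm z < R \<Longrightarrow> f z = exp (g z)"
proof -
  have "simply_connected (ball (0::complex) R)"
    by (simp add: convex_imp_simply_connected)
  with assms show thesis
    using that simply_connected_eq_holomorphic_log[OF open_ball, of 0 R] by (metis mem_ball_0)
qed

text \<open>No lower bound for A is available near its zeros. With g the cofactor left after
  splitting off these zeros and B the product of their Blaschke factors for radius \<rho>, the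
  functions g B and g H B obey the bounds for A and A H. Since g B has no zeros on |w| \<le> R,
  Harnack applies to ln (MA / |g B|), and H is the quotient of g H B by g B.\<close>

lemma holomorphic_quotient_bound:
  assumes holA: "A holomorphic_on ball 0 R'" and holH: "H holomorphic_on ball 0 R'"
    and A0: "A 0 \<noteq> 0" and r: "norm z \<le> r" "r < R" "R < \<rho>" "\<rho> < R'"
    and MA: "\<And>w. norm w = \<rho> \<Longrightarrow> norm (A w) \<le> MA"
    and MD: "\<And>w. norm w = \<rho> \<Longrightarrow> norm (A w * H w) \<le> MD"
  shows "norm (H z) \<le> MD / MA * exp ((R + r) / (R - r) * ln (MA / norm (A 0)))"
proof -
  have pos: "0 \<le> r" "0 < R" "0 < \<rho>" "0 < R'" using r norm_ge_zero[of z] by linarith+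
  obtain n :: nat and a g where g: "g holomorphic_on ball 0 R'" "\<And>z. A z = (\<Prod>i<n. z - a i) * g z"
    "\<And>i. i < n \<Longrightarrow> norm (a i) \<le> R" "\<And>z. norm z \<le> R \<Longrightarrow> g z \<noteq> 0"
    by (rule holomorphic_zero_factorization[OF holA A0, of R]) (use pos r in auto)
  define B where "B = (\<lambda>w. \<Prod>i<n. (of_real \<rho> ^ 2 - cnj (a i) * w) / of_real \<rho>)"
  have Bg: "norm (g w * B w) \<le> MA" if "norm w \<le> \<rho>" for w
    unfolding B_def by (rule Blaschke_bound[OF g(1,2) _ _ MA that]) (use r pos in auto)
  have BgH: "norm ((g w * H w) * B w) \<le> MD" if "norm w \<le> \<rho>" for w
    unfolding B_def
    by (rule Blaschke_bound[where f = "\<lambda>w. A w * H w" and R' = R', OF _ _ _ _ MD that])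
       (use r pos g holH in \<open>auto intro!: holomorphic_intros\<close>)
  have Bnz: "B w \<noteq> 0" if "norm w \<le> R" for w
  proof -
    have "of_real \<rho> ^ 2 - cnj (a i) * w \<noteq> 0" if "i < n" for i
    proof
      assume "of_real \<rho> ^ 2 - cnj (a i) * w = 0"
      hence "norm (of_real \<rho> ^ 2 :: complex) = norm (a i) * norm w"
        by (metis complex_mod_cnj eq_iff_diff_eq_0 norm_mult)
      hence "\<rho> ^ 2 = norm (a i) * norm w" by (simp add: norm_power)
      also have "\<dots> \<le> R * R" using g(3)[OF that] \<open>norm w \<le> R\<close> pos by (intro mult_mono) auto
      also have "\<dots> < \<rho> * \<rho>" using r pos by (intro mult_strict_mono) auto
      finally show False by (simp add: power2_eq_square)
    qed
    thus ?thesis using pos by (simp add: B_def)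
  qed
  have MA0: "MA > 0"
    using Bg[of 0] g(4)[of 0] Bnz[of 0] pos by (metis less_le_trans mult_eq_0_iff norm_zero order_less_imp_le zero_less_norm_iff)
  have holB: "B holomorphic_on ball 0 R" unfolding B_def using pos by (intro holomorphic_intros) auto
  have "g holomorphic_on ball 0 R" by (rule holomorphic_on_subset[OF g(1)]) (use r in auto)
  hence "(\<lambda>w. of_real MA / (g w * B w)) holomorphic_on ball 0 R"
    using g(4) Bnz by (intro holomorphic_intros holB) auto
  then obtain u where u: "u holomorphic_on ball 0 R"
      "\<And>w. norm w < R \<Longrightarrow> of_real MA / (g w * B w) = exp (u w)"
    using holomorphic_log_on_ball[of "\<lambda>w. of_real MA / (g w * B w)" R] g(4) Bnz MA0 by auto
  have eu: "exp (Re (u w)) = MA / norm (g w * B w)" if "norm w < R" for w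
    using arg_cong[OF u(2)[OF that], of norm] MA0 by (simp add: norm_divide)
  have "Re (u z) \<le> (R + r) / (R - r) * Re (u 0)"
  proof (rule Harnack_upper[OF u(1)])
    fix w :: complex assume w: "norm w < R"
    have "norm (g w * B w) > 0" using g(4) Bnz w by simp
    moreover have "norm (g w * B w) \<le> MA" using Bg w r by simp
    ultimately have "1 \<le> exp (Re (u w))" unfolding eu[OF w] by simp
    thus "0 \<le> Re (u w)" by simp
  qed (use r in auto)
  also have "\<dots> \<le> (R + r) / (R - r) * ln (MA / norm (A 0))"
  proof (rule mult_left_mono)
    \<comment> \<open>At 0 the exchange of factors can only increase the modulus:
      \<open>norm (a i)\<close> is replaced by \<rho>.\<close>
    have "norm (A 0) \<le> norm (g 0 * B 0)"
    proof -
      have "(\<Prod>i<n. norm (a i)) \<le> \<rho> ^ n"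
        using prod_mono[of "{..<n}" "\<lambda>i. norm (a i)" "\<lambda>_. \<rho>"] g(3) r by force
      moreover have "norm (B 0) = \<rho> ^ n"
        using pos by (simp add: B_def norm_power norm_divide power2_eq_square)
      ultimately have "(\<Prod>i<n. norm (a i)) * norm (g 0) \<le> norm (B 0) * norm (g 0)"
        by (intro mult_right_mono) auto
      thus ?thesis
        by (simp add: g(2) norm_mult prod_norm[symmetric] mult.commute)
    qed
    hence "MA / norm (g 0 * B 0) \<le> MA / norm (A 0)"
      using A0 MA0 by (intro divide_left_mono) (use g(4)[of 0] Bnz[of 0] pos in \<open>auto simp: norm_mult\<close>)
    hence "ln (exp (Re (u 0))) \<le> ln (MA / norm (A 0))"
      using eu[of 0] pos by (metis exp_gt_zero ln_mono norm_zero)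
    thus "Re (u 0) \<le> ln (MA / norm (A 0))" by simp
  qed (use r pos in auto)
  finally have uz: "Re (u z) \<le> (R + r) / (R - r) * ln (MA / norm (A 0))" .
  have z: "norm z < R" using r by simp
  have gB: "norm (g z * B z) > 0" using g(4) Bnz z by simp
  have "norm (H z) = norm (g z * H z * B z) / norm (g z * B z)"
    using g(4)[of z] Bnz[of z] z by (simp add: norm_mult)
  also have "\<dots> \<le> MD / norm (g z * B z)"
    using BgH[of z] z r gB by (intro divide_right_mono) auto
  also have "\<dots> = MD / MA * exp (Re (u z))"
    unfolding eu[OF z] using MA0 by simp
  also have "\<dots> \<le> MD / MA * exp ((R + r) / (R - r) * ln (MA / norm (A 0)))"
  proof (intro mult_left_mono)
    have "0 \<le> MD" using order_trans[OF norm_ge_zero BgH[of 0]] pos by simp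
    thus "0 \<le> MD / MA" using MA0 by simp
  qed (use uz in auto)
  finally show ?thesis .
qed

section \<open>From the proximity function to pointwise bounds\<close>

text \<open>Restricted to the unit circle these are the real trigonometric polynomials. Keeping them
  as sums of real parts of complex monomials builds in the harmonic extension to the disc; the price
  is that closure under products is available only on the circle.\<close>

inductive trig_poly :: "(complex \<Rightarrow> real) \<Rightarrow> bool" where
  monom: "trig_poly (\<lambda>z. Re (c * z ^ n))"
| add: "trig_poly f \<Longrightarrow> trig_poly g \<Longrightarrow> trig_poly (\<lambda>z. f z + g z)"

lemma trig_poly_eq_Re_entire:
  assumes "trig_poly f"
  shows "\<exists>k. k holomorphic_on UNIV \<and> (\<forall>z. f z = Re (k z))"
  using assms
proof induction
  case (monom c n)
  show ?case by (rule exI[of _ "\<lambda>z. c * z ^ n"]) (auto intro!: holomorphic_intros)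
next
  case (add f g)
  then obtain k l where "k holomorphic_on UNIV" "\<forall>z. f z = Re (k z)"
    "l holomorphic_on UNIV" "\<forall>z. g z = Re (l z)" by blast
  thus ?case by (intro exI[of _ "\<lambda>z. k z + l z"]) (auto intro!: holomorphic_intros)
qed

text \<open>Re a Re b is half of Re (a b) + Re (a cnj b), and cnj z is the inverse of z on the
  circle; m \<le> n keeps the exponent n - m a natural number.\<close>

lemma trig_poly_monom_mult_le:
  assumes "m \<le> n"
  shows "\<exists>h. trig_poly h \<and> (\<forall>z. norm z = 1 \<longrightarrow> Re (c * z ^ n) * Re (d * z ^ m) = h z)"
proof (intro exI conjI allI impI)
  define h where "h = (\<lambda>z. Re (c * d / 2 * z ^ (n + m)) + Re (c * cnj d / 2 * z ^ (n - m)))"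
  show "trig_poly h" unfolding h_def by (intro trig_poly.intros)
  fix z :: complex assume z: "norm z = 1"
  have "z ^ n * cnj z ^ m = z ^ (n - m) * (z * cnj z) ^ m"
  proof -
    obtain k where "n = m + k" using assms le_Suc_ex by blast
    thus ?thesis by (simp add: power_add power_mult_distrib)
  qed
  also have "z * cnj z = 1" using z by (simp flip: complex_norm_square)
  finally have *: "z ^ n * cnj z ^ m = z ^ (n - m)" by simp
  have "Re a * Re b = Re (a * b / 2) + Re (a * cnj b / 2)" for a b :: complex
    by (simp add: field_simps)
  hence "Re (c * z ^ n) * Re (d * z ^ m) =
      Re (c * z ^ n * (d * z ^ m) / 2) + Re (c * z ^ n * cnj (d * z ^ m) / 2)" by blast
  also have "c * z ^ n * cnj (d * z ^ m) = c * cnj d * (z ^ n * cnj z ^ m)" by (simp add: mult_ac)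
  finally show "Re (c * z ^ n) * Re (d * z ^ m) = h z" unfolding * h_def
    by (simp add: power_add mult_ac)
qed

lemma trig_poly_mult:
  assumes "trig_poly f" "trig_poly g"
  shows "\<exists>h. trig_poly h \<and> (\<forall>z. norm z = 1 \<longrightarrow> f z * g z = h z)"
  using assms(1)
proof induction
  case (monom c n)
  show ?case using assms(2)
  proof induction
    case (monom d m)
    show ?case
      using trig_poly_monom_mult_le[of m n c d] trig_poly_monom_mult_le[of n m d c]
      by (cases "m \<le> n") (auto simp: mult.commute)
  next
    case (add f' g')
    then obtain h1 h2 where "trig_poly h1" "\<forall>z. norm z = 1 \<longrightarrow> Re (c * z ^ n) * f' z = h1 z"
      "trig_poly h2" "\<forall>z. norm z = 1 \<longrightarrow> Re (c * z ^ n) * g' z = h2 z" by blast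
    thus ?case
      by (intro exI[of _ "\<lambda>z. h1 z + h2 z"]) (auto intro: trig_poly.add simp: distrib_left)
  qed
next
  case (add f' g')
  then obtain h1 h2 where "trig_poly h1" "\<forall>z. norm z = 1 \<longrightarrow> f' z * g z = h1 z"
    "trig_poly h2" "\<forall>z. norm z = 1 \<longrightarrow> g' z * g z = h2 z" by blast
  thus ?case
    by (intro exI[of _ "\<lambda>z. h1 z + h2 z"]) (auto intro: trig_poly.add simp: distrib_right)
qed

text \<open>Connects with Stone-Weierstrass, whose polynomials in Re z and Im z need not be
  harmonic; on the circle they may be traded for real parts of complex polynomials.\<close>

lemma real_polynomial_eq_trig_poly:
  fixes p :: "complex \<Rightarrow> real"
  assumes "real_polynomial_function p"
  shows "\<exists>h. trig_poly h \<and> (\<forall>z. norm z = 1 \<longrightarrow> p z = h z)"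
  using assms
proof (induction rule: real_polynomial_function.induct)
  case (linear p)
  interpret bounded_linear p by fact
  \<comment> \<open>A real linear p is determined by its values at 1 and \<i>: for z = x + \<i> y, x
    p(1) + y p(\<i>) is the real part of (p(1) - \<i> p(\<i>)) z.\<close>
  have "p z = Re (Complex (p 1) (- p \<i>) * z ^ 1)" for z
  proof -
    have "p z = p (Re z *\<^sub>R 1 + Im z *\<^sub>R \<i>)"
      by (rule arg_cong[where f = p]) (simp add: complex_eq_iff)
    also have "\<dots> = Re z * p 1 + Im z * p \<i>" by (simp only: add scaleR real_scaleR_def)
    finally show ?thesis by simp
  qed
  with trig_poly.monom[of "Complex (p 1) (- p \<i>)" 1] show ?case by blast
next
  case (const c)
  show ?case by (intro exI[of _ "\<lambda>z. Re (of_real c * z ^ 0)"] conjI trig_poly.monom) auto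
next
  case (add f g)
  then obtain h1 h2 where "trig_poly h1" "\<forall>z. norm z = 1 \<longrightarrow> f z = h1 z"
    "trig_poly h2" "\<forall>z. norm z = 1 \<longrightarrow> g z = h2 z" by blast
  thus ?case by (intro exI[of _ "\<lambda>z. h1 z + h2 z"]) (auto intro: trig_poly.add)
next
  case (mult f g)
  then obtain h1 h2 where h: "trig_poly h1" "\<forall>z. norm z = 1 \<longrightarrow> f z = h1 z"
    "trig_poly h2" "\<forall>z. norm z = 1 \<longrightarrow> g z = h2 z" by blast
  with trig_poly_mult[OF h(1,3)] show ?case by auto
qed

lemma Re_entire_dense_on_circle:
  fixes v :: "complex \<Rightarrow> real"
  assumes "continuous_on (sphere 0 1) v" "e > 0"
  obtains k where "k holomorphic_on UNIV" "\<And>z. norm z = 1 \<Longrightarrow> \<bar>v z - Re (k z)\<bar> < e"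
proof -
  obtain p where p: "real_polynomial_function p" "\<And>z. z \<in> sphere 0 1 \<Longrightarrow> \<bar>v z - p z\<bar> < e"
    using Stone_Weierstrass_real_polynomial_function[of "sphere 0 1" v e] assms by auto
  from real_polynomial_eq_trig_poly[OF p(1)] trig_poly_eq_Re_entire obtain k
    where "k holomorphic_on UNIV" "\<forall>z. norm z = 1 \<longrightarrow> p z = Re (k z)" by metis
  thus ?thesis using p(2) by (intro that[of k]) auto
qed

lemma Re_entire_mean_value:
  assumes "k holomorphic_on UNIV"
  shows "((\<lambda>\<theta>. Re (k (cis \<theta>))) has_integral (2 * pi * Re (k 0))) {0..2 * pi}"
proof -
  have "((\<lambda>u. k u / (u - 0)) has_contour_integral (2 * of_real pi * \<i> * k 0)) (circlepath 0 1)"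
    by (rule Cauchy_integral_circlepath_simple) (auto intro!: holomorphic_on_subset[OF assms])
  hence "((\<lambda>\<theta>. \<i> * k (cis \<theta>)) has_integral (2 * of_real pi * \<i> * k 0)) {0..2 * pi}"
    unfolding circlepath_def by (subst (asm) has_contour_integral_part_circlepath_iff) (auto simp: mult_ac)
  from has_integral_linear[OF this bounded_linear_Im] show ?thesis
    by (simp add: o_def mult_ac)
qed

lemma log_plus_nonneg [simp]: "0 \<le> log_plus x"
  by (simp add: log_plus_def)

text \<open>This form is visibly continuous at 0, which gives the continuity of log+ |f| at the
  zeros of f.\<close>

lemma log_plus_eq_ln_max: "0 \<le> x \<Longrightarrow> log_plus x = ln (max 1 x)"
  by (cases "x = 0") (auto simp: log_plus_def max_def)

lemma le_exp_log_plus: "0 \<le> x \<Longrightarrow> x \<le> exp (log_plus x)"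
  by (simp add: log_plus_eq_ln_max)

lemma log_plus_le:
  assumes "0 \<le> x" "x \<le> exp y" "0 \<le> y"
  shows "log_plus x \<le> y"
proof -
  have "ln (max 1 x) \<le> ln (exp y)" using assms by (subst ln_le_cancel_iff) auto
  thus ?thesis using assms by (simp add: log_plus_eq_ln_max)
qed

lemma continuous_on_log_plus_norm [continuous_intros]:
  assumes "continuous_on S f"
  shows "continuous_on S (\<lambda>x. log_plus (norm (f x)))"
proof -
  have "continuous_on S (\<lambda>x. ln (max 1 (norm (f x))))"
    by (intro continuous_intros assms) auto
  thus ?thesis by (simp add: log_plus_eq_ln_max)
qed

text \<open>
  Majorising \<open>log\<^sup>+ |f|\<close> on the circle by the real part of a polynomial makes Harnack's inequality
  applicable, whether or not \<open>f\<close> has zeros on the circle or in the disc.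
\<close>
lemma log_plus_le_proximity:
  assumes hol: "f holomorphic_on UNIV" and z: "norm z \<le> r" "r < R"
  shows "log_plus (norm (f z)) \<le> (R + r) / (R - r) * proximity_fun f R"
proof -
  have pos: "0 \<le> r" "0 < R" using z norm_ge_zero[of z] by linarith+
  define c where "c = (R + r) / (R - r)"
  have c: "c > 0" using pos z by (simp add: c_def)
  define F where "F = (\<lambda>w. f (of_real R * w))"
  have holF: "F holomorphic_on UNIV"
    unfolding F_def
    by (intro holomorphic_on_compose_gen[OF _ hol, unfolded o_def] holomorphic_intros) auto
  have contF: "continuous_on A F" for A
    using holomorphic_on_imp_continuous_on[OF holF] continuous_on_subset by blast
  define v where "v = (\<lambda>w. log_plus (norm (F w)))"
  have contv: "continuous_on A v" for A unfolding v_def by (intro continuous_intros contF)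
  define z' where "z' = z / of_real R"
  have z': "norm z' \<le> r / R" "r / R < 1" "F z' = f z"
    using pos z by (auto simp: z'_def F_def norm_divide divide_right_mono)
  have *: "log_plus (norm (f z)) \<le> c * (proximity_fun f R + 2 * e)" if e: "e > 0" for e
  proof -
    obtain k where k: "k holomorphic_on UNIV" "\<And>w. norm w = 1 \<Longrightarrow> \<bar>v w - Re (k w)\<bar> < e"
      using Re_entire_dense_on_circle[OF contv e] by metis
    \<comment> \<open>After the shift by e, Re u lies between v and v + 2 e on the circle. Hence exp
      (- u) and F exp (- u) have modulus at most 1 there and, by the maximum principle, in the disc:
      the former gives the non-negativity that Harnack requires, the latter log |F| \<le> Re
      u.\<close>
    define u where "u = (\<lambda>w. k w + of_real e)"
    have holu: "u holomorphic_on A" for A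
      unfolding u_def by (intro holomorphic_intros holomorphic_on_subset[OF k(1)]) auto
    have u: "v w \<le> Re (u w)" "Re (u w) \<le> v w + 2 * e" if "norm w = 1" for w
      using k(2)[OF that] by (auto simp: u_def)
    have le: "norm (exp (- u w)) \<le> 1" if "norm w \<le> 1" for w
    proof (rule maximum_modulus_cball[where f = "\<lambda>w. exp (- u w)" and R = 1 and R' = 2])
      fix w :: complex assume w: "norm w = 1"
      have "v w \<ge> 0" by (simp add: v_def)
      thus "norm (exp (- u w)) \<le> 1" using u(1)[OF w] by simp
    qed (use that in \<open>auto intro!: holomorphic_intros holu\<close>)
    have le2: "norm (F w * exp (- u w)) \<le> 1" if "norm w \<le> 1" for w
    proof (rule maximum_modulus_cball[where f = "\<lambda>w. F w * exp (- u w)" and R = 1 and R' = 2])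
      fix w :: complex assume w: "norm w = 1"
      have "norm (F w) \<le> exp (v w)" by (simp add: v_def le_exp_log_plus)
      also have "\<dots> \<le> exp (Re (u w))" using u(1)[OF w] by simp
      finally show "norm (F w * exp (- u w)) \<le> 1" by (simp add: norm_mult) (simp add: exp_minus field_simps)
    qed (use that in \<open>auto intro!: holomorphic_intros holu holomorphic_on_subset[OF holF]\<close>)
    have Re0: "Re (u w) \<ge> 0" if "norm w \<le> 1" for w using le[OF that] by simp
    have z1: "norm z' \<le> 1" using z' by linarith
    have "norm (f z) \<le> exp (Re (u z'))"
      using le2[OF z1] z' by (simp add: norm_mult) (simp add: exp_minus field_simps)
    hence "log_plus (norm (f z)) \<le> Re (u z')" using Re0[OF z1] by (intro log_plus_le) auto
    also have "\<dots> \<le> (1 + r / R) / (1 - r / R) * Re (u 0)"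
      by (rule Harnack_upper[OF holu]) (use Re0 z' in auto)
    also have "(1 + r / R) / (1 - r / R) = c" using pos z by (simp add: c_def field_simps)
    also have "c * Re (u 0) \<le> c * (proximity_fun f R + 2 * e)"
    proof (rule mult_left_mono)
      have "integral {0..2 * pi} (\<lambda>\<theta>. Re (u (cis \<theta>))) \<le> integral {0..2 * pi} (\<lambda>\<theta>. v (cis \<theta>) + 2 * e)"
      proof (rule integral_le)
        show "(\<lambda>\<theta>. Re (u (cis \<theta>))) integrable_on {0..2 * pi}"
          using Re_entire_mean_value[OF holu] by blast
        show "(\<lambda>\<theta>. v (cis \<theta>) + 2 * e) integrable_on {0..2 * pi}"
          by (intro integrable_continuous_interval continuous_intros continuous_on_compose2[OF contv]) auto
      qed (use u(2) in auto)
      also have "integral {0..2 * pi} (\<lambda>\<theta>. v (cis \<theta>) + 2 * e) =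
          integral {0..2 * pi} (\<lambda>\<theta>. v (cis \<theta>)) + 2 * pi * (2 * e)"
        by (subst Henstock_Kurzweil_Integration.integral_add)
           (auto intro!: integrable_continuous_interval continuous_intros continuous_on_compose2[OF contv])
      also have "integral {0..2 * pi} (\<lambda>\<theta>. v (cis \<theta>)) = 2 * pi * proximity_fun f R"
        by (simp add: proximity_fun_def v_def F_def)
      also have "integral {0..2 * pi} (\<lambda>\<theta>. Re (u (cis \<theta>))) = 2 * pi * Re (u 0)"
        using Re_entire_mean_value[OF holu] by blast
      finally have "2 * pi * Re (u 0) \<le> 2 * pi * (proximity_fun f R + 2 * e)"
        by (simp add: algebra_simps)
      thus "Re (u 0) \<le> proximity_fun f R + 2 * e" by simp
    qed (use c in auto)
    finally show ?thesis .
  qed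
  have "log_plus (norm (f z)) \<le> c * proximity_fun f R"
  proof (rule field_le_epsilon)
    fix e :: real assume "e > 0"
    thus "log_plus (norm (f z)) \<le> c * proximity_fun f R + e"
      using *[of "e / (2 * c)"] c by (simp add: distrib_left)
  qed
  thus ?thesis by (simp add: c_def)
qed

section \<open>Entire functions of bounded growth\<close>

lemma entire_compose:
  assumes "f holomorphic_on UNIV" "g holomorphic_on A"
  shows "(\<lambda>z. f (g z)) holomorphic_on A"
  using holomorphic_on_compose_gen[OF assms(2,1)] by (simp add: o_def)

text \<open>A pointwise form of "order p, finite type", for all z rather than for large |z|. The
  base 1 + |z| keeps the weight at least 1 when p \<ge> 0, so that additive and multiplicative
  constants can be absorbed into C.\<close>

definition growth_at_most :: "real \<Rightarrow> (complex \<Rightarrow> complex) \<Rightarrow> bool" where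
  "growth_at_most p f \<longleftrightarrow> f holomorphic_on UNIV \<and>
     (\<exists>C\<ge>0. \<forall>z. norm (f z) \<le> exp (C * (1 + norm z) powr p))"

lemma growth_at_mostI:
  assumes "f holomorphic_on UNIV" "\<And>z. norm (f z) \<le> exp (C * (1 + norm z) powr p)"
  shows "growth_at_most p f"
  unfolding growth_at_most_def
proof (intro conjI exI[of _ "max 0 C"] allI)
  fix z
  show "norm (f z) \<le> exp (max 0 C * (1 + norm z) powr p)"
    by (rule order_trans[OF assms(2)]) (auto intro: mult_right_mono)
qed (use assms in auto)

lemma growth_at_mostE:
  assumes "growth_at_most p f"
  obtains C where "C \<ge> 0" "\<And>z. norm (f z) \<le> exp (C * (1 + norm z) powr p)"
  using assms unfolding growth_at_most_def by blast

lemma growth_at_most_imp_holomorphic: "growth_at_most p f \<Longrightarrow> f holomorphic_on A"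
  unfolding growth_at_most_def using holomorphic_on_subset by blast

lemma growth_at_most_mono:
  assumes "growth_at_most p f" "p \<le> q"
  shows "growth_at_most q f"
proof -
  obtain C where C: "C \<ge> 0" "\<And>z. norm (f z) \<le> exp (C * (1 + norm z) powr p)"
    using growth_at_mostE[OF assms(1)] by blast
  show ?thesis
  proof (rule growth_at_mostI)
    fix z :: complex
    show "norm (f z) \<le> exp (C * (1 + norm z) powr q)"
      by (rule order_trans[OF C(2)]) (use C(1) assms(2) in \<open>auto intro!: mult_left_mono powr_mono\<close>)
  qed (use assms growth_at_most_imp_holomorphic in blast)
qed

lemma one_le_one_plus_norm_powr: "p \<ge> 0 \<Longrightarrow> 1 \<le> (1 + norm z) powr p"
  using powr_mono2[of p 1 "1 + norm z"] by (simp add: ge_one_powr_ge_zero)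

lemma growth_at_most_mult:
  assumes "growth_at_most p f" "growth_at_most p g"
  shows "growth_at_most p (\<lambda>z. f z * g z)"
proof -
  obtain C D where C: "\<And>z. norm (f z) \<le> exp (C * (1 + norm z) powr p)"
    and D: "\<And>z. norm (g z) \<le> exp (D * (1 + norm z) powr p)"
    using assms[THEN growth_at_mostE] by metis
  show ?thesis
  proof (rule growth_at_mostI)
    fix z :: complex
    have "norm (f z) * norm (g z) \<le> exp (C * (1 + norm z) powr p) * exp (D * (1 + norm z) powr p)"
      by (intro mult_mono C D) auto
    thus "norm (f z * g z) \<le> exp ((C + D) * (1 + norm z) powr p)"
      by (simp add: norm_mult distrib_right exp_add)
  qed (intro holomorphic_intros assms[THEN growth_at_most_imp_holomorphic])
qed

lemma growth_at_most_add:
  assumes "growth_at_most p f" "growth_at_most p g" "p \<ge> 0"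
  shows "growth_at_most p (\<lambda>z. f z + g z)"
proof -
  obtain C D where CD: "C \<ge> 0" "D \<ge> 0"
    and C: "\<And>z. norm (f z) \<le> exp (C * (1 + norm z) powr p)"
    and D: "\<And>z. norm (g z) \<le> exp (D * (1 + norm z) powr p)"
    using assms(1,2)[THEN growth_at_mostE] by metis
  show ?thesis
  proof (rule growth_at_mostI)
    fix z :: complex
    define w where "w = (1 + norm z) powr p"
    have w: "w \<ge> 1" using one_le_one_plus_norm_powr[OF assms(3)] by (simp add: w_def)
    have "norm (f z + g z) \<le> exp (C * w) + exp (D * w)"
      using norm_triangle_ineq[of "f z" "g z"] C[of z] D[of z] by (simp add: w_def)
    also have "\<dots> \<le> 2 * exp (max C D * w)"
    proof -
      have "exp (C * w) \<le> exp (max C D * w)" "exp (D * w) \<le> exp (max C D * w)"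
        using w by (auto intro!: mult_right_mono)
      thus ?thesis by linarith
    qed
    also have "(2 :: real) \<le> exp w" using exp_ge_add_one_self[of w] w by linarith
    hence "2 * exp (max C D * w) \<le> exp w * exp (max C D * w)" by simp
    also have "\<dots> = exp ((1 + max C D) * w)" by (simp add: distrib_right exp_add)
    finally show "norm (f z + g z) \<le> exp ((1 + max C D) * (1 + norm z) powr p)" by (simp add: w_def)
  qed (intro holomorphic_intros assms(1,2)[THEN growth_at_most_imp_holomorphic])
qed

lemma growth_at_most_const:
  assumes "p \<ge> 0"
  shows "growth_at_most p (\<lambda>_. c)"
proof (rule growth_at_mostI)
  fix z :: complex
  have "norm c \<le> exp (norm c)" using exp_ge_add_one_self[of "norm c"] by linarith
  also have "\<dots> \<le> exp (norm c * (1 + norm z) powr p)"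
    using one_le_one_plus_norm_powr[OF assms, of z] by (simp add: mult_le_cancel_left1)
  finally show "norm c \<le> exp (norm c * (1 + norm z) powr p)" .
qed auto

lemma growth_at_most_ident:
  assumes "p > 0"
  shows "growth_at_most p (\<lambda>z. z)"
proof (rule growth_at_mostI)
  fix z :: complex
  have "ln (1 + norm z) \<le> (1 + norm z) powr p / p"
    using ln_powr_bound[of "1 + norm z" p] assms by simp
  hence "exp (ln (1 + norm z)) \<le> exp (1 / p * (1 + norm z) powr p)" by simp
  moreover have "exp (ln (1 + norm z)) = 1 + norm z" by (rule exp_ln) (simp add: add_pos_nonneg)
  ultimately show "norm z \<le> exp (1 / p * (1 + norm z) powr p)" by linarith
qed auto

lemma growth_at_most_power:
  assumes "growth_at_most p f" "p \<ge> 0"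
  shows "growth_at_most p (\<lambda>z. f z ^ n)"
  by (induction n) (auto intro: growth_at_most_const growth_at_most_mult assms)

lemma growth_at_most_uminus: "growth_at_most p f \<Longrightarrow> growth_at_most p (\<lambda>z. - f z)"
  unfolding growth_at_most_def by (auto intro: holomorphic_intros)

lemma growth_at_most_diff:
  assumes "growth_at_most p f" "growth_at_most p g" "p \<ge> 0"
  shows "growth_at_most p (\<lambda>z. f z - g z)"
  using growth_at_most_add[OF assms(1) growth_at_most_uminus[OF assms(2)] assms(3)] by simp

lemma growth_at_most_affine_comp:
  assumes "growth_at_most p f" "p \<ge> 0"
  shows "growth_at_most p (\<lambda>z. f (a * z + b))"
proof -
  obtain C where C: "C \<ge> 0" "\<And>z. norm (f z) \<le> exp (C * (1 + norm z) powr p)"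
    using growth_at_mostE[OF assms(1)] by blast
  define M where "M = 1 + norm a + norm b"
  show ?thesis
  proof (rule growth_at_mostI)
    show "(\<lambda>z. f (a * z + b)) holomorphic_on UNIV"
      by (rule entire_compose[OF growth_at_most_imp_holomorphic[OF assms(1)]]) (intro holomorphic_intros)
    fix z :: complex
    have "1 + norm (a * z + b) \<le> M * (1 + norm z)"
    proof -
      have "0 \<le> norm a + norm z + norm b * norm z" by simp
      moreover have "M * (1 + norm z) = 1 + norm a + norm b + norm z + norm a * norm z + norm b * norm z"
        by (simp add: M_def algebra_simps)
      moreover have "norm (a * z + b) \<le> norm a * norm z + norm b"
        using norm_triangle_ineq[of "a * z" b] by (simp add: norm_mult)
      ultimately show ?thesis by linarith
    qed
    hence "(1 + norm (a * z + b)) powr p \<le> (M * (1 + norm z)) powr p"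
      using assms(2) by (intro powr_mono2) auto
    also have "\<dots> = M powr p * (1 + norm z) powr p"
      by (rule powr_mult)
    finally have "C * (1 + norm (a * z + b)) powr p \<le> C * M powr p * (1 + norm z) powr p"
      using C(1) mult_left_mono[of _ _ C] by (simp add: mult.assoc)
    thus "norm (f (a * z + b)) \<le> exp (C * M powr p * (1 + norm z) powr p)"
      using C(2)[of "a * z + b"] by (meson exp_le_cancel_iff order_trans)
  qed
qed

lemma growth_at_most_shift:
  assumes "growth_at_most p f" "p \<ge> 0"
  shows "growth_at_most p (\<lambda>z. f (z + b))"
  using growth_at_most_affine_comp[OF assms, of 1 b] by simp

lemma growth_at_most_linear_power:
  assumes "p > 0"
  shows "growth_at_most p (\<lambda>z. (z - a) ^ n)"
  using assms by (intro growth_at_most_power growth_at_most_diff growth_at_most_ident growth_at_most_const) auto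

lemma growth_at_most_from_large:
  assumes hol: "f holomorphic_on UNIV"
    and le: "\<And>z. norm z \<ge> R \<Longrightarrow> norm (f z) \<le> exp (C * (1 + norm z) powr p)" and p: "p \<ge> 0"
  shows "growth_at_most p f"
proof -
  have "compact (f ` cball 0 R)"
    by (intro compact_continuous_image holomorphic_on_imp_continuous_on holomorphic_on_subset[OF hol]) auto
  then obtain M where M: "\<And>z. norm z \<le> R \<Longrightarrow> norm (f z) \<le> M"
    using compact_imp_bounded bounded_iff by (metis (no_types, opaque_lifting) image_eqI mem_cball_0)
  show ?thesis
  proof (rule growth_at_mostI[OF hol])
    fix z :: complex
    define w where "w = (1 + norm z) powr p"
    have w: "w \<ge> 1" using one_le_one_plus_norm_powr[OF p] by (simp add: w_def)
    have "norm (f z) \<le> exp (max (max C M) 0 * w)"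
    proof (cases "norm z \<ge> R")
      case True
      have "C * w \<le> max (max C M) 0 * w" using w by (intro mult_right_mono) auto
      thus ?thesis using le[OF True] unfolding w_def[symmetric] by (meson exp_le_cancel_iff order_trans)
    next
      case False
      hence "norm (f z) \<le> M" using M by simp
      also have "M \<le> max (max C M) 0 * 1" by simp
      also have "\<dots> \<le> max (max C M) 0 * w" using w by (intro mult_left_mono) auto
      also have "\<dots> \<le> exp \<dots>" using exp_ge_add_one_self[of "max (max C M) 0 * w"] by linarith
      finally show ?thesis .
    qed
    thus "norm (f z) \<le> exp (max (max C M) 0 * (1 + norm z) powr p)" by (simp add: w_def)
  qed
qed

text \<open>The radii r, 2 r, 3 r with r = 1 + |z| are proportional, so the Harnack factor is the
  constant 3 and only the constant in the exponent changes.\<close>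

lemma growth_at_most_quotient_nonzero:
  assumes A: "growth_at_most p A" and D: "growth_at_most p D" and H: "H holomorphic_on UNIV"
    and eq: "\<And>z. D z = A z * H z" and A0: "A 0 \<noteq> 0" and p: "p \<ge> 0"
  shows "growth_at_most p H"
proof -
  obtain C1 C2 where C: "C1 \<ge> 0" "C2 \<ge> 0"
    "\<And>z. norm (A z) \<le> exp (C1 * (1 + norm z) powr p)"
    "\<And>z. norm (D z) \<le> exp (C2 * (1 + norm z) powr p)"
    using A D by (metis growth_at_mostE)
  define \<beta> where "\<beta> = \<bar>ln (norm (A 0))\<bar>"
  show ?thesis
  proof (rule growth_at_mostI[OF H])
    fix z :: complex
    define r where "r = 1 + norm z"
    have r1: "r \<ge> 1" "norm z \<le> r" by (simp_all add: r_def)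
    define w where "w = (1 + norm z) powr p"
    have w: "w \<ge> 1" using one_le_one_plus_norm_powr[OF p] by (simp add: w_def)
    \<comment> \<open>Majorises the weight on the circle of radius 3 r, because 1 + 3 r \<le> 4
      r.\<close>
    define W where "W = 4 powr p * w"
    have W: "W \<ge> 1" using w ge_one_powr_ge_zero[of 4 p] p mult_mono[of 1 "4 powr p" 1 w] by (simp add: W_def)
    have eqW: "(1 + 3 * r) powr p \<le> W"
    proof -
      have "(1 + 3 * r) powr p \<le> (4 * (1 + norm z)) powr p"
        using p r1 by (intro powr_mono2) (auto simp: r_def)
      thus ?thesis unfolding W_def w_def by (simp only: powr_mult)
    qed
    have "norm (H z) \<le> exp (C2 * W) / exp (C1 * W) *
        exp ((2 * r + r) / (2 * r - r) * ln (exp (C1 * W) / norm (A 0)))"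
    proof (rule holomorphic_quotient_bound[where \<rho> = "3 * r" and R' = "4 * r" and A = A and H = H and z = z])
      fix x :: complex assume x: "norm x = 3 * r"
      have "C1 * (1 + norm x) powr p \<le> C1 * W" "C2 * (1 + norm x) powr p \<le> C2 * W"
        using C eqW by (auto simp: x intro!: mult_left_mono)
      thus "norm (A x) \<le> exp (C1 * W)" "norm (A x * H x) \<le> exp (C2 * W)"
        using C(3)[of x] C(4)[of x] unfolding eq by (meson exp_le_cancel_iff order_trans)+
    qed (use r1 A0 in \<open>auto intro!: holomorphic_on_subset[OF H] growth_at_most_imp_holomorphic[OF A]\<close>)
    also have "(2 * r + r) / (2 * r - r) = 3" using r1 by simp
    also have "ln (exp (C1 * W) / norm (A 0)) \<le> (C1 + \<beta>) * W"
    proof -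
      have "ln (exp (C1 * W) / norm (A 0)) = C1 * W - ln (norm (A 0))"
        using A0 by (simp add: ln_div)
      also have "\<dots> \<le> C1 * W + \<beta>" by (simp add: \<beta>_def)
      also have "\<beta> \<le> \<beta> * W" using W by (simp add: \<beta>_def mult_le_cancel_left1)
      finally show ?thesis by (simp add: distrib_right)
    qed
    hence "exp (C2 * W) / exp (C1 * W) * exp (3 * ln (exp (C1 * W) / norm (A 0)))
       \<le> exp (C2 * W) / 1 * exp (3 * ((C1 + \<beta>) * W))"
      using C W by (intro mult_mono frac_le) auto
    also have "\<dots> = exp ((C2 + 3 * (C1 + \<beta>)) * 4 powr p * w)"
      by (simp add: W_def exp_add[symmetric] algebra_simps)
    finally show "norm (H z) \<le> exp ((C2 + 3 * (C1 + \<beta>)) * 4 powr p * (1 + norm z) powr p)"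
      by (simp add: w_def)
  qed
qed

text \<open>A translation moves the point a, where A does not vanish, to the centre.\<close>

lemma growth_at_most_quotient:
  assumes A: "growth_at_most p A" and D: "growth_at_most p D" and H: "H holomorphic_on UNIV"
    and eq: "\<And>z. D z = A z * H z" and a: "A a \<noteq> 0" and p: "p \<ge> 0"
  shows "growth_at_most p H"
proof -
  have "growth_at_most p (\<lambda>z. H (z + a))"
  proof (rule growth_at_most_quotient_nonzero)
    show "growth_at_most p (\<lambda>z. A (z + a))" "growth_at_most p (\<lambda>z. D (z + a))"
      using A D p by (auto intro: growth_at_most_shift)
    show "(\<lambda>z. H (z + a)) holomorphic_on UNIV"
      by (rule entire_compose[OF H]) (intro holomorphic_intros)
  qed (use a p eq in auto)
  from growth_at_most_shift[OF this p, of "- a"] show ?thesis by simp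
qed

section \<open>Characteristic and pointwise growth of entire functions\<close>

lemma nevanlinna_char_entire:
  assumes "f holomorphic_on UNIV"
  shows "nevanlinna_char f r = proximity_fun f r"
proof -
  have "\<not> is_pole f z" for z
    using assms by (metis UNIV_I open_UNIV not_is_pole_holomorphic)
  hence "pole_count f t = 0" for t by (simp add: pole_count_def)
  thus ?thesis by (simp add: nevanlinna_char_def integrated_pole_count_def)
qed

text \<open>For large r the hypothesis gives T(r) = m(r) \<le> r^p, and passing from the mean over
  the circle of radius 2 r to values on |z| \<le> r costs only the factor 3.\<close>

lemma growth_order_less_imp_growth_at_most:
  assumes f: "f holomorphic_on UNIV" and lt: "growth_order f < ereal p" and p: "p \<ge> 0"
  shows "growth_at_most p f"
proof -
  have "eventually (\<lambda>r. ereal (log_plus (nevanlinna_char f r) / ln r) < ereal p) at_top"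
    using lt unfolding growth_order_def by (rule Limsup_lessD)
  hence "eventually (\<lambda>r. proximity_fun f r \<le> r powr p) at_top"
    using eventually_gt_at_top[of 1]
  proof eventually_elim
    case (elim r)
    hence "log_plus (proximity_fun f r) < p * ln r"
      by (simp add: nevanlinna_char_entire[OF f] divide_less_eq)
    hence "ln (proximity_fun f r) \<le> p * ln r" by (simp add: log_plus_def)
    show ?case
    proof (cases "proximity_fun f r > 0")
      case True
      hence "proximity_fun f r = exp (ln (proximity_fun f r))" by simp
      also have "\<dots> \<le> exp (p * ln r)" using \<open>ln (proximity_fun f r) \<le> p * ln r\<close> by simp
      also have "\<dots> = r powr p" using elim by (simp add: powr_def)
      finally show ?thesis .
    next
      case False
      thus ?thesis using order_trans[of _ 0 "r powr p"] by simp
    qed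
  qed
  then obtain r0 where r0: "\<And>r. r \<ge> r0 \<Longrightarrow> proximity_fun f r \<le> r powr p"
    by (auto simp: eventually_at_top_linorder)
  define K where "K = max 1 r0"
  show ?thesis
  proof (rule growth_at_mostI[OF f])
    fix z :: complex
    \<comment> \<open>The dilation by K makes 2 r at least r0 for every z, so that small z need no
      separate treatment.\<close>
    define r where "r = K * (1 + norm z)"
    have r: "norm z \<le> r" "r > 0" "2 * r \<ge> r0"
    proof -
      have K: "K \<ge> 1" "K \<ge> r0" by (auto simp: K_def)
      have "1 * (1 + norm z) \<le> r" unfolding r_def by (rule mult_right_mono) (use K in auto)
      thus "norm z \<le> r" by simp
      have "K * 1 \<le> r" unfolding r_def by (rule mult_left_mono) (use K in auto)
      thus "r > 0" "2 * r \<ge> r0" using K by linarith+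
    qed
    have "log_plus (norm (f z)) \<le> (2 * r + r) / (2 * r - r) * proximity_fun f (2 * r)"
      by (rule log_plus_le_proximity[OF f]) (use r in auto)
    also have "(2 * r + r) / (2 * r - r) = 3" using r by simp
    also have "3 * proximity_fun f (2 * r) \<le> 3 * (2 * r) powr p" using r0[OF r(3)] by simp
    also have "(2 * r) powr p = (2 * K) powr p * (1 + norm z) powr p"
      by (simp add: r_def powr_mult flip: mult.assoc)
    finally have "log_plus (norm (f z)) \<le> 3 * (2 * K) powr p * (1 + norm z) powr p" by simp
    thus "norm (f z) \<le> exp (3 * (2 * K) powr p * (1 + norm z) powr p)"
      using le_exp_log_plus[of "norm (f z)"] by (meson exp_le_cancel_iff norm_ge_zero order_trans)
  qed
qed

text \<open>The mean m(r) inherits the pointwise bound C (1 + r)^p, and the gap p < q absorbs the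
  constant for large r.\<close>

lemma growth_at_most_imp_growth_order_le:
  assumes f: "growth_at_most p f" and p: "0 \<le> p" "p < q"
  shows "growth_order f \<le> ereal q"
  unfolding growth_order_def
proof (rule Limsup_bounded)
  obtain C where C: "C \<ge> 0" "\<And>z. norm (f z) \<le> exp (C * (1 + norm z) powr p)"
    using growth_at_mostE[OF f] by blast
  have hol: "f holomorphic_on A" for A by (rule growth_at_most_imp_holomorphic[OF f])
  have m: "proximity_fun f r \<le> C * (1 + r) powr p" if "r > 0" for r
  proof -
    have "integral {0..2 * pi} (\<lambda>\<theta>. log_plus (norm (f (of_real r * cis \<theta>))))
        \<le> integral {0..2 * pi} (\<lambda>\<theta>. C * (1 + r) powr p)"
    proof (rule integral_le)
      show "(\<lambda>\<theta>. log_plus (norm (f (of_real r * cis \<theta>)))) integrable_on {0..2 * pi}"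
        by (intro integrable_continuous_interval continuous_intros
              continuous_on_compose2[OF holomorphic_on_imp_continuous_on[OF hol[of UNIV]]]) auto
      fix \<theta> :: real
      show "log_plus (norm (f (of_real r * cis \<theta>))) \<le> C * (1 + r) powr p"
        using C(2)[of "of_real r * cis \<theta>"] C(1) that by (intro log_plus_le) (auto simp: norm_mult)
    qed auto
    also have "\<dots> = 2 * pi * (C * (1 + r) powr p)" by simp
    finally show ?thesis by (simp add: proximity_fun_def field_simps)
  qed
  have "eventually (\<lambda>r. C * (1 + r) powr p \<le> r powr q) at_top"
  proof -
    have "((\<lambda>r::real. (1 + r) powr p / r powr q) \<longlongrightarrow> 0) at_top"
      using p by real_asymp
    hence "((\<lambda>r::real. C * ((1 + r) powr p / r powr q)) \<longlongrightarrow> 0) at_top"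
      using tendsto_mult_right_zero by blast
    hence "eventually (\<lambda>r::real. C * ((1 + r) powr p / r powr q) < 1) at_top"
      by (rule order_tendstoD) simp
    thus ?thesis using eventually_gt_at_top[of 0]
      by eventually_elim (auto simp: field_simps)
  qed
  thus "eventually (\<lambda>r. ereal (log_plus (nevanlinna_char f r) / ln r) \<le> ereal q) at_top"
    using eventually_gt_at_top[of 1]
  proof eventually_elim
    case (elim r)
    have m': "proximity_fun f r \<le> r powr q" using m[of r] elim by linarith
    have "ln (proximity_fun f r) \<le> q * ln r"
    proof (cases "proximity_fun f r > 0")
      case True
      hence "ln (proximity_fun f r) \<le> ln (r powr q)" using m' by (intro ln_mono)
      thus ?thesis using elim by (simp add: ln_powr)
    next
      case False
      \<comment> \<open>A mean of log+ is non-negative, so only the value 0 is left; there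
        \<open>ln 0 = 0\<close> in HOL.\<close>
      hence "proximity_fun f r = 0"
      proof -
        have "0 \<le> integral {0..2 * pi} (\<lambda>\<theta>. log_plus (norm (f (of_real r * cis \<theta>))))"
          by (intro integral_nonneg integrable_continuous_interval continuous_intros
              continuous_on_compose2[OF holomorphic_on_imp_continuous_on[OF hol[of UNIV]]]) auto
        hence "proximity_fun f r \<ge> 0" by (simp add: proximity_fun_def)
        thus ?thesis using False by simp
      qed
      thus ?thesis using p elim by simp
    qed
    moreover have "0 \<le> q * ln r" using p elim by simp
    ultimately show ?case using elim
      by (simp add: nevanlinna_char_entire[OF hol] log_plus_def divide_le_eq)
  qed
qed

section \<open>The Gamma function and a Phragmen--Lindelof principle\<close>

text \<open>A Weierstrass factor of genus 1. For |w| \<le> 1 the estimate |1 + w|^2 \<le> exp (2 Re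
  w + |w|^2) leaves only the quadratic term once exp (- w) has cancelled the linear one, and |w|^2
  \<le> |w|^p as p \<le> 2; for |w| > 1 the crude bound exp (2 |w|) is enough.\<close>

lemma norm_one_plus_mult_exp_minus_le:
  fixes w :: complex
  assumes p: "1 < p" "p \<le> 2"
  shows "norm ((1 + w) * exp (- w)) \<le> exp (2 * norm w powr p)"
proof (cases "norm w \<le> 1")
  case True
  have "(norm (1 + w))\<^sup>2 = 1 + (2 * Re w + (norm w)\<^sup>2)"
    by (simp only: cmod_power2) (simp add: power2_eq_square algebra_simps)
  also have "\<dots> \<le> exp (2 * Re w + (norm w)\<^sup>2)" by (rule exp_ge_add_one_self)
  also have "\<dots> = (exp (Re w + (norm w)\<^sup>2 / 2))\<^sup>2"
    by (simp add: power2_eq_square flip: exp_add)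
  finally have "norm (1 + w) \<le> exp (Re w + (norm w)\<^sup>2 / 2)"
    by (rule power2_le_imp_le) simp
  hence "norm ((1 + w) * exp (- w)) \<le> exp (Re w + (norm w)\<^sup>2 / 2) * exp (- Re w)"
    by (simp add: norm_mult)
  also have "\<dots> = exp ((norm w)\<^sup>2 / 2)" by (simp flip: exp_add)
  also have "(norm w)\<^sup>2 \<le> norm w powr p"
  proof (cases "w = 0")
    case False
    have "norm w powr 2 \<le> norm w powr p"
      using True p False by (intro powr_mono') auto
    thus ?thesis by simp
  qed auto
  hence "exp ((norm w)\<^sup>2 / 2) \<le> exp (2 * norm w powr p)"
    using powr_ge_zero[of "norm w" p] by (subst exp_le_cancel_iff) linarith
  finally show ?thesis .
next
  case False
  have "norm (1 + w) \<le> 1 + norm w" using norm_triangle_ineq[of 1 w] by simp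
  also have "\<dots> \<le> exp (norm w)" by (rule exp_ge_add_one_self)
  finally have "norm (1 + w) \<le> exp (norm w)" .
  moreover have "norm (exp (- w)) \<le> exp (norm w)"
    using abs_Re_le_cmod[of w] by simp
  ultimately have "norm ((1 + w) * exp (- w)) \<le> exp (norm w) * exp (norm w)"
    unfolding norm_mult by (intro mult_mono) auto
  also have "\<dots> = exp (2 * norm w powr 1)" by (simp flip: exp_add)
  also have "\<dots> \<le> exp (2 * norm w powr p)"
    using False p by (simp only: exp_le_cancel_iff) (intro mult_left_mono powr_mono, auto)
  finally show ?thesis .
qed

text \<open>In the Weierstrass product the k-th factor contributes 2 |z / k|^p to the exponent, and
  p > 1 makes the sum over k converge. The bound is proved for the partial products and survives the
  limit.\<close>

lemma growth_at_most_rGamma: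
  assumes p: "1 < p" "p \<le> 2"
  shows "growth_at_most p rGamma"
proof (rule growth_at_mostI)
  define S where "S = (\<Sum>k. real k powr (- p))"
  have summ: "summable (\<lambda>k. real k powr (- p))" using p by (simp add: summable_real_powr_iff)
  define c where "c = \<bar>euler_mascheroni :: real\<bar>"
  fix z :: complex
  have bound: "norm (rGamma_series_Weierstrass z n) \<le> exp ((c + 1 + 2 * S) * (1 + norm z) powr p)" for n
  proof -
    have "norm (\<Prod>k=1..n. (1 + z / of_nat k) * exp (- z / of_nat k)) \<le>
        (\<Prod>k=1..n. exp (2 * norm z powr p * real k powr (- p)))"
      unfolding prod_norm[symmetric]
    proof (rule prod_mono, safe)
      fix k assume "k \<in> {1..n}"
      have "norm ((1 + z / of_nat k) * exp (- (z / of_nat k))) \<le> exp (2 * norm (z / of_nat k) powr p)"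
        by (rule norm_one_plus_mult_exp_minus_le[OF p])
      also have "norm (z / of_nat k) powr p = norm z powr p * real k powr (- p)"
        by (simp add: norm_divide powr_divide powr_minus_divide)
      finally show "norm ((1 + z / of_nat k) * exp (- z / of_nat k)) \<le>
        exp (2 * norm z powr p * real k powr (- p))" by (simp add: mult.assoc)
    qed auto
    also have "\<dots> = exp (2 * norm z powr p * (\<Sum>k=1..n. real k powr (- p)))"
      by (simp add: exp_sum sum_distrib_left)
    also have "\<dots> \<le> exp (2 * norm z powr p * S)"
      unfolding S_def
      by (simp only: exp_le_cancel_iff) (intro mult_left_mono sum_le_suminf summ, auto)
    finally have 1: "norm (\<Prod>k=1..n. (1 + z / of_nat k) * exp (- z / of_nat k)) \<le> exp (2 * norm z powr p * S)" .
    have 2: "norm z \<le> exp (norm z)" using exp_ge_add_one_self[of "norm z"] by linarith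
    have 3: "norm (exp (euler_mascheroni * z)) \<le> exp (c * norm z)"
    proof -
      have "euler_mascheroni * Re z \<le> \<bar>euler_mascheroni * Re z\<bar>" by simp
      also have "\<dots> \<le> c * norm z"
        unfolding c_def abs_mult by (intro mult_left_mono abs_Re_le_cmod) auto
      finally have "euler_mascheroni * Re z \<le> c * norm z" .
      moreover have "Re (euler_mascheroni * z) = euler_mascheroni * Re z"
        by (metis Re_complex_of_real Im_complex_of_real of_real_euler_mascheroni mult_zero_left diff_zero times_complex.sel(1))
      ultimately show ?thesis by (simp only: norm_exp_eq_Re exp_le_cancel_iff)
    qed
    have "norm (rGamma_series_Weierstrass z n) \<le>
        exp (c * norm z) * exp (norm z) * exp (2 * norm z powr p * S)"
      unfolding rGamma_series_Weierstrass_def norm_mult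
      by (intro mult_mono 2 3 order_trans[OF _ 1]) (auto simp: norm_mult)
    also have "\<dots> = exp ((c + 1) * norm z + 2 * S * norm z powr p)"
      by (simp add: algebra_simps flip: exp_add)
    also have "\<dots> \<le> exp ((c + 1) * (1 + norm z) powr p + 2 * S * (1 + norm z) powr p)"
    proof -
      have "norm z \<le> (1 + norm z) powr 1" by simp
      also have "\<dots> \<le> (1 + norm z) powr p" using p by (intro powr_mono) auto
      finally have "norm z \<le> (1 + norm z) powr p" .
      moreover have "norm z powr p \<le> (1 + norm z) powr p" using p by (intro powr_mono2) auto
      moreover have "S \<ge> 0" unfolding S_def by (intro suminf_nonneg summ) auto
      ultimately show ?thesis
        by (simp only: exp_le_cancel_iff) (intro add_mono mult_left_mono, auto simp: c_def)
    qed
    finally show ?thesis by (simp add: distrib_right)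
  qed
  show "norm (rGamma z) \<le> exp ((c + 1 + 2 * S) * (1 + norm z) powr p)"
    by (rule tendsto_upperbound[OF tendsto_norm[OF rGamma_Weierstrass_complex]])
       (use bound in auto)
qed (rule holomorphic_rGamma)

text \<open>Euler's limit formula: its numerator has modulus n! n^(Re w), and each factor w + k of
  the denominator has modulus at least Re w + k.\<close>

lemma norm_Gamma_le_Gamma_Re:
  fixes w :: complex
  assumes "Re w > 0"
  shows "norm (Gamma w) \<le> Gamma (Re w)"
proof (rule tendsto_le[OF _ Gamma_series_LIMSEQ[of "Re w"] tendsto_norm[OF Gamma_series_LIMSEQ[of w]]])
  show "\<forall>\<^sub>F n in sequentially. norm (Gamma_series w n) \<le> Gamma_series (Re w) n"
  proof (rule always_eventually, rule allI)
    fix n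
    have "pochhammer (Re w) (n + 1) \<le> norm (pochhammer w (n + 1))"
      unfolding pochhammer_prod prod_norm[symmetric]
    proof (rule prod_mono, safe)
      fix i
      show "0 \<le> Re w + of_nat i" using assms by simp
      show "Re w + of_nat i \<le> norm (w + of_nat i)"
        using complex_Re_le_cmod[of "w + of_nat i"] by simp
    qed
    thus "norm (Gamma_series w n) \<le> Gamma_series (Re w) n"
      unfolding Gamma_series_def norm_divide norm_mult
      using assms pochhammer_pos[of "Re w" "n + 1"] by (intro frac_le mult_mono) auto
  qed
qed auto

text \<open>Comparison with n! \<le> exp (n ln n), where ln n \<le> n^e / e for e = p - 1. Gamma
  increases only beyond its minimum between 1 and 2, hence the argument is first raised to x + 2;
  dividing by x (x + 1) \<ge> c^2 undoes this.\<close>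

lemma Gamma_real_le_exp:
  fixes c p :: real
  assumes c: "c > 0" and p: "p > 1"
  obtains C where "C \<ge> 0" "\<And>x. x \<ge> c \<Longrightarrow> Gamma x \<le> exp (C * (1 + x) powr p)"
proof
  define e where "e = p - 1"
  have e: "e > 0" using p by (simp add: e_def)
  define C where "C = 3 powr p / e + \<bar>ln (c * c)\<bar>"
  show "C \<ge> 0" using e by (simp add: C_def)
  fix x :: real assume x: "x \<ge> c"
  define n where "n = nat \<lceil>x\<rceil> + 1"
  have n: "x + 1 \<le> real n" "real n \<le> x + 2" "n \<ge> 1" using x c unfolding n_def by linarith+
  have nonint: "x \<notin> \<int>\<^sub>\<le>\<^sub>0" "x + 1 \<notin> \<int>\<^sub>\<le>\<^sub>0"
    using x c by (auto elim!: nonpos_Ints_cases)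
  have "Gamma (x + 2) = (x + 1) * (x * Gamma x)"
    using Gamma_plus1[OF nonint(2)] Gamma_plus1[OF nonint(1)] by (simp add: add.assoc)
  hence "Gamma x = Gamma (x + 2) / (x * (x + 1))" using x c by simp
  also have "\<dots> \<le> Gamma (1 + real n) / (c * c)"
  proof (rule frac_le)
    show "Gamma (x + 2) \<le> Gamma (1 + real n)"
      using Gamma_real_strict_mono[of "x + 2" "1 + real n"] n x c
      by (cases "x + 2 < 1 + real n") (auto intro!: eq_refl arg_cong[where f = Gamma])
    show "c * c \<le> x * (x + 1)" using x c by (intro mult_mono) auto
  qed (use c n in auto)
  also have "Gamma (1 + real n) = fact n" by (rule Gamma_fact)
  also have "fact n / (c * c) \<le> real n ^ n / (c * c)"
    using fact_le_power[of n, where 'a = real] c by (intro divide_right_mono) auto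
  also have "real n ^ n = exp (real n * ln (real n))" using n by (simp add: exp_of_nat_mult)
  also have "\<dots> \<le> exp (real n powr p / e)"
  proof -
    have "ln (real n) \<le> real n powr e / e" using n e by (intro ln_powr_bound) auto
    hence "real n * ln (real n) \<le> real n * (real n powr e / e)" by (intro mult_left_mono) auto
    also have "\<dots> = real n powr (1 + e) / e" using n by (simp add: powr_add)
    finally show ?thesis by (simp add: e_def)
  qed
  also have "\<dots> \<le> exp (3 powr p / e * (1 + x) powr p)"
  proof -
    have "real n powr p \<le> (3 * (1 + x)) powr p" using n p x c by (intro powr_mono2) auto
    also have "\<dots> = 3 powr p * (1 + x) powr p" by (rule powr_mult)
    finally show ?thesis using e by (simp add: divide_right_mono)
  qed
  also have "exp (3 powr p / e * (1 + x) powr p) / (c * c) = exp (3 powr p / e * (1 + x) powr p - ln (c * c))"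
    using c by (simp add: exp_diff)
  also have "\<dots> \<le> exp (C * (1 + x) powr p)"
  proof -
    have "1 \<le> (1 + x) powr p" using x c p by (intro ge_one_powr_ge_zero) auto
    hence "\<bar>ln (c * c)\<bar> \<le> \<bar>ln (c * c)\<bar> * (1 + x) powr p" by (simp add: mult_le_cancel_left1)
    thus ?thesis by (simp add: C_def distrib_right)
  qed
  finally show "Gamma x \<le> exp (C * (1 + x) powr p)" using c by (simp add: divide_right_mono)
qed

lemma Gamma_complex_le_exp:
  assumes c: "c > 0" and p: "p > 1"
  obtains C where "C \<ge> 0" "\<And>w. Re w \<ge> c \<Longrightarrow> norm (Gamma w :: complex) \<le> exp (C * (1 + norm w) powr p)"
proof -
  obtain C where C: "C \<ge> 0" "\<And>x. x \<ge> c \<Longrightarrow> Gamma x \<le> exp (C * (1 + x) powr p)"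
    using Gamma_real_le_exp[OF c p] by blast
  show thesis
  proof (rule that[OF C(1)])
    fix w :: complex assume w: "Re w \<ge> c"
    have "norm (Gamma w) \<le> Gamma (Re w)" using w c by (intro norm_Gamma_le_Gamma_Re) auto
    also have "\<dots> \<le> exp (C * (1 + Re w) powr p)" by (rule C(2)[OF w])
    also have "\<dots> \<le> exp (C * (1 + norm w) powr p)"
      using C(1) w c p complex_Re_le_cmod[of w]
      by (simp only: exp_le_cancel_iff) (intro mult_left_mono powr_mono2, auto)
    finally show "norm (Gamma w) \<le> exp (C * (1 + norm w) powr p)" .
  qed
qed

section \<open>Phragmen-Lindelof in sector-like regions and across a strip\<close>

lemma Re_powr_of_real:
  fixes w :: complex
  assumes "w \<noteq> 0"
  shows "Re (w powr of_real P) = norm w powr P * cos (P * Arg w)"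
  using assms by (simp add: powr_def Re_exp Arg_def cis_Arg)

text \<open>The damping factor exp (- \<delta> w^P) beats growth of order p < P on large arcs,
  because Re (w^P) \<ge> c |w|^P on S; then \<delta> tends to 0. Describing S by a lower bound for
  cos (P Arg w) instead of an opening angle covers half-planes and thin half-strips alike.\<close>

lemma Phragmen_Lindelof:
  assumes S: "closed S" "\<And>w. w \<in> S \<Longrightarrow> 0 \<le> Re w"
    and c: "c > 0" "\<And>w. w \<in> S \<Longrightarrow> w \<noteq> 0 \<Longrightarrow> c \<le> cos (P * Arg w)"
    and hol: "f holomorphic_on interior S" and cont: "continuous_on S f"
    and M: "M > 0" "\<And>w. w \<in> frontier S \<Longrightarrow> norm (f w) \<le> M"
    and growth: "\<And>w. w \<in> S \<Longrightarrow> norm (f w) \<le> exp (C * (1 + norm w) powr p)"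
    and p: "0 \<le> p" "p < P" and \<xi>: "\<xi> \<in> S"
  shows "norm (f \<xi>) \<le> M"
proof -
  define t where "t = Re (\<xi> powr of_real P)"
  have main: "norm (f \<xi>) \<le> M * exp (\<delta> * t)" if \<delta>: "\<delta> > 0" for \<delta>
  proof -
    define F where "F = (\<lambda>w. f w * exp (- (of_real \<delta> * w powr of_real P)))"
    have normF: "norm (F w) \<le> norm (f w) * exp (- (\<delta> * c * norm w powr P))" if w: "w \<in> S" for w
    proof (cases "w = 0")
      case True
      thus ?thesis using p by (simp add: F_def)
    next
      case False
      have "norm w powr P * c \<le> norm w powr P * cos (P * Arg w)"
        by (intro mult_left_mono c(2) w False) auto
      hence "\<delta> * (norm w powr P * c) \<le> \<delta> * Re (w powr of_real P)"
        using \<delta> False by (intro mult_left_mono) (auto simp: Re_powr_of_real)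
      hence "exp (- (\<delta> * Re (w powr of_real P))) \<le> exp (- (\<delta> * c * norm w powr P))"
        by (simp add: mult_ac)
      thus ?thesis by (simp add: F_def norm_mult mult_left_mono)
    qed
    have normF': "norm (F w) \<le> norm (f w)" if w: "w \<in> S" for w
    proof -
      have "exp (- (\<delta> * c * norm w powr P)) \<le> 1" using \<delta> c by simp
      thus ?thesis using normF[OF w] mult_left_mono[of _ 1 "norm (f w)"] by fastforce
    qed
    have "\<forall>\<^sub>F R in at_top. C * (1 + R) powr p - \<delta> * c * R powr P \<le> ln M"
    proof -
      have dc: "\<delta> * c > 0" using \<delta> c by simp
      have "((\<lambda>R::real. (1 + R) powr p / R powr P) \<longlongrightarrow> 0) at_top"
        using p by real_asymp
      hence "((\<lambda>R::real. C * ((1 + R) powr p / R powr P)) \<longlongrightarrow> 0) at_top"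
        using tendsto_mult_right_zero by blast
      hence 1: "\<forall>\<^sub>F R::real in at_top. C * ((1 + R) powr p / R powr P) < \<delta> * c / 2"
        by (rule order_tendstoD) (use dc in simp)
      have "filterlim (\<lambda>R::real. R powr P) at_top at_top" using p by real_asymp
      hence 2: "\<forall>\<^sub>F R::real in at_top. R powr P \<ge> - ln M / (\<delta> * c / 2)"
        by (simp add: filterlim_at_top)
      show ?thesis using 1 2 eventually_gt_at_top[of 0]
      proof eventually_elim
        case (elim R)
        have "C * (1 + R) powr p \<le> \<delta> * c / 2 * R powr P" using elim by (simp add: field_simps)
        moreover have "- ln M \<le> \<delta> * c / 2 * R powr P"
          using elim dc by (simp only: pos_divide_le_eq mult.commute) 
        ultimately show ?case by (simp add: algebra_simps)
      qed
    qed
    hence "\<forall>\<^sub>F R in at_top. C * (1 + R) powr p - \<delta> * c * R powr P \<le> ln M \<and> R > norm \<xi>"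
      using eventually_gt_at_top[of "norm \<xi>"] by eventually_elim auto
    then obtain R where R: "C * (1 + R) powr p - \<delta> * c * R powr P \<le> ln M" "R > norm \<xi>"
      by (auto simp: eventually_at_top_linorder)
    define T where "T = S \<inter> cball 0 R"
    have clT: "closed T" using S by (auto simp: T_def)
    \<comment> \<open>Interior points have positive real part, so they avoid the branch cut of the
      principal power.\<close>
    have intS: "interior S \<subseteq> {w. Re w > 0}"
    proof
      fix w assume "w \<in> interior S"
      then obtain e where e: "e > 0" "cball w e \<subseteq> S" by (auto simp: mem_interior_cball)
      hence "w - of_real e \<in> S" by (auto simp: dist_norm subset_iff)
      from S(2)[OF this] show "w \<in> {w. Re w > 0}" using e by simp
    qed
    have "norm (F \<xi>) \<le> M"
    proof (rule maximum_modulus_frontier[of F T])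
      have "interior T \<subseteq> interior S" by (simp add: T_def)
      show "F holomorphic_on interior T"
        unfolding F_def
        by (intro holomorphic_intros holomorphic_on_subset[OF hol])
           (use \<open>interior T \<subseteq> interior S\<close> intS in \<open>auto simp: complex_nonpos_Reals_iff dest!: subsetD\<close>)
      have "continuous_on S (\<lambda>w. w powr of_real P :: complex)"
        using S(2) p by (intro continuous_on_powr_complex continuous_intros) auto
      hence "continuous_on S F" unfolding F_def
        by (intro continuous_on_mult continuous_on_exp continuous_on_minus continuous_on_const cont)
      thus "continuous_on (closure T) F"
        using clT by (auto simp: T_def intro: continuous_on_subset)
      show "bounded T" by (auto simp: T_def bounded_Int)
      show "\<xi> \<in> T" using \<xi> R by (simp add: T_def)
      fix w assume w: "w \<in> frontier T"
      have wT: "w \<in> S" using w clT frontier_subset_closed by (auto simp: T_def)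
      have "w \<in> frontier S \<or> w \<in> frontier (cball 0 R)"
        using w frontier_Int_subset[of S "cball 0 R"] by (auto simp: T_def)
      moreover have "R > 0" using R norm_ge_zero[of \<xi>] by linarith
      ultimately consider "w \<in> frontier S" | "norm w = R" by (auto simp: frontier_cball)
      thus "norm (F w) \<le> M"
      proof cases
        case 1
        thus ?thesis using M(2) normF'[OF wT] by force
      next
        case 2
        have "norm (F w) \<le> exp (C * (1 + R) powr p) * exp (- (\<delta> * c * R powr P))"
          by (rule order_trans[OF normF[OF wT, unfolded 2] mult_right_mono[OF growth[OF wT, unfolded 2]]]) simp
        also have "\<dots> = exp (C * (1 + R) powr p - \<delta> * c * R powr P)" by (simp flip: exp_add)
        also have "\<dots> \<le> exp (ln M)" using R by (simp only: exp_le_cancel_iff)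
        finally show ?thesis using M by simp
      qed
    qed
    hence "norm (f \<xi>) * exp (- (\<delta> * t)) \<le> M" by (simp add: F_def norm_mult t_def)
    thus ?thesis by (simp add: exp_minus field_simps)
  qed
  have "((\<lambda>\<delta>. M * exp (\<delta> * t)) \<longlongrightarrow> M * exp (0 * t)) (at_right 0)"
    by (intro tendsto_intros)
  moreover have "\<forall>\<^sub>F \<delta> in at_right 0. norm (f \<xi>) \<le> M * exp (\<delta> * t)"
    using eventually_at_right_less[of 0] by eventually_elim (rule main)
  ultimately show ?thesis
    using tendsto_lowerbound[of "\<lambda>\<delta>. M * exp (\<delta> * t)" "M * exp (0 * t)" "at_right 0" "norm (f \<xi>)"] by simp
qed

lemma cos_mult_le_cos_1:
  fixes x P p :: real
  assumes "\<bar>x\<bar> \<le> 1 / P" "0 \<le> p" "p \<le> P" "0 < P"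
  shows "cos 1 \<le> cos (p * x)"
proof -
  have "\<bar>p * x\<bar> \<le> P * (1 / P)"
    unfolding abs_mult using assms by (intro mult_mono) auto
  hence "\<bar>p * x\<bar> \<le> 1" using assms by simp
  hence "cos 1 \<le> cos \<bar>p * x\<bar>" using pi_gt3 by (intro cos_monotone_0_pi_le) auto
  thus ?thesis by simp
qed

text \<open>What is known on the edges is a growth bound, not a constant, so it is divided out: G
  exp (- A w^p) is bounded on the boundary of the half-strip. Far to the right a half-strip lies in
  a sector of tiny opening, in which the a priori order \<rho>, however large, is harmless.\<close>

lemma growth_in_half_strip:
  assumes \<rho>: "growth_at_most \<rho> G" and p: "1 \<le> p" and C: "C \<ge> 0"
    and le: "\<And>w. 2 \<le> \<bar>Im w\<bar> \<Longrightarrow> norm (G w) \<le> exp (C * (1 + norm w) powr p)"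
  obtains T K where "T \<ge> 1" "K \<ge> 0"
    "\<And>w. Re w \<ge> T \<Longrightarrow> \<bar>Im w\<bar> \<le> 2 \<Longrightarrow> norm (G w) \<le> exp (K * (1 + norm w) powr p)"
proof -
  define \<rho>' where "\<rho>' = max \<rho> p"
  define P where "P = \<rho>' + 1"
  have P: "P > \<rho>'" "P > p" "P > 0" "\<rho>' \<ge> 0" using p by (auto simp: P_def \<rho>'_def)
  obtain D where D: "D \<ge> 0" "\<And>w. norm (G w) \<le> exp (D * (1 + norm w) powr \<rho>')"
    using growth_at_most_mono[OF \<rho>, of \<rho>'] by (auto simp: \<rho>'_def elim: growth_at_mostE)
  have "isCont Arg 1" by (intro continuous_at_Arg) auto
  then obtain \<eta> where \<eta>: "\<eta> > 0" "\<And>u. norm (u - 1) < \<eta> \<Longrightarrow> \<bar>Arg u\<bar> < 1 / P"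
    using P unfolding continuous_at_eps_delta dist_norm
    by (metis Arg_1 diff_zero real_norm_def zero_less_divide_1_iff)
  \<comment> \<open>Then |w / Re w - 1| \<le> 2 / T < \<eta> on the half-strip, so that P |Arg w|
    \<le> 1, and the cosines of P Arg w and p Arg w are both at least cos 1.\<close>
  define T where "T = max 1 (3 / \<eta>)"
  have T: "T \<ge> 1" "T \<ge> 3 / \<eta>" by (auto simp: T_def)
  define S where "S = {w. T \<le> Re w \<and> \<bar>Im w\<bar> \<le> 2}"
  have closedS: "closed S"
    unfolding S_def by (intro closed_Collect_conj closed_Collect_le continuous_intros)
  have Arg: "\<bar>Arg w\<bar> \<le> 1 / P" if "w \<in> S" for w
  proof -
    have w: "Re w \<ge> T" "\<bar>Im w\<bar> \<le> 2" "Re w > 0" using that T by (auto simp: S_def)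
    have "norm (w / of_real (Re w) - 1) = norm (w - of_real (Re w)) / Re w"
    proof -
      have "w / of_real (Re w) - 1 = (w - of_real (Re w)) / of_real (Re w)"
        using w by (subst diff_divide_distrib, subst divide_self) auto
      thus ?thesis using w by (simp only: norm_divide norm_of_real abs_of_pos)
    qed
    also have "w - of_real (Re w) = \<i> * of_real (Im w)" by (simp add: complex_eq_iff)
    also have "norm \<dots> = \<bar>Im w\<bar>" by (simp add: norm_mult)
    also have "\<bar>Im w\<bar> / Re w \<le> 2 / T" using w T by (intro frac_le) auto
    also have "2 / T < \<eta>" using T \<eta>(1) by (auto simp: field_simps)
    finally have "\<bar>Arg (w / of_real (Re w))\<bar> < 1 / P" by (rule \<eta>(2))
    also have "Arg (w / of_real (Re w)) = Arg w"
      using Arg_times_of_real[of "inverse (Re w)" w] w by (simp add: field_simps)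
    finally show ?thesis by simp
  qed
  define c where "c = cos (1 :: real)"
  have c: "c > 0" using cos_gt_zero_pi[of 1] pi_gt3 by (simp add: c_def)
  \<comment> \<open>On S one has 1 + |w| \<le> 2 |w|, so A c |w|^p dominates the exponent C (1 +
    |w|)^p that is valid on the edges |Im w| = 2.\<close>
  define A where "A = C * 2 powr p / c"
  have A: "A \<ge> 0" using C c by (simp add: A_def)
  define f where "f = (\<lambda>w. G w * exp (- (of_real A * w powr of_real p)))"
  have holG: "G holomorphic_on X" for X by (rule growth_at_most_imp_holomorphic[OF \<rho>])
  have S0: "Re w \<ge> 1" "w \<noteq> 0" "1 \<le> norm w" if "w \<in> S" for w
    using that T complex_Re_le_cmod[of w] by (auto simp: S_def)
  have normf: "norm (f w) \<le> norm (G w) * exp (- (A * c * norm w powr p))" if w: "w \<in> S" for w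
  proof -
    have "norm w powr p * c \<le> norm w powr p * cos (p * Arg w)"
      unfolding c_def using Arg[OF w] P p by (intro mult_left_mono cos_mult_le_cos_1[of _ P]) auto
    hence "A * (norm w powr p * c) \<le> A * Re (w powr of_real p)"
      using A S0(2)[OF w] by (intro mult_left_mono) (auto simp: Re_powr_of_real)
    hence "exp (- (A * Re (w powr of_real p))) \<le> exp (- (A * c * norm w powr p))"
      by (simp add: mult_ac)
    thus ?thesis by (simp add: f_def norm_mult mult_left_mono)
  qed
  have normf': "norm (f w) \<le> norm (G w)" if w: "w \<in> S" for w
  proof -
    have "exp (- (A * c * norm w powr p)) \<le> 1" using A c by simp
    thus ?thesis using normf[OF w] mult_left_mono[of _ 1 "norm (G w)"] by fastforce
  qed
  have holf: "f holomorphic_on {w. Re w > 0}"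
    unfolding f_def by (intro holomorphic_intros holG) (auto simp: complex_nonpos_Reals_iff)
  have "compact {w. Re w = T \<and> \<bar>Im w\<bar> \<le> 2}"
  proof -
    have "closed {w. Re w = T \<and> \<bar>Im w\<bar> \<le> 2}"
      by (intro closed_Collect_conj closed_Collect_le closed_Collect_eq continuous_intros)
    moreover have "bounded {w. Re w = T \<and> \<bar>Im w\<bar> \<le> 2}"
      unfolding bounded_iff
    proof (intro exI ballI)
      fix w assume "w \<in> {w. Re w = T \<and> \<bar>Im w\<bar> \<le> 2}"
      thus "norm w \<le> T + 2" using cmod_le[of w] T by auto
    qed
    ultimately show ?thesis by (simp add: compact_eq_bounded_closed)
  qed
  hence "bounded (G ` {w. Re w = T \<and> \<bar>Im w\<bar> \<le> 2})"
    by (intro compact_imp_bounded compact_continuous_image holomorphic_on_imp_continuous_on holG)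
  then obtain M0 where M0: "\<And>w. Re w = T \<Longrightarrow> \<bar>Im w\<bar> \<le> 2 \<Longrightarrow> norm (G w) \<le> M0"
    by (auto simp: bounded_iff)
  define M where "M = max 1 M0"
  have fM: "norm (f w) \<le> M" if "w \<in> S" for w
  proof (rule Phragmen_Lindelof[OF closedS _ c _ _ _ _ _ _ _ P(1) that])
    show "0 \<le> Re w" if "w \<in> S" for w using S0(1)[OF that] by simp
    show "c \<le> cos (P * Arg w)" if "w \<in> S" for w
      unfolding c_def using Arg[OF that] P by (intro cos_mult_le_cos_1[of _ P]) auto
    show "f holomorphic_on interior S"
      by (rule holomorphic_on_subset[OF holf]) (use S0(1) interior_subset in fastforce)
    show "continuous_on S f"
      by (rule continuous_on_subset[OF holomorphic_on_imp_continuous_on[OF holf]]) (use S0(1) in fastforce)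
    show "M > 0" by (simp add: M_def)
    show "norm (f w) \<le> exp (D * (1 + norm w) powr \<rho>')" if "w \<in> S" for w
      using normf'[OF that] D(2)[of w] by linarith
    show "0 \<le> \<rho>'" by fact
    fix w assume w: "w \<in> frontier S"
    have wS: "w \<in> S" using w closedS frontier_subset_closed by blast
    have "\<not> (T < Re w \<and> \<bar>Im w\<bar> < 2)"
    proof
      assume *: "T < Re w \<and> \<bar>Im w\<bar> < 2"
      have "open {w. T < Re w \<and> \<bar>Im w\<bar> < 2}"
        by (intro open_Collect_conj open_Collect_less continuous_intros)
      moreover have "{w. T < Re w \<and> \<bar>Im w\<bar> < 2} \<subseteq> S" by (auto simp: S_def)
      ultimately have "w \<in> interior S" using * by (auto simp: interior_def)
      thus False using w by (simp add: frontier_def)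
    qed
    then consider "Re w = T" "\<bar>Im w\<bar> \<le> 2" | "\<bar>Im w\<bar> = 2" using wS by (fastforce simp: S_def)
    thus "norm (f w) \<le> M"
    proof cases
      case 1
      thus ?thesis using M0[of w] normf'[OF wS] by (simp add: M_def)
    next
      case 2
      have "(1 + norm w) powr p \<le> (2 * norm w) powr p"
        using S0(3)[OF wS] p by (intro powr_mono2) auto
      hence "C * (1 + norm w) powr p \<le> C * (2 powr p * norm w powr p)"
        using C by (intro mult_left_mono) (auto simp: powr_mult)
      also have "\<dots> = A * c * norm w powr p" using c by (simp add: A_def)
      finally have "exp (C * (1 + norm w) powr p) \<le> exp (A * c * norm w powr p)"
        by (subst exp_le_cancel_iff)
      moreover have "norm (G w) \<le> exp (C * (1 + norm w) powr p)" using le[of w] 2 by simp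
      ultimately have "norm (G w) \<le> exp (A * c * norm w powr p)" by linarith
      hence "norm (G w) * exp (- (A * c * norm w powr p)) \<le>
          exp (A * c * norm w powr p) * exp (- (A * c * norm w powr p))"
        by (intro mult_right_mono) auto
      also have "\<dots> = 1" by (simp flip: exp_add)
      finally show ?thesis using normf[OF wS] by (simp add: M_def)
    qed
  qed
  show thesis
  proof (rule that[OF T(1)])
    show "ln M + A \<ge> 0" using A by (simp add: M_def)
    fix w assume "Re w \<ge> T" "\<bar>Im w\<bar> \<le> 2"
    hence w: "w \<in> S" by (simp add: S_def)
    have "norm (G w) = norm (f w) * exp (A * Re (w powr of_real p))"
      by (simp add: f_def norm_mult flip: exp_add)
    also have "\<dots> \<le> M * exp (A * norm w powr p)"
    proof (intro mult_mono fM w)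
      have "Re (w powr of_real p) \<le> norm w powr p * 1"
        unfolding Re_powr_of_real[OF S0(2)[OF w]] by (intro mult_left_mono) auto
      thus "exp (A * Re (w powr of_real p)) \<le> exp (A * norm w powr p)"
        using A by (simp add: mult_left_mono)
    qed (auto simp: M_def)
    also have "\<dots> = exp (ln M + A * norm w powr p)"
      by (simp add: exp_add M_def)
    also have "\<dots> \<le> exp ((ln M + A) * (1 + norm w) powr p)"
    proof -
      have "norm w powr p \<le> (1 + norm w) powr p" using p by (intro powr_mono2) auto
      hence "A * norm w powr p \<le> A * (1 + norm w) powr p" using A by (rule mult_left_mono)
      moreover have "ln M \<le> ln M * (1 + norm w) powr p"
        using one_le_one_plus_norm_powr[of p w] p by (simp add: M_def mult_le_cancel_left1)
      ultimately show ?thesis by (simp add: distrib_right)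
    qed
    finally show "norm (G w) \<le> exp ((ln M + A) * (1 + norm w) powr p)" .
  qed
qed

text \<open>Rotations by \<i> and -\<i> turn the two ends of the strip |Re s| \<le> 2 into
  half-strips around the positive real axis; the bounded middle piece is left to
  compactness.\<close>

lemma growth_at_most_from_off_strip:
  assumes \<rho>: "growth_at_most \<rho> G" and p: "1 \<le> p" and C: "C \<ge> 0"
    and le: "\<And>w. 2 \<le> \<bar>Re w\<bar> \<Longrightarrow> norm (G w) \<le> exp (C * (1 + norm w) powr p)"
  shows "growth_at_most p G"
proof -
  have half: "\<exists>T K. T \<ge> 1 \<and> K \<ge> 0 \<and> (\<forall>w. Re w \<ge> T \<longrightarrow> \<bar>Im w\<bar> \<le> 2 \<longrightarrow>
      norm (G (u * w)) \<le> exp (K * (1 + norm w) powr p))" if u: "u = \<i> \<or> u = -\<i>" for u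
  proof -
    have "growth_at_most (max \<rho> 0) (\<lambda>w. G (u * w + 0))"
      by (intro growth_at_most_affine_comp growth_at_most_mono[OF \<rho>]) auto
    hence 1: "growth_at_most (max \<rho> 0) (\<lambda>w. G (u * w))" by simp
    show ?thesis
      by (rule growth_in_half_strip[OF 1 p C])
         (use u le[of "u * _"] in \<open>auto simp: norm_mult\<close>)
  qed
  obtain T1 K1 where 1: "T1 \<ge> 1" "K1 \<ge> 0" "\<And>w. Re w \<ge> T1 \<Longrightarrow> \<bar>Im w\<bar> \<le> 2 \<Longrightarrow>
      norm (G (\<i> * w)) \<le> exp (K1 * (1 + norm w) powr p)" using half[of \<i>] by auto
  obtain T2 K2 where 2: "T2 \<ge> 1" "K2 \<ge> 0" "\<And>w. Re w \<ge> T2 \<Longrightarrow> \<bar>Im w\<bar> \<le> 2 \<Longrightarrow>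
      norm (G (- \<i> * w)) \<le> exp (K2 * (1 + norm w) powr p)" using half[of "-\<i>"] by auto
  define K where "K = max C (max K1 K2)"
  show ?thesis
  proof (rule growth_at_most_from_large[OF growth_at_most_imp_holomorphic[OF \<rho>]])
    fix s :: complex assume s: "norm s \<ge> max T1 T2 + 2"
    have Kle: "exp (x * (1 + norm s) powr p) \<le> exp (K * (1 + norm s) powr p)" if "x \<le> K" for x
      using that by (auto intro: mult_right_mono)
    consider "\<bar>Re s\<bar> \<ge> 2" | "\<bar>Re s\<bar> \<le> 2" "Im s \<ge> T1" | "\<bar>Re s\<bar> \<le> 2" "- Im s \<ge> T2"
      using s cmod_le[of s] by linarith
    thus "norm (G s) \<le> exp (K * (1 + norm s) powr p)"
    proof cases
      case 1
      show ?thesis by (rule order_trans[OF le[OF 1] Kle]) (simp add: K_def)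
    next
      case 2
      have "norm (G (\<i> * (- \<i> * s))) \<le> exp (K1 * (1 + norm (- \<i> * s)) powr p)"
        by (rule 1(3)) (use 2 in auto)
      hence "norm (G s) \<le> exp (K1 * (1 + norm s) powr p)" by (simp add: norm_mult)
      also have "\<dots> \<le> exp (K * (1 + norm s) powr p)" by (rule Kle) (simp add: K_def)
      finally show ?thesis .
    next
      case 3
      have "norm (G (- \<i> * (\<i> * s))) \<le> exp (K2 * (1 + norm (\<i> * s)) powr p)"
        by (rule 2(3)) (use 3 in auto)
      hence "norm (G s) \<le> exp (K2 * (1 + norm s) powr p)" by (simp add: norm_mult)
      also have "\<dots> \<le> exp (K * (1 + norm s) powr p)" by (rule Kle) (simp add: K_def)
      finally show ?thesis .
    qed
  qed (use p in auto)
qed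

text \<open>A growth bound on a subset and without holomorphy: the functional equation involves cnj
  s, so the factors to be estimated are not holomorphic, and their bounds hold only on a
  half-plane.\<close>

definition exp_bounded_on :: "complex set \<Rightarrow> real \<Rightarrow> (complex \<Rightarrow> complex) \<Rightarrow> bool" where
  "exp_bounded_on A p u \<longleftrightarrow> (\<exists>C\<ge>0. \<forall>s\<in>A. norm (u s) \<le> exp (C * (1 + norm s) powr p))"

lemma exp_bounded_on_mult:
  assumes "exp_bounded_on A p u" "exp_bounded_on A p v"
  shows "exp_bounded_on A p (\<lambda>s. u s * v s)"
proof -
  obtain C D where CD: "C \<ge> 0" "D \<ge> 0" "\<forall>s\<in>A. norm (u s) \<le> exp (C * (1 + norm s) powr p)"
    "\<forall>s\<in>A. norm (v s) \<le> exp (D * (1 + norm s) powr p)"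
    using assms unfolding exp_bounded_on_def by blast
  show ?thesis
    unfolding exp_bounded_on_def
  proof (intro exI[of _ "C + D"] conjI ballI)
    fix s assume "s \<in> A"
    hence "norm (u s) * norm (v s) \<le> exp (C * (1 + norm s) powr p) * exp (D * (1 + norm s) powr p)"
      using CD by (intro mult_mono) auto
    thus "norm (u s * v s) \<le> exp ((C + D) * (1 + norm s) powr p)"
      by (simp add: norm_mult distrib_right exp_add)
  qed (use CD in auto)
qed

lemma exp_bounded_on_bounded:
  assumes "p \<ge> 0" "\<And>s. s \<in> A \<Longrightarrow> norm (u s) \<le> B"
  shows "exp_bounded_on A p u"
  unfolding exp_bounded_on_def
proof (intro exI[of _ "max 0 B"] conjI ballI)
  fix s assume "s \<in> A"
  hence "norm (u s) \<le> max 0 B * 1" using assms(2)[of s] by simp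
  also have "\<dots> \<le> max 0 B * (1 + norm s) powr p"
    by (intro mult_left_mono one_le_one_plus_norm_powr assms) auto
  also have "\<dots> \<le> exp \<dots>" using exp_ge_add_one_self[of "max 0 B * (1 + norm s) powr p"] by linarith
  finally show "norm (u s) \<le> exp (max 0 B * (1 + norm s) powr p)" .
qed auto

lemma exp_bounded_on_prod:
  assumes "p \<ge> 0" "\<And>j. j < (K :: nat) \<Longrightarrow> exp_bounded_on A p (u j)"
  shows "exp_bounded_on A p (\<lambda>s. \<Prod>j<K. u j s)"
  using assms(2)
proof (induction K)
  case 0
  show ?case using assms(1) by (intro exp_bounded_on_bounded[of p A _ 1]) auto
next
  case (Suc K)
  thus ?case by (simp add: exp_bounded_on_mult)
qed

lemma growth_at_most_imp_exp_bounded_on: "growth_at_most p f \<Longrightarrow> exp_bounded_on A p f"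
  unfolding growth_at_most_def exp_bounded_on_def by blast

lemma exp_bounded_on_affine_norm:
  assumes u: "\<And>s. s \<in> A \<Longrightarrow> norm (u s) \<le> exp (C * (1 + norm (v s)) powr p)" and C: "C \<ge> 0"
    and v: "\<And>s. s \<in> A \<Longrightarrow> 1 + norm (v s) \<le> M * (1 + norm s)" and p: "p \<ge> 0"
  shows "exp_bounded_on A p u"
  unfolding exp_bounded_on_def
proof (intro exI[of _ "C * M powr p"] conjI ballI)
  fix s assume s: "s \<in> A"
  have "(1 + norm (v s)) powr p \<le> (M * (1 + norm s)) powr p"
    using v[OF s] p by (intro powr_mono2) auto
  also have "\<dots> = M powr p * (1 + norm s) powr p" by (rule powr_mult)
  finally have "C * (1 + norm (v s)) powr p \<le> C * M powr p * (1 + norm s) powr p"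
    using C mult_left_mono[of _ _ C] by (simp add: mult.assoc)
  thus "norm (u s) \<le> exp (C * M powr p * (1 + norm s) powr p)"
    using u[OF s] by (meson exp_le_cancel_iff order_trans)
qed (use C in auto)

section \<open>Growth of elements of the extended Selberg class\<close>

lemma powr_eq_exp_ln_mult: "Q > 0 \<Longrightarrow> of_real Q powr s = exp (s * of_real (ln Q))" for s :: complex
  by (simp add: powr_def Ln_of_real)

text \<open>With \<epsilon> = 1/2 in the Ramanujan hypothesis the terms are O(n^(-3/2)), uniformly
  for Re s \<ge> 2.\<close>

lemma selberg_bounded_right:
  assumes "L \<in> extended_selberg_class"
  obtains B where "B > 0" "\<And>s. Re s \<ge> 2 \<Longrightarrow> norm (L s) \<le> B"
proof -
  from assms obtain a where a: "ramanujan_hypothesis a"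
    and L: "\<And>s. Re s > 1 \<Longrightarrow> (\<lambda>n. a (Suc n) / of_nat (Suc n) powr s) sums L s"
    unfolding extended_selberg_class_def by blast
  from a have "(\<lambda>n. norm (a n)) \<in> O(\<lambda>n. real n powr (1 / 2))"
    unfolding ramanujan_hypothesis_def by (metis half_gt_zero_iff zero_less_one)
  then obtain C where C: "C > 0" "\<forall>\<^sub>F n in sequentially. norm (a n) \<le> C * real n powr (1 / 2)"
    by (elim landau_o.bigE) auto
  then obtain N where N: "\<And>n. n \<ge> N \<Longrightarrow> norm (a n) \<le> C * real n powr (1 / 2)"
    by (auto simp: eventually_sequentially)
  \<comment> \<open>The finite sum accommodates the coefficients below N, so that one constant works
    for all n \<ge> 1.\<close>
  define D where "D = C + (\<Sum>n<N. norm (a n))"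
  have D: "norm (a n) \<le> D * real n powr (1 / 2)" if "n \<ge> 1" for n
  proof -
    have n1: "1 \<le> real n powr (1 / 2)" using that by (intro ge_one_powr_ge_zero) auto
    show ?thesis
    proof (cases "n \<ge> N")
      case True
      have "C \<le> D" by (simp add: D_def sum_nonneg)
      thus ?thesis using N[OF True] n1 mult_right_mono[of C D "real n powr (1 / 2)"] by linarith
    next
      case False
      hence "norm (a n) \<le> (\<Sum>n<N. norm (a n))" by (intro member_le_sum) auto
      also have "\<dots> \<le> D * 1" using C by (simp add: D_def)
      also have "\<dots> \<le> D * real n powr (1 / 2)"
        using n1 C by (intro mult_left_mono) (auto simp: D_def intro!: add_nonneg_nonneg sum_nonneg)
      finally show ?thesis .
    qed
  qed
  have D0: "D > 0" using C by (simp add: D_def add_pos_nonneg sum_nonneg)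
  define B where "B = (\<Sum>n. D * real (Suc n) powr (- 3 / 2))"
  have summ: "summable (\<lambda>n. D * real (Suc n) powr (- 3 / 2))"
    by (intro summable_mult) (subst summable_Suc_iff, simp add: summable_real_powr_iff)
  show thesis
  proof (rule that)
    show "\<bar>B\<bar> + 1 > 0" by simp
    fix s assume s: "Re s \<ge> 2"
    have "norm (a (Suc n) / of_nat (Suc n) powr s) \<le> D * real (Suc n) powr (- 3 / 2)" for n
    proof -
      have "norm (of_nat (Suc n) powr s) = real (Suc n) powr Re s"
        by (subst norm_powr_real_powr) auto
      hence "norm (a (Suc n) / of_nat (Suc n) powr s) \<le> D * real (Suc n) powr (1 / 2) / real (Suc n) powr Re s"
        using D[of "Suc n"] by (simp add: norm_divide divide_right_mono)
      also have "\<dots> = D * real (Suc n) powr (1 / 2 - Re s)" by (simp add: powr_diff)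
      also have "\<dots> \<le> D * real (Suc n) powr (- 3 / 2)"
        using s D0 by (intro mult_left_mono powr_mono) auto
      finally show ?thesis .
    qed
    hence "norm (suminf (\<lambda>n. a (Suc n) / of_nat (Suc n) powr s)) \<le> B"
      unfolding B_def by (intro norm_suminf_le summ) auto
    moreover have "suminf (\<lambda>n. a (Suc n) / of_nat (Suc n) powr s) = L s"
      by (rule sums_unique[symmetric, OF L]) (use s in auto)
    ultimately show "norm (L s) \<le> \<bar>B\<bar> + 1" by simp
  qed
qed

lemma selberg_holomorphic:
  assumes "L \<in> extended_selberg_class"
  shows "L holomorphic_on - {1}"
proof -
  from assms obtain k g where g: "g holomorphic_on UNIV" "\<And>s. s \<noteq> 1 \<Longrightarrow> g s = (s - 1) ^ k * L s"
    unfolding extended_selberg_class_def selberg_continuation_def by blast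
  have "(\<lambda>s. g s / (s - 1) ^ k) holomorphic_on - {1}"
    by (intro holomorphic_intros holomorphic_on_subset[OF g(1)]) auto
  thus ?thesis by (rule holomorphic_transform) (auto simp: g(2))
qed

text \<open>Serves to leave the poles of the Gamma factors by an arbitrarily small horizontal
  shift.\<close>

lemma nonpos_Ints_affine_countable:
  fixes l :: real and m s :: complex
  assumes "l \<noteq> 0"
  shows "countable {t :: real. of_real l * (s - of_real t) + m \<in> \<int>\<^sub>\<le>\<^sub>0}"
proof (rule countable_subset)
  show "{t. of_real l * (s - of_real t) + m \<in> \<int>\<^sub>\<le>\<^sub>0} \<subseteq>
      range (\<lambda>n::nat. Re ((of_real l * s + m + of_nat n) / of_real l))"
  proof
    fix t :: real assume "t \<in> {t. of_real l * (s - of_real t) + m \<in> \<int>\<^sub>\<le>\<^sub>0}"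
    then obtain n where "of_real l * (s - of_real t) + m = - of_nat n"
      by (auto elim!: nonpos_Ints_cases')
    hence "of_real l * of_real t = of_real l * s + m + of_nat n"
      by (simp add: algebra_simps)
    hence "(of_real l * s + m + of_nat n) / of_real l = of_real t"
      using assms by (metis nonzero_mult_div_cancel_left of_real_eq_0_iff)
    hence "t = Re ((of_real l * s + m + of_nat n) / of_real l)" by simp
    thus "t \<in> range (\<lambda>n::nat. Re ((of_real l * s + m + of_nat n) / of_real l))" by blast
  qed
qed auto

text \<open>Off the poles of its factors the product is analytic, and \<open>remove_sings\<close>
  leaves the value at analytic points unchanged.\<close>

lemma completed_L_eq:
  assumes L: "L holomorphic_on - {1}" and s: "s \<noteq> 1" and Q: "Q > 0"
    and nonpole: "\<And>j. j < K \<Longrightarrow> of_real (lam j) * s + mu j \<notin> \<int>\<^sub>\<le>\<^sub>0"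
  shows "completed_L Q K lam mu L s =
    L s * exp (s * of_real (ln Q)) * (\<Prod>j<K. Gamma (of_real (lam j) * s + mu j))"
proof -
  have h1: "L analytic_on {s}"
    using analytic_on_open[of "- {1}"] L s analytic_on_subset[of L "- {1}" "{s}"] by auto
  have h2: "(\<lambda>s. \<Prod>j<K. Gamma (of_real (lam j) * s + mu j)) analytic_on {s}"
  proof (rule analytic_on_prod)
    fix j assume "j \<in> {..<K}"
    hence "Gamma analytic_on ((\<lambda>s. of_real (lam j) * s + mu j) ` {s})"
      using nonpole by (intro analytic_Gamma) auto
    moreover have "(\<lambda>s. of_real (lam j) * s + mu j) analytic_on {s}" by (intro analytic_intros)
    ultimately show "(\<lambda>s. Gamma (of_real (lam j) * s + mu j)) analytic_on {s}"
      using analytic_on_compose[of "\<lambda>s. of_real (lam j) * s + mu j" "{s}" Gamma] by (simp add: o_def)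
  qed
  have h3: "(\<lambda>s. exp (s * of_real (ln Q))) analytic_on {s}"
    by (rule holomorphic_on_imp_analytic_at[of _ UNIV]) (auto intro!: holomorphic_intros)
  have "(\<lambda>s. L s * exp (s * of_real (ln Q)) *
      (\<Prod>j<K. Gamma (of_real (lam j) * s + mu j))) analytic_on {s}"
    by (intro analytic_on_mult h1 h2 h3)
  thus ?thesis
    unfolding completed_L_def powr_eq_exp_ln_mult[OF Q] by (rule remove_sings_at_analytic)
qed

text \<open>The functional equation expresses L at s through L at 1 - cnj s, where the real part is
  at least 2 and L is bounded; \<open>rGamma\<close> replaces the reciprocals of the Gamma factors.
  At a pole of such a factor the completed function does not yield L s directly, so these points are
  reached by continuity.\<close>

lemma selberg_left_bound:
  assumes L: "L \<in> extended_selberg_class" and p: "1 < p" "p \<le> 2"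
  shows "exp_bounded_on {s. Re s \<le> -1} p L"
proof -
  obtain B where B: "B > 0" "\<And>s. Re s \<ge> 2 \<Longrightarrow> norm (L s) \<le> B"
    using selberg_bounded_right[OF L] by blast
  note hol = selberg_holomorphic[OF L]
  from L obtain Q K lam mu \<omega> where Q: "Q > 0" and lam: "\<And>j. j < K \<Longrightarrow> lam j > 0"
    "\<And>j. j < (K :: nat) \<Longrightarrow> Re (mu j) \<ge> 0" and \<omega>: "norm \<omega> = 1"
    and fe: "\<And>s. completed_L Q K lam mu L s = \<omega> * cnj (completed_L Q K lam mu L (1 - cnj s))"
    unfolding extended_selberg_class_def selberg_functional_equation_def by blast
  define A where "A = {s. Re s \<le> -1}"
  \<comment> \<open>For Re s \<le> -1 and off the poles of the Gamma factors |u s| = |L s|: this is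
    the functional equation solved for L s, where the outer conjugation and \<omega> do not affect
    the modulus.\<close>
  define u where "u = (\<lambda>s. L (1 - cnj s) *
      (exp ((1 - cnj s) * of_real (ln Q)) * exp (- s * of_real (ln Q))) *
      (\<Prod>j<K. Gamma (of_real (lam j) * (1 - cnj s) + mu j) * rGamma (of_real (lam j) * s + mu j)))"
  have "exp_bounded_on A p u"
    unfolding u_def
  proof (intro exp_bounded_on_mult exp_bounded_on_prod)
    show "exp_bounded_on A p (\<lambda>s. L (1 - cnj s))"
      by (rule exp_bounded_on_bounded[of _ _ _ B]) (use p B in \<open>auto simp: A_def\<close>)
    show "exp_bounded_on A p (\<lambda>s. exp (- s * of_real (ln Q)))"
    proof (rule exp_bounded_on_affine_norm[where A = A and C = "\<bar>ln Q\<bar>" and v = "\<lambda>s. s" and M = 1])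
      fix s :: complex
      have "norm (exp (- s * of_real (ln Q))) \<le> exp (\<bar>Re s\<bar> * \<bar>ln Q\<bar>)"
        using abs_ge_minus_self[of "Re s * ln Q"] by (simp add: abs_mult)
      also have "\<dots> \<le> exp (\<bar>ln Q\<bar> * (1 + norm s) powr p)"
      proof -
        have "\<bar>Re s\<bar> \<le> (1 + norm s) powr 1" using abs_Re_le_cmod[of s] by simp
        also have "\<dots> \<le> (1 + norm s) powr p" using p by (intro powr_mono) auto
        finally show ?thesis using mult_right_mono[of _ _ "\<bar>ln Q\<bar>"] by (subst mult.commute) simp
      qed
      finally show "norm (exp (- s * of_real (ln Q))) \<le> exp (\<bar>ln Q\<bar> * (1 + norm s) powr p)" .
    qed (use p in auto)
    show "exp_bounded_on A p (\<lambda>s. exp ((1 - cnj s) * of_real (ln Q)))"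
    proof (rule exp_bounded_on_affine_norm[where A = A and C = "\<bar>ln Q\<bar>" and v = "\<lambda>s. s" and M = 1])
      fix s :: complex
      have "norm (exp ((1 - cnj s) * of_real (ln Q))) \<le> exp (\<bar>1 - Re s\<bar> * \<bar>ln Q\<bar>)"
        using abs_ge_self[of "(1 - Re s) * ln Q"] by (simp add: abs_mult)
      also have "\<dots> \<le> exp (\<bar>ln Q\<bar> * (1 + norm s) powr p)"
      proof -
        have "\<bar>1 - Re s\<bar> \<le> (1 + norm s) powr 1" using abs_Re_le_cmod[of s] by simp
        also have "\<dots> \<le> (1 + norm s) powr p" using p by (intro powr_mono) auto
        finally show ?thesis using mult_right_mono[of _ _ "\<bar>ln Q\<bar>"] by (subst mult.commute) simp
      qed
      finally show "norm (exp ((1 - cnj s) * of_real (ln Q))) \<le> exp (\<bar>ln Q\<bar> * (1 + norm s) powr p)" .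
    qed (use p in auto)
    fix j assume j: "j < K"
    show "exp_bounded_on A p (\<lambda>s. rGamma (of_real (lam j) * s + mu j))"
      by (rule growth_at_most_imp_exp_bounded_on, rule growth_at_most_affine_comp, rule growth_at_most_rGamma)
         (use p in auto)
    obtain C where C: "C \<ge> 0" "\<And>w. Re w \<ge> lam j \<Longrightarrow> norm (Gamma w :: complex) \<le> exp (C * (1 + norm w) powr p)"
      using Gamma_complex_le_exp[OF lam(1)[OF j] p(1)] by blast
    show "exp_bounded_on A p (\<lambda>s. Gamma (of_real (lam j) * (1 - cnj s) + mu j))"
    proof (rule exp_bounded_on_affine_norm[where A = A and C = C and M = "1 + lam j + norm (mu j)" and
          v = "\<lambda>s. of_real (lam j) * (1 - cnj s) + mu j"])
      fix s assume s: "s \<in> A"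
      have "lam j * 1 \<le> lam j * (1 - Re s)"
        using s lam(1)[OF j] by (intro mult_left_mono) (auto simp: A_def)
      thus "norm (Gamma (of_real (lam j) * (1 - cnj s) + mu j)) \<le>
          exp (C * (1 + norm (of_real (lam j) * (1 - cnj s) + mu j)) powr p)"
        using lam(2)[OF j] by (intro C) simp
      have "norm (of_real (lam j) * (1 - cnj s) + mu j) \<le> lam j * norm (1 - cnj s) + norm (mu j)"
        using norm_triangle_ineq[of "of_real (lam j) * (1 - cnj s)" "mu j"] lam(1)[OF j]
        by (simp add: norm_mult)
      also have "norm (1 - cnj s) \<le> 1 + norm s" using norm_triangle_ineq4[of 1 "cnj s"] by simp
      finally have "1 + norm (of_real (lam j) * (1 - cnj s) + mu j) \<le> 1 + lam j * (1 + norm s) + norm (mu j)"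
        using lam(1)[OF j] by (simp add: mult_left_mono)
      also have "\<dots> \<le> (1 + lam j + norm (mu j)) * (1 + norm s)"
      proof -
        have "0 \<le> norm s + norm (mu j) * norm s" by simp
        thus ?thesis by (simp add: algebra_simps)
      qed
      finally show "1 + norm (of_real (lam j) * (1 - cnj s) + mu j) \<le> (1 + lam j + norm (mu j)) * (1 + norm s)" .
    qed (use C p in auto)
  qed (use p in auto)
  then obtain C where C: "C \<ge> 0" "\<And>s. s \<in> A \<Longrightarrow> norm (u s) \<le> exp (C * (1 + norm s) powr p)"
    unfolding exp_bounded_on_def by blast
  have good: "norm (L s) \<le> exp (C * (1 + norm s) powr p)"
    if s: "Re s \<le> -1" and np: "\<And>j. j < K \<Longrightarrow> of_real (lam j) * s + mu j \<notin> \<int>\<^sub>\<le>\<^sub>0" for s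
  proof -
    define s' where "s' = 1 - cnj s"
    have np': "of_real (lam j) * s' + mu j \<notin> \<int>\<^sub>\<le>\<^sub>0" if "j < K" for j
    proof
      assume "of_real (lam j) * s' + mu j \<in> \<int>\<^sub>\<le>\<^sub>0"
      then obtain n where "of_real (lam j) * s' + mu j = - of_nat n" by (elim nonpos_Ints_cases')
      hence "Re (of_real (lam j) * s' + mu j) \<le> 0" by (simp only:) simp
      moreover have "0 < lam j * Re s'" using s lam(1)[OF that] by (simp add: s'_def)
      ultimately show False using lam(2)[OF that] by simp
    qed
    define G1 where "G1 = (\<Prod>j<K. Gamma (of_real (lam j) * s + mu j))"
    define G2 where "G2 = (\<Prod>j<K. Gamma (of_real (lam j) * s' + mu j))"
    define R where "R = (\<Prod>j<K. rGamma (of_real (lam j) * s + mu j))"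
    have GR: "G1 * R = 1"
      unfolding G1_def R_def prod.distrib[symmetric]
      using np by (intro prod.neutral) (auto simp: rGamma_inverse_Gamma Gamma_eq_zero_iff)
    have "s \<noteq> 1" "s' \<noteq> 1" using s by (auto simp: s'_def)
    hence eq: "L s * exp (s * of_real (ln Q)) * G1 = \<omega> * cnj (L s' * exp (s' * of_real (ln Q)) * G2)"
      using fe[of s] unfolding s'_def[symmetric] G1_def G2_def
      by (simp only: completed_L_eq[OF hol \<open>s \<noteq> 1\<close> Q np] completed_L_eq[OF hol \<open>s' \<noteq> 1\<close> Q np'])
    have "L s = (L s * exp (s * of_real (ln Q)) * G1) * (R * exp (- s * of_real (ln Q)))"
    proof -
      have "L s * exp (s * of_real (ln Q)) * G1 * (R * exp (- s * of_real (ln Q))) =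
          L s * (exp (s * of_real (ln Q)) * exp (- s * of_real (ln Q))) * (G1 * R)"
        by (simp only: mult_ac)
      also have "exp (s * of_real (ln Q)) * exp (- s * of_real (ln Q)) = 1"
        by (simp flip: exp_add)
      finally show ?thesis using GR by simp
    qed
    hence "norm (L s) = norm (L s * exp (s * of_real (ln Q)) * G1) * norm (R * exp (- s * of_real (ln Q)))"
      by (metis norm_mult)
    also have "norm (L s * exp (s * of_real (ln Q)) * G1) = norm (L s' * exp (s' * of_real (ln Q)) * G2)"
      unfolding eq by (simp add: norm_mult \<omega>)
    also have "norm (L s' * exp (s' * of_real (ln Q)) * G2) * norm (R * exp (- s * of_real (ln Q))) =
        norm (L s' * (exp (s' * of_real (ln Q)) * exp (- s * of_real (ln Q))) * (G2 * R))"
      by (simp only: norm_mult mult_ac)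
    also have "\<dots> = norm (u s)"
      by (simp add: u_def prod.distrib norm_mult G2_def R_def s'_def)
    also have "\<dots> \<le> exp (C * (1 + norm s) powr p)" by (rule C) (use s in \<open>simp add: A_def\<close>)
    finally show ?thesis .
  qed
  have "norm (L s) \<le> exp (C * (1 + norm s) powr p)" if s: "Re s \<le> -1" for s
  proof (rule ccontr)
    assume contr: "\<not> ?thesis"
    \<comment> \<open>A violation at s persists under all small shifts to s - t by continuity,
      whereas only countably many t meet a pole of a Gamma factor. Moving to the left stays inside
      Re \<le> -1.\<close>
    define F where "F = (\<lambda>t::real. norm (L (s - of_real t)) - exp (C * (1 + norm (s - of_real t)) powr p))"
    have "continuous_on {0..1} F"
      unfolding F_def
    proof (intro continuous_intros continuous_on_compose2[OF holomorphic_on_imp_continuous_on[OF hol]])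
      show "(\<lambda>t. s - complex_of_real t) ` {0..1} \<subseteq> - {1}"
      proof safe
        fix t :: real assume t: "t \<in> {0..1}" and eq: "s - of_real t = 1"
        show False using arg_cong[OF eq, of Re] s t by simp
      qed
    qed (auto simp: add_nonneg_eq_0_iff)
    hence "(F \<longlongrightarrow> F 0) (at 0 within {0..1})" by (simp add: continuous_on)
    moreover have "F 0 > 0" using contr by (simp add: F_def)
    ultimately have "\<forall>\<^sub>F t in at 0 within {0..1}. F t > 0" by (rule order_tendstoD)
    then obtain d where d: "d > 0" "\<And>t. t \<in> {0..1} \<Longrightarrow> t \<noteq> 0 \<Longrightarrow> dist t 0 < d \<Longrightarrow> F t > 0"
      by (auto simp: eventually_at)
    define X where "X = (\<Union>j<K. {t :: real. of_real (lam j) * (s - of_real t) + mu j \<in> \<int>\<^sub>\<le>\<^sub>0})"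
    have "countable X"
      unfolding X_def
    proof (rule countable_UN)
      fix j assume "j \<in> {..<K}"
      hence "lam j \<noteq> 0" using lam(1)[of j] by simp
      thus "countable {t :: real. of_real (lam j) * (s - of_real t) + mu j \<in> \<int>\<^sub>\<le>\<^sub>0}"
        by (rule nonpos_Ints_affine_countable)
    qed auto
    moreover have "uncountable {0<..<min 1 d}" using d(1) by (simp add: uncountable_open_interval)
    ultimately have "\<not> {0<..<min 1 d} \<subseteq> X" using countable_subset by blast
    then obtain t where t: "t \<in> {0<..<min 1 d}" "t \<notin> X" by blast
    have "norm (L (s - of_real t)) \<le> exp (C * (1 + norm (s - of_real t)) powr p)"
      by (rule good) (use t s in \<open>auto simp: X_def\<close>)
    hence "F t \<le> 0" unfolding F_def by simp
    moreover have "F t > 0" using t by (intro d(2)) auto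
    ultimately show False by simp
  qed
  thus ?thesis unfolding exp_bounded_on_def using C(1) by auto
qed

text \<open>The continuation axiom supplies some finite order n, which Phragmen-Lindelof requires
  across the strip; the bounds on both sides then lower it to every p > 1. The estimate of 1/Gamma
  is made for p \<le> 2, and larger p follow by monotonicity.\<close>

lemma selberg_continuation_growth:
  assumes L: "L \<in> extended_selberg_class"
  obtains k g where "\<And>p. 1 < p \<Longrightarrow> growth_at_most p g" "\<And>s. s \<noteq> 1 \<Longrightarrow> g s = (s - 1) ^ k * L s"
proof -
  from L obtain k g where g: "g holomorphic_on UNIV" "growth_order g < \<infinity>"
      "\<And>s. s \<noteq> 1 \<Longrightarrow> g s = (s - 1) ^ k * L s"
    unfolding extended_selberg_class_def selberg_continuation_def by blast
  obtain B where B: "B > 0" "\<And>s. Re s \<ge> 2 \<Longrightarrow> norm (L s) \<le> B"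
    using selberg_bounded_right[OF L] by blast
  have "growth_order g \<noteq> \<infinity>" using g(2) by simp
  from less_PInf_Ex_of_nat[THEN iffD1, OF this] obtain n where "growth_order g < ereal (real n)" by auto
  hence \<rho>: "growth_at_most (real n) g" by (rule growth_order_less_imp_growth_at_most[OF g(1)]) auto
  have main: "growth_at_most p g" if p: "1 < p" "p \<le> 2" for p
  proof -
    have lin: "exp_bounded_on A p (\<lambda>s. (s - 1) ^ k)" for A
      using p by (intro growth_at_most_imp_exp_bounded_on growth_at_most_linear_power) auto
    have "exp_bounded_on {s. Re s \<le> -1} p (\<lambda>s. (s - 1) ^ k * L s)"
      by (intro exp_bounded_on_mult lin selberg_left_bound[OF L p])
    then obtain C1 where C1: "C1 \<ge> 0"
        "\<And>s. Re s \<le> -1 \<Longrightarrow> norm ((s - 1) ^ k * L s) \<le> exp (C1 * (1 + norm s) powr p)"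
      unfolding exp_bounded_on_def by blast
    have "exp_bounded_on {s. Re s \<ge> 2} p (\<lambda>s. (s - 1) ^ k * L s)"
      by (intro exp_bounded_on_mult lin exp_bounded_on_bounded[of p _ L B]) (use p B in auto)
    then obtain C2 where C2: "C2 \<ge> 0"
        "\<And>s. Re s \<ge> 2 \<Longrightarrow> norm ((s - 1) ^ k * L s) \<le> exp (C2 * (1 + norm s) powr p)"
      unfolding exp_bounded_on_def by blast
    show ?thesis
    proof (rule growth_at_most_from_off_strip[OF \<rho>])
      show "0 \<le> max C1 C2" using C1(1) by simp
      fix s :: complex assume s: "2 \<le> \<bar>Re s\<bar>"
      have Kle: "exp (x * (1 + norm s) powr p) \<le> exp (max C1 C2 * (1 + norm s) powr p)"
        if "x \<le> max C1 C2" for x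
        using that by (intro iffD2[OF exp_le_cancel_iff] mult_right_mono) auto
      have "s \<noteq> 1" using s by auto
      thus "norm (g s) \<le> exp (max C1 C2 * (1 + norm s) powr p)"
        using s order_trans[OF C1(2)[of s] Kle[of C1]] order_trans[OF C2(2)[of s] Kle[of C2]] g(3)[of s]
        by (cases "Re s \<ge> 0") auto
    qed (use p in auto)
  qed
  have "growth_at_most p g" if p: "1 < p" for p
    using growth_at_most_mono[OF main[of "min p 2"], of p] p by simp
  thus thesis using g(3) that by blast
qed

section \<open>Functions $(s-a)^m e^{\phi}$ with few ones\<close>

text \<open>
  If the bound were violated at \<open>r\<close>, then along \<open>r (2 - 1 / 2 ^ k)\<close> the inequality would force
  \<open>b\<close> to be unbounded on a bounded interval.
\<close>
lemma powr_bound_of_ln_inequality: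
  fixes b :: "real \<Rightarrow> real"
  assumes b1: "\<And>r. 1 \<le> b r" and mono: "\<And>r s. r \<le> s \<Longrightarrow> b r \<le> b s"
    and r1: "r1 \<ge> 1" and K: "K > 0" and q: "q \<ge> 0"
    and ineq: "\<And>r t. r1 \<le> r \<Longrightarrow> 1 \<le> t \<Longrightarrow> b r \<le> K * t\<^sup>2 * (r powr q + ln (b (r + r / t)))"
  obtains C where "\<And>r. r1 \<le> r \<Longrightarrow> b r \<le> C * r powr q"
proof -
  \<comment> \<open>The 5 is spent as 3 for ln 8, 1 for ln w and 1 for the subtracted w in the
    induction step below.\<close>
  have "filterlim (\<lambda>A::real. A / (16 * K) - 5 - ln A) at_top at_top" using K by real_asymp
  hence "\<forall>\<^sub>F A in at_top. 0 \<le> A / (16 * K) - 5 - ln A" unfolding filterlim_at_top by blast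
  hence "\<forall>\<^sub>F A in at_top. A / (16 * K) - 5 - ln A \<ge> 0 \<and> A \<ge> 1"
    by (rule eventually_conj[OF _ eventually_ge_at_top])
  then obtain A where A: "A / (16 * K) - 5 - ln A \<ge> 0" "A \<ge> 1"
    by (auto simp: eventually_at_top_linorder)
  show thesis
  proof (rule that)
    fix r assume r: "r1 \<le> r"
    define w where "w = (2 * r) powr q"
    have w: "w \<ge> 1" unfolding w_def using r r1 q by (intro ge_one_powr_ge_zero) auto
    have "b r \<le> A * w"
    proof (rule ccontr)
      assume contr: "\<not> b r \<le> A * w"
      define \<rho> where "\<rho> = (\<lambda>k::nat. r * (2 - 1 / 2 ^ k))"
      have \<rho>: "r \<le> \<rho> k" "\<rho> k \<le> 2 * r" for k
        using r r1 mult_left_mono[of 1 "2 - 1 / 2 ^ k" r] mult_left_mono[of "2 - 1 / 2 ^ k" 2 r]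
        by (auto simp: \<rho>_def)
      have grow: "A * 8 ^ k * w \<le> b (\<rho> k)" for k
      proof (induction k)
        case 0
        thus ?case using contr by (simp add: \<rho>_def)
      next
        case (Suc k)
        \<comment> \<open>This t makes \<rho> k + \<rho> k / t equal to \<rho> (Suc k). Since t^2
          \<le> 16 * 4^k, a claim growing like 8^k still leaves 2^k after division, against the
          logarithm of the next claim, which is only linear in k.\<close>
        define t where "t = 2 ^ Suc k * (2 - 1 / 2 ^ k :: real)"
        have tk: "1 \<le> (2 - 1 / 2 ^ k :: real)" "(2 - 1 / 2 ^ k :: real) \<le> 2" by auto
        have t: "1 \<le> t" "t \<le> 4 * 2 ^ k"
        proof -
          have "1 * 1 \<le> (2 ^ Suc k :: real) * (2 - 1 / 2 ^ k)"
            using tk by (intro mult_mono one_le_power) auto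
          thus "1 \<le> t" by (simp add: t_def)
          have "(2 ^ Suc k :: real) * (2 - 1 / 2 ^ k) \<le> 2 ^ Suc k * 2"
            using tk by (intro mult_left_mono) auto
          thus "t \<le> 4 * 2 ^ k" by (simp add: t_def)
        qed
        have step: "\<rho> k + \<rho> k / t = \<rho> (Suc k)"
        proof -
          define s where "s = (2 - 1 / 2 ^ k :: real)"
          have "s \<noteq> 0" using tk unfolding s_def by linarith
          hence "\<rho> k / t = r / 2 ^ Suc k" by (simp add: \<rho>_def t_def flip: s_def)
          moreover have "\<rho> k + r / 2 ^ Suc k = \<rho> (Suc k)" by (simp add: \<rho>_def field_simps)
          ultimately show ?thesis by (simp only:)
        qed
        have t2: "t\<^sup>2 \<le> 16 * 4 ^ k"
        proof -
          have "t\<^sup>2 \<le> (4 * 2 ^ k)\<^sup>2" using t by (intro power_mono) auto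
          also have "\<dots> = 16 * 4 ^ k" by (simp add: power_mult_distrib power2_eq_square flip: power_mult_distrib)
          finally show ?thesis .
        qed
        define l where "l = ln (b (\<rho> (Suc k)))"
        have l0: "l \<ge> 0" unfolding l_def using b1 by (intro ln_ge_zero)
        have "A * 8 ^ k * w \<le> b (\<rho> k)" by (rule Suc.IH)
        also have "\<dots> \<le> K * t\<^sup>2 * (\<rho> k powr q + l)"
          using ineq[OF order_trans[OF r \<rho>(1)] t(1), of k] by (simp add: step l_def)
        also have "\<dots> \<le> K * (16 * 4 ^ k) * (w + l)"
        proof -
          have "\<rho> k powr q \<le> w" unfolding w_def
            using \<rho>[of k] r r1 q by (intro powr_mono2) linarith+
          thus ?thesis using t2 K l0 by (intro mult_mono add_mono mult_left_mono) auto
        qed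
        also have "A * 8 ^ k * w = 4 ^ k * (A * 2 ^ k * w)"
          by (simp add: mult_ac flip: power_mult_distrib)
        finally have "A * 2 ^ k * w \<le> 16 * K * (w + l)"
          by (simp add: mult_ac)
        hence "A / (16 * K) * (2 ^ k * w) - w \<le> l" using K by (simp add: field_simps)
        moreover have "(ln A + 5) * (2 ^ k * w) \<le> A / (16 * K) * (2 ^ k * w)"
          using A w by (intro mult_right_mono) auto
        ultimately have l1: "(ln A + 5) * (2 ^ k * w) - w \<le> l" by linarith
        have kw: "1 \<le> 2 ^ k * w" "w \<le> 2 ^ k * w" "real (Suc k) \<le> 2 ^ k * w"
        proof -
          have "1 * w \<le> 2 ^ k * w" using w by (intro mult_right_mono) auto
          thus "w \<le> 2 ^ k * w" "1 \<le> 2 ^ k * w" using w by linarith+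
          have "real (Suc k) \<le> 2 ^ k"
          proof (induction k)
            case (Suc k)
            have "real (Suc (Suc k)) \<le> real (Suc k) + 1 * 1" by simp
            also have "\<dots> \<le> 2 ^ k + 2 ^ k" by (intro add_mono Suc.IH) auto
            finally show ?case by simp
          qed auto
          hence "real (Suc k) * 1 \<le> 2 ^ k * w" using w by (intro mult_mono) auto
          thus "real (Suc k) \<le> 2 ^ k * w" by simp
        qed
        have "ln (A * 8 ^ Suc k * w) = ln A + real (Suc k) * ln 8 + ln w"
          using A w by (simp add: ln_mult ln_realpow distrib_right)
        also have "\<dots> \<le> ln A * (2 ^ k * w) + (2 ^ k * w) * 3 + (2 ^ k * w)"
        proof (intro add_mono)
          show "ln A \<le> ln A * (2 ^ k * w)" using A kw mult_left_mono[of 1 "2 ^ k * w" "ln A"] by simp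
          have "ln (8 :: real) = 3 * ln 2" using ln_realpow[of 2 3] by simp
          also have "\<dots> \<le> 3" using ln_2_less_1 by simp
          finally have "ln (8 :: real) \<le> 3" .
          thus "real (Suc k) * ln 8 \<le> (2 ^ k * w) * 3" using kw w by (intro mult_mono) auto
          show "ln w \<le> 2 ^ k * w" using ln_le_minus_one[of w] w kw by linarith
        qed
        also have "\<dots> \<le> (ln A + 5) * (2 ^ k * w) - w" using kw by (simp add: algebra_simps)
        also have "\<dots> \<le> l" by (rule l1)
        finally have "exp (ln (A * 8 ^ Suc k * w)) \<le> exp l" by simp
        moreover have "A * 8 ^ Suc k * w > 0" using A w by simp
        moreover have "b (\<rho> (Suc k)) > 0" using b1[of "\<rho> (Suc k)"] by linarith
        ultimately show ?case by (simp only: exp_ln l_def)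
      qed
      have "(8 :: real) ^ k \<le> b (2 * r)" for k
      proof -
        have "1 * 8 ^ k * 1 \<le> A * 8 ^ k * w" using A w by (intro mult_mono) auto
        also have "\<dots> \<le> b (\<rho> k)" by (rule grow)
        also have "\<dots> \<le> b (2 * r)" by (rule mono) (rule \<rho>)
        finally show ?thesis by simp
      qed
      moreover obtain k where "b (2 * r) < 8 ^ k" using real_arch_pow[of 8] by auto
      ultimately show False by (meson not_le)
    qed
    also have "A * w = A * 2 powr q * r powr q" by (simp add: w_def powr_mult)
    finally show "b r \<le> A * 2 powr q * r powr q" .
  qed
qed

text \<open>The inserted 0 is the value for negative r, where the disc is empty, so monotonicity and
  non-negativity need no condition on r.\<close>

definition max_modulus :: "(complex \<Rightarrow> complex) \<Rightarrow> real \<Rightarrow> real" where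
  "max_modulus f r = Sup (insert 0 ((\<lambda>z. norm (f z)) ` cball 0 r))"

context
  fixes f :: "complex \<Rightarrow> complex"
  assumes cont: "continuous_on UNIV f"
begin

lemma max_modulus_bdd: "bdd_above (insert 0 ((\<lambda>z. norm (f z)) ` cball 0 r))"
proof -
  have "compact ((\<lambda>z. norm (f z)) ` cball 0 r)"
    by (intro compact_continuous_image continuous_intros continuous_on_subset[OF cont]) auto
  thus ?thesis by (simp add: bounded_imp_bdd_above compact_imp_bounded)
qed

lemma norm_le_max_modulus: "norm z \<le> r \<Longrightarrow> norm (f z) \<le> max_modulus f r"
  unfolding max_modulus_def by (rule cSup_upper[OF _ max_modulus_bdd]) auto

lemma max_modulus_nonneg: "0 \<le> max_modulus f r"
  unfolding max_modulus_def by (rule cSup_upper[OF _ max_modulus_bdd]) auto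

lemma max_modulus_mono: "r \<le> s \<Longrightarrow> max_modulus f r \<le> max_modulus f s"
  unfolding max_modulus_def by (rule cSup_subset_mono[OF _ max_modulus_bdd]) auto

end

lemma max_modulus_le: "B \<ge> 0 \<Longrightarrow> (\<And>z. norm z \<le> r \<Longrightarrow> norm (f z) \<le> B) \<Longrightarrow> max_modulus f r \<le> B"
  unfolding max_modulus_def by (rule cSup_least) auto

text \<open>
  The analogue of the second main theorem for the values 0, 1, \<open>\<infinity>\<close>. On a disc
  write \<open>F - 1 = P exp \<psi>\<close> with \<open>P\<close> a normalised polynomial; the number of its zeros is controlled by
  \<open>D\<close>. Since \<open>(z - a) F' = \<eta> F\<close>, the function \<open>E = (z - a) (P' + P \<psi>') - \<eta> P\<close> satisfies
  \<open>E exp \<psi> = \<eta>\<close>. By Borel--Caratheodory, \<open>E\<close> and \<open>\<eta>\<close> are polynomial in the logarithm \<open>b\<close> of the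
  maximum modulus of \<open>F\<close> on a slightly larger disc, so bounding the quotient \<open>exp \<psi> = \<eta> / E\<close> costs
  only \<open>ln b\<close>.
\<close>
lemma growth_of_exp_unit_step:
  fixes a :: complex and m :: nat and \<phi> F D H \<eta> :: "complex \<Rightarrow> complex"
  assumes hol\<phi>: "\<phi> holomorphic_on UNIV" and F: "\<And>z. F z = (z - a) ^ m * exp (\<phi> z)"
    and D: "growth_at_most p D" and p: "0 \<le> p" and H: "H holomorphic_on UNIV"
    and eq: "\<And>z. D z = (F z - 1) * H z" and D0: "D 0 \<noteq> 0"
    and \<eta>: "\<And>z. \<eta> z = of_nat m + (z - a) * deriv \<phi> z" and \<eta>0: "\<eta> 0 \<noteq> 0" and q: "p < q" "1 \<le> q"
  defines "b \<equiv> \<lambda>r. ln (3 + max_modulus F r)"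
  obtains K where "K > 0"
    "\<And>r t. norm a + 1 \<le> r \<Longrightarrow> 1 \<le> t \<Longrightarrow> b r \<le> K * t\<^sup>2 * (r powr q + ln (b (r + r / t)))"
proof -
  have holF: "F holomorphic_on X" for X
    unfolding F by (intro holomorphic_intros holomorphic_on_subset[OF hol\<phi>]) auto
  have hol\<phi>': "deriv \<phi> holomorphic_on X" for X
    by (rule holomorphic_on_subset[OF holomorphic_deriv[OF hol\<phi> open_UNIV]]) auto
  have hol\<eta>: "\<eta> holomorphic_on X" for X
    unfolding \<eta> by (intro holomorphic_intros hol\<phi>')
  have contF: "continuous_on UNIV F" by (rule holomorphic_on_imp_continuous_on[OF holF])
  define A where "A = (\<lambda>z. F z - 1)"
  have holA: "A holomorphic_on X" for X unfolding A_def by (intro holomorphic_intros holF)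
  have A0: "A 0 \<noteq> 0" using D0 eq[of 0] by (auto simp: A_def)
  obtain CD where CD: "CD \<ge> 0" "\<And>z. norm (D z) \<le> exp (CD * (1 + norm z) powr p)"
    using growth_at_mostE[OF D] by blast
  have "isCont A 0" using holA[of UNIV] holomorphic_on_imp_continuous_on continuous_on_eq_continuous_at by blast
  then obtain \<kappa>0 where \<kappa>0: "\<kappa>0 > 0" "\<And>z. norm z < \<kappa>0 \<Longrightarrow> A z \<noteq> 0"
    using continuous_at_avoid[where f = A and x = 0 and a = 0] A0 by (auto simp: dist_norm)
  \<comment> \<open>All zeros of F - 1 stay at distance at least \<kappa> from 0; this keeps |P 0|
    from being too small.\<close>
  define \<kappa> where "\<kappa> = min 1 \<kappa>0"
  have \<kappa>: "0 < \<kappa>" "\<kappa> \<le> 1" "\<And>z. norm z < \<kappa> \<Longrightarrow> A z \<noteq> 0" using \<kappa>0 by (auto simp: \<kappa>_def)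
  define \<alpha> where "\<alpha> = \<bar>ln (norm (A 0))\<bar>"
  define \<beta> where "\<beta> = \<bar>ln (norm (\<eta> 0))\<bar>"
  define \<phi>0 where "\<phi>0 = \<bar>Re (\<phi> 0)\<bar>"
  \<comment> \<open>K1 r^p will bound the number of zeros of F - 1, K2 is the coefficient in W \<le>
    K2 V, K3 r^(q - p) majorises ln (4 r / \<kappa>), and K4 collects the multiples of w.\<close>
  define K1 where "K1 = CD * 7 powr p + \<bar>ln (norm (D 0))\<bar>"
  define K2 where "K2 = 12 + (768 + 12288 * K1 + 768 * \<alpha>) + (real m + 768 * (1 + \<phi>0))"
  define K3 where "K3 = ln (4 / \<kappa>) + 1 / (q - p)"
  define K4 where "K4 = \<bar>ln K2\<bar> + (p + 1) + 3 + \<beta> + \<alpha> + K1 * K3"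
  define K where "K = 2 + 16 * (1 + K4)"
  have nonneg: "\<alpha> \<ge> 0" "\<beta> \<ge> 0" "\<phi>0 \<ge> 0" "K1 \<ge> 0" "K2 \<ge> 1" "K3 \<ge> 0" "K4 \<ge> 0"
  proof -
    show "\<alpha> \<ge> 0" "\<beta> \<ge> 0" "\<phi>0 \<ge> 0" "K1 \<ge> 0" using CD by (auto simp: \<alpha>_def \<beta>_def \<phi>0_def K1_def)
    thus "K2 \<ge> 1" by (simp add: K2_def)
    show "K3 \<ge> 0" using \<kappa> q by (auto simp: K3_def)
    thus "K4 \<ge> 0" using p \<open>K1 \<ge> 0\<close> \<open>\<alpha> \<ge> 0\<close> \<open>\<beta> \<ge> 0\<close> by (simp add: K4_def)
  qed
  have b1: "1 \<le> b r" for r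
  proof -
    have "exp 1 \<le> 3 + max_modulus F r" using exp_le max_modulus_nonneg[OF contF, of r] by linarith
    thus ?thesis unfolding b_def by (subst ln_ge_iff) (auto intro: less_le_trans[OF exp_gt_zero])
  qed
  have expb: "exp (b r) = 3 + max_modulus F r" for r
    using max_modulus_nonneg[OF contF, of r] by (simp add: b_def)
  show thesis
  proof (rule that)
    show "K > 0" using nonneg by (simp add: K_def)
    fix r t :: real assume r: "norm a + 1 \<le> r" and t: "1 \<le> t"
    define \<delta> where "\<delta> = r / t"
    have r1: "r \<ge> 1" using r norm_ge_zero[of a] by linarith
    have \<delta>: "0 < \<delta>" "\<delta> \<le> r" "r / \<delta> = t" "4 / \<delta> \<le> 4 * t"
      using r1 t by (auto simp: \<delta>_def field_simps mult_le_cancel_left1)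
    \<comment> \<open>The estimates share out \<delta> in quarters: Cauchy for P' and the lower
      bound for P use the gap from R3 to R4, Borel-Caratheodory the gap from R2 to R3, and the
      quotient bound the radii r, R1, R2.\<close>
    define R1 R2 R3 R4 where "R1 = r + \<delta> / 4" and "R2 = r + \<delta> / 2" and "R3 = r + 3 * \<delta> / 4" and "R4 = r + \<delta>"
    have R: "r < R1" "R1 < R2" "R2 < R3" "R3 < R4" "R4 \<le> 2 * r" "0 < R1" "0 < R2" "0 < R3" "0 < R4"
      "R4 - R3 = \<delta> / 4" "R3 - R2 = \<delta> / 4" "R1 - r = \<delta> / 4"
      using \<delta> r1 by (auto simp: R1_def R2_def R3_def R4_def)
    have R3r: "R3 \<le> 2 * r * r"
    proof -
      have "2 * r * 1 \<le> 2 * r * r" using r1 by (intro mult_left_mono) auto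
      thus ?thesis using R by linarith
    qed
    define b4 where "b4 = b R4"
    have b4: "b4 \<ge> 1" using b1 by (simp add: b4_def)
    have F4: "norm (F z) \<le> exp b4 - 3" if "norm z \<le> R4" for z
      using norm_le_max_modulus[OF contF that] by (simp add: b4_def expb)

    obtain n :: nat and c g where g: "g holomorphic_on ball 0 (7 * r)" "\<And>z. A z = (\<Prod>i<n. z - c i) * g z"
      "\<And>i. i < n \<Longrightarrow> norm (c i) \<le> R3" "\<And>z. norm z \<le> R3 \<Longrightarrow> g z \<noteq> 0"
      by (rule holomorphic_zero_factorization[OF holA[of "ball 0 (7 * r)"] A0, of R3]) (use R r1 in auto)
    have c0: "\<kappa> \<le> norm (c i)" if "i < n" for i
    proof (rule ccontr)
      assume "\<not> \<kappa> \<le> norm (c i)"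
      hence "A (c i) \<noteq> 0" by (intro \<kappa>) auto
      moreover have "(\<Prod>j<n. c i - c j) = 0" using that by (intro prod_zero) auto
      ultimately show False using g(2)[of "c i"] by simp
    qed
    have nK1: "real n \<le> K1 * r powr p"
    proof -
      \<comment> \<open>As D = (F - 1) H, the zeros of F - 1 are among those of D. The radius 3 R3
        gives the ratio 3, with ln 3 \<ge> 1, and 1 + 3 R3 \<le> 7 r.\<close>
      have "(3 * R3 / R3) ^ n * norm (D 0) \<le> exp (CD * (7 powr p * r powr p))"
      proof (rule zero_count_bound[where f = D and g = "\<lambda>z. g z * H z" and R' = "7 * r"])
        show "D z = (\<Prod>i<n. z - c i) * (g z * H z)" for z
          using eq[of z] g(2)[of z] by (simp add: A_def mult.assoc)
        fix z :: complex assume z: "norm z = 3 * R3"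
        have "(1 + norm z) powr p \<le> (7 * r) powr p"
          using p R r1 by (intro powr_mono2) (auto simp: z)
        also have "\<dots> = 7 powr p * r powr p" by (rule powr_mult)
        finally have "exp (CD * (1 + norm z) powr p) \<le> exp (CD * (7 powr p * r powr p))"
          using CD(1) by (auto intro: mult_left_mono)
        thus "norm (D z) \<le> exp (CD * (7 powr p * r powr p))" using CD(2)[of z] by linarith
      qed (use g R r1 H in \<open>auto intro!: holomorphic_intros intro: holomorphic_on_subset\<close>)
      hence le: "3 ^ n * norm (D 0) \<le> exp (CD * (7 powr p * r powr p))" using R by simp
      hence "ln (3 ^ n * norm (D 0)) \<le> ln (exp (CD * (7 powr p * r powr p)))"
        using D0 by (intro ln_mono) auto
      hence 1: "real n * ln 3 + ln (norm (D 0)) \<le> CD * 7 powr p * r powr p"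
        using D0 by (simp add: ln_mult ln_realpow mult.assoc)
      have "1 \<le> ln (3::real)" by (subst ln_ge_iff) (auto intro: exp_le)
      hence "real n * 1 \<le> real n * ln 3" by (intro mult_left_mono) auto
      moreover have "\<bar>ln (norm (D 0))\<bar> \<le> \<bar>ln (norm (D 0))\<bar> * r powr p"
        using ge_one_powr_ge_zero[OF r1 p] by (simp add: mult_le_cancel_left1)
      ultimately show ?thesis using 1 by (simp add: K1_def distrib_right)
    qed

    \<comment> \<open>The scale 4 r makes |P| \<le> 1 on |z| \<le> R4, as R3 and R4 are at most 2
      r.\<close>
    define P where "P = (\<lambda>z. \<Prod>i<n. (z - c i) / of_real (4 * r))"
    define G where "G = (\<lambda>z. of_real (4 * r) ^ n * g z)"
    have holP: "P holomorphic_on X" for X unfolding P_def using r1 by (intro holomorphic_intros) auto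
    have holG: "G holomorphic_on ball 0 (7 * r)" unfolding G_def by (intro holomorphic_intros g)
    have AP: "A z = P z * G z" for z
      using r1 by (simp add: P_def G_def g(2) prod_dividef)
    have normP: "norm (P z) \<le> 1" if "norm z \<le> R4" for z
      unfolding P_def prod_norm[symmetric]
    proof (rule prod_le_1)
      fix i assume "i \<in> {..<n}"
      hence "norm (z - c i) \<le> 4 * r"
        using norm_triangle_ineq4[of z "c i"] that g(3)[of i] R by simp
      thus "0 \<le> norm ((z - c i) / of_real (4 * r)) \<and> norm ((z - c i) / of_real (4 * r)) \<le> 1"
        using r1 by (simp add: norm_divide norm_mult)
    qed
    have normP': "norm (deriv P z) \<le> 4 * t" if "norm z \<le> R3" for z
    proof -
      have "norm ((deriv ^^ 1) P z) \<le> fact 1 * 1 / (\<delta> / 4) ^ 1"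
      proof (rule Cauchy_inequality)
        fix x assume "norm (z - x) = \<delta> / 4"
        hence "norm x \<le> R4" using norm_triangle_ineq4[of z "z - x"] that R by simp
        thus "norm (P x) \<le> 1" by (rule normP)
      qed (use \<delta> in \<open>auto intro: holomorphic_on_imp_continuous_on holP\<close>)
      thus ?thesis using \<delta> by simp
    qed
    have normG: "norm (G z) \<le> exp (b4 + real n * ln (16 * t))" if "norm z \<le> R4" for z
    proof (rule maximum_modulus_cball[where f = G and R = R4 and R' = "7 * r"])
      fix w :: complex assume w: "norm w = R4"
      \<comment> \<open>Points with |w| = R4 have distance at least \<delta> / 4 from the zeros, and
        \<delta> / (16 r) = 1 / (16 t).\<close>
      have "(1 / (16 * t)) ^ n \<le> norm (P w)"
      proof -
        have "(\<Prod>i<n. 1 / (16 * t)) \<le> norm (P w)"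
          unfolding P_def prod_norm[symmetric]
        proof (rule prod_mono, safe)
          fix i assume "i < n"
          hence "\<delta> / 4 \<le> norm (w - c i)"
            using norm_triangle_ineq2[of w "c i"] g(3)[of i] w R by simp
          hence "\<delta> / 4 / (4 * r) \<le> norm (w - c i) / (4 * r)" using r1 by (intro divide_right_mono) auto
          moreover have "\<delta> / 4 / (4 * r) = 1 / (16 * t)" using r1 t by (simp add: \<delta>_def)
          ultimately show "1 / (16 * t) \<le> norm ((w - c i) / of_real (4 * r))"
            using r1 by (simp add: norm_divide norm_mult)
        qed (use t in auto)
        thus ?thesis by simp
      qed
      hence "(1 / (16 * t)) ^ n * norm (G w) \<le> norm (P w) * norm (G w)" by (intro mult_right_mono) auto
      also have "\<dots> = norm (A w)" by (simp add: AP norm_mult)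
      also have "\<dots> \<le> exp b4" using F4[of w] w norm_triangle_ineq4[of "F w" 1] by (simp add: A_def)
      finally have "norm (G w) \<le> exp b4 * (16 * t) ^ n" using t by (simp add: power_one_over field_simps)
      also have "(16 * t) ^ n = exp (real n * ln (16 * t))" using t by (simp add: exp_of_nat_mult)
      finally show "norm (G w) \<le> exp (b4 + real n * ln (16 * t))" by (simp add: exp_add)
    qed (use holG R r1 that in auto)
    obtain \<psi> where \<psi>: "\<psi> holomorphic_on ball 0 R3" "\<And>z. norm z < R3 \<Longrightarrow> G z = exp (\<psi> z)"
    proof (rule holomorphic_log_on_ball[of G R3])
      show "G holomorphic_on ball 0 R3" by (rule holomorphic_on_subset[OF holG]) (use R r1 in auto)
    qed (use g(4) r1 in \<open>auto simp: G_def\<close>)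
    define S where "S = b4 + real n * ln (16 * t)"
    have Re\<psi>: "Re (\<psi> z) \<le> S" if "norm z < R3" for z
      using normG[of z] that R \<psi>(2)[OF that] by (simp add: S_def)
    have P0: "P 0 \<noteq> 0" using A0 AP[of 0] by auto
    have normA0: "norm (A 0) = norm (P 0) * exp (Re (\<psi> 0))"
      using AP[of 0] \<psi>(2)[of 0] R by (simp add: norm_mult)
    have \<psi>0_lower: "- \<alpha> \<le> Re (\<psi> 0)"
    proof -
      have "norm (A 0) \<le> 1 * exp (Re (\<psi> 0))" unfolding normA0 using normP[of 0] R by (intro mult_right_mono) auto
      hence "ln (norm (A 0)) \<le> ln (exp (Re (\<psi> 0)))" using A0 by (subst ln_le_cancel_iff) auto
      thus ?thesis by (simp add: \<alpha>_def)
    qed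
    have \<psi>0_upper: "Re (\<psi> 0) \<le> \<alpha> + real n * ln (4 * r / \<kappa>)"
    proof -
      have "(\<kappa> / (4 * r)) ^ n \<le> norm (P 0)"
      proof -
        have "(\<Prod>i<n. \<kappa> / (4 * r)) \<le> norm (P 0)"
          unfolding P_def prod_norm[symmetric]
        proof (rule prod_mono, safe)
          fix i assume "i < n"
          thus "\<kappa> / (4 * r) \<le> norm ((0 - c i) / of_real (4 * r))"
            using c0[of i] r1 by (simp add: norm_divide norm_mult divide_right_mono)
        qed (use \<kappa> r1 in auto)
        thus ?thesis by simp
      qed
      hence "ln ((\<kappa> / (4 * r)) ^ n) \<le> ln (norm (P 0))"
        using \<kappa> r1 P0 by (subst ln_le_cancel_iff) auto
      moreover have "ln ((\<kappa> / (4 * r)) ^ n) = - (real n * ln (4 * r / \<kappa>))"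
        using \<kappa> r1 by (simp add: ln_realpow ln_div algebra_simps)
      moreover have "ln (norm (A 0)) = ln (norm (P 0)) + Re (\<psi> 0)"
        unfolding normA0 using P0 by (simp add: ln_mult)
      ultimately show ?thesis by (simp add: \<alpha>_def)
    qed
    have \<psi>': "norm (deriv \<psi> z) \<le> 256 * t\<^sup>2 * (S + \<alpha>)" if "norm z \<le> R2" for z
    proof -
      have "norm (deriv \<psi> z) \<le> 8 * R3 * (S - Re (\<psi> 0)) / (R3 - R2)\<^sup>2"
        by (rule Borel_Caratheodory_deriv[OF \<psi>(1) Re\<psi> that]) (use R in auto)
      also have "\<dots> \<le> 8 * (2 * r * r) * (S + \<alpha>) / (R3 - R2)\<^sup>2"
        using R R3r r1 \<psi>0_lower Re\<psi>[of 0]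
        by (intro divide_right_mono mult_mono) (auto simp: mult_le_cancel_left1)
      also have "\<dots> = 256 * (r / \<delta>)\<^sup>2 * (S + \<alpha>)"
        unfolding R(11) by (simp add: power2_eq_square)
      finally show ?thesis using \<delta> by simp
    qed
    have Re\<phi>: "Re (\<phi> z) \<le> b4" if "norm z < R3" for z
    proof -
      have "norm (exp (\<phi> z)) \<le> exp b4"
      proof (rule maximum_modulus_cball[where f = "\<lambda>z. exp (\<phi> z)" and R = R4 and R' = "7 * r"])
        fix w :: complex assume w: "norm w = R4"
        \<comment> \<open>The condition \<open>norm a + 1 \<le> r\<close> makes F dominate exp
          \<phi> on the circle; the maximum principle extends the bound for exp \<phi> to the
          inside, including the neighbourhood of a, where F may vanish.\<close>
        have "1 \<le> norm (w - a)" using norm_triangle_ineq2[of w a] w R r by simp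
        hence "1 * norm (exp (\<phi> w)) \<le> norm (w - a) ^ m * norm (exp (\<phi> w))"
          by (intro mult_right_mono one_le_power) auto
        also have "\<dots> = norm (F w)" by (simp only: F norm_mult norm_power)
        also have "\<dots> \<le> exp b4" using F4[of w] w by simp
        finally show "norm (exp (\<phi> w)) \<le> exp b4" by simp
      qed (use hol\<phi> that R r1 in \<open>auto intro!: holomorphic_intros intro: holomorphic_on_subset\<close>)
      thus ?thesis by simp
    qed
    have \<phi>': "norm (deriv \<phi> z) \<le> 256 * t\<^sup>2 * (b4 + \<phi>0)" if "norm z \<le> R2" for z
    proof -
      have "norm (deriv \<phi> z) \<le> 8 * R3 * (b4 - Re (\<phi> 0)) / (R3 - R2)\<^sup>2"
        by (rule Borel_Caratheodory_deriv[OF holomorphic_on_subset[OF hol\<phi>] Re\<phi> that]) (use R in auto)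
      also have "\<dots> \<le> 8 * (2 * r * r) * (b4 + \<phi>0) / (R3 - R2)\<^sup>2"
        using R R3r r1 Re\<phi>[of 0] b4
        by (intro divide_right_mono mult_mono) (auto simp: mult_le_cancel_left1 \<phi>0_def)
      also have "\<dots> = 256 * (r / \<delta>)\<^sup>2 * (b4 + \<phi>0)"
        unfolding R(11) by (simp add: power2_eq_square)
      finally show ?thesis using \<delta> by simp
    qed
    have za: "norm (z - a) \<le> 3 * r" if "norm z \<le> R2" for z
      using norm_triangle_ineq4[of z a] that R r by simp
    define X where "X = real m + 3 * r * (256 * t\<^sup>2 * (b4 + \<phi>0))"
    have normX: "norm (\<eta> z) \<le> X" if "norm z \<le> R2" for z
    proof -
      have "norm (\<eta> z) \<le> real m + norm (z - a) * norm (deriv \<phi> z)"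
        unfolding \<eta> using norm_triangle_ineq[of "of_nat m" "(z - a) * deriv \<phi> z"] by (simp add: norm_mult)
      also have "\<dots> \<le> X"
        unfolding X_def using za[OF that] \<phi>'[OF that] r1 by (intro add_mono mult_mono) auto
      finally show ?thesis .
    qed
    define E where "E = (\<lambda>z. (z - a) * (deriv P z + P z * deriv \<psi> z) - \<eta> z * P z)"
    define W where "W = 3 * r * (4 * t + 256 * t\<^sup>2 * (S + \<alpha>)) + X"
    have normE: "norm (E z) \<le> W" if z: "norm z \<le> R2" for z
    proof -
      have "norm (P z * deriv \<psi> z) \<le> 1 * (256 * t\<^sup>2 * (S + \<alpha>))"
        unfolding norm_mult using normP[of z] \<psi>'[OF z] z R by (intro mult_mono) auto
      hence "norm (deriv P z + P z * deriv \<psi> z) \<le> 4 * t + 256 * t\<^sup>2 * (S + \<alpha>)"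
        using norm_triangle_ineq[of "deriv P z" "P z * deriv \<psi> z"] normP'[of z] z R by simp
      hence "norm ((z - a) * (deriv P z + P z * deriv \<psi> z)) \<le> 3 * r * (4 * t + 256 * t\<^sup>2 * (S + \<alpha>))"
        unfolding norm_mult using za[OF z] r1 by (intro mult_mono) auto
      moreover have "norm (\<eta> z * P z) \<le> X * 1"
        unfolding norm_mult using normX[OF z] normP[of z] z R by (intro mult_mono) (auto intro: order_trans[OF norm_ge_zero])
      ultimately show ?thesis
        using norm_triangle_ineq4[of "(z - a) * (deriv P z + P z * deriv \<psi> z)" "\<eta> z * P z"]
        by (simp add: E_def W_def)
    qed
    have EG: "E z * G z = \<eta> z" if z: "norm z < R3" for z
    proof -
      have dP: "(P has_field_derivative deriv P z) (at z)"
        using holP[of UNIV] by (auto intro: holomorphic_derivI)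
      have d\<psi>: "(\<psi> has_field_derivative deriv \<psi> z) (at z)"
        by (rule holomorphic_derivI[OF \<psi>(1) open_ball]) (use z in auto)
      have d1: "((\<lambda>w. 1 + P w * exp (\<psi> w)) has_field_derivative
          deriv P z * exp (\<psi> z) + P z * (exp (\<psi> z) * deriv \<psi> z)) (at z)"
        by (auto intro!: derivative_eq_intros dP d\<psi>)
      have eqF: "1 + P w * exp (\<psi> w) = F w" if "w \<in> ball 0 R3" for w
        using AP[of w] \<psi>(2)[of w] that by (simp add: A_def algebra_simps)
      have 1: "(F has_field_derivative
          deriv P z * exp (\<psi> z) + P z * (exp (\<psi> z) * deriv \<psi> z)) (at z)"
        by (rule has_field_derivative_transform_within_open[OF d1 open_ball[of 0 R3] _ eqF]) (use z in auto)
      have d\<phi>: "(\<phi> has_field_derivative deriv \<phi> z) (at z)"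
        using hol\<phi> by (auto intro: holomorphic_derivI)
      have 2: "(F has_field_derivative
          of_nat m * (z - a) ^ (m - 1) * exp (\<phi> z) + (z - a) ^ m * (exp (\<phi> z) * deriv \<phi> z)) (at z)"
        unfolding F by (auto intro!: derivative_eq_intros d\<phi>)
      have 3: "deriv P z * exp (\<psi> z) + P z * (exp (\<psi> z) * deriv \<psi> z) =
          of_nat m * (z - a) ^ (m - 1) * exp (\<phi> z) + (z - a) ^ m * (exp (\<phi> z) * deriv \<phi> z)"
        by (rule DERIV_unique[OF 1 2])
      have m: "(z - a) * (of_nat m * (z - a) ^ (m - 1)) = of_nat m * (z - a) ^ m"
        by (cases m) auto
      have "(z - a) * (deriv P z + P z * deriv \<psi> z) * G z =
          (z - a) * (deriv P z * exp (\<psi> z) + P z * (exp (\<psi> z) * deriv \<psi> z))"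
        using \<psi>(2)[OF z] by (simp add: algebra_simps)
      also have "\<dots> = (z - a) * (of_nat m * (z - a) ^ (m - 1)) * exp (\<phi> z) +
          (z - a) * ((z - a) ^ m * (exp (\<phi> z) * deriv \<phi> z))"
        unfolding 3 by (simp only: distrib_left mult.assoc)
      also have "\<dots> = \<eta> z * F z" unfolding m \<eta> F by (simp add: algebra_simps)
      also have "F z = 1 + P z * G z" using AP[of z] by (simp add: A_def algebra_simps)
      finally show ?thesis by (simp add: E_def algebra_simps)
    qed
    have EG0: "E 0 * G 0 = \<eta> 0" by (rule EG) (use R in auto)
    \<comment> \<open>The condition on \<eta> 0 enters here: the quotient bound needs E to be
      non-zero at the centre but tolerates zeros elsewhere.\<close>
    have E0: "E 0 \<noteq> 0" using EG0 \<eta>0 by auto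
    have W0: "W > 0" using normE[of 0] E0 R by (metis less_le_trans norm_zero order_less_imp_le zero_less_norm_iff)
    have lnE0: "ln (norm (E 0)) = ln (norm (\<eta> 0)) - Re (\<psi> 0)"
    proof -
      have "norm (\<eta> 0) = norm (E 0) * exp (Re (\<psi> 0))"
        using EG0 \<psi>(2)[of 0] R by (metis norm_exp_eq_Re norm_mult norm_zero)
      thus ?thesis using E0 by (simp add: ln_mult)
    qed
    define Y where "Y = 16 * t * (ln W + \<beta> + \<alpha> + real n * ln (4 * r / \<kappa>))"
    have XW: "X \<le> W" using normP'[of 0] normP[of 0] Re\<psi>[of 0] \<psi>0_lower R r1 t by (simp add: W_def)
    have lnW: "ln (W / norm (E 0)) \<ge> 0" "ln (W / norm (E 0)) \<le> ln W + \<beta> + \<alpha> + real n * ln (4 * r / \<kappa>)"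
    proof -
      have "norm (E 0) \<le> W" using normE[of 0] R by simp
      thus "ln (W / norm (E 0)) \<ge> 0" using E0 W0 by (intro ln_ge_zero) (simp add: field_simps)
      have "ln (W / norm (E 0)) = ln W - ln (norm (E 0))" using E0 W0 by (simp add: ln_div)
      thus "ln (W / norm (E 0)) \<le> ln W + \<beta> + \<alpha> + real n * ln (4 * r / \<kappa>)"
        using lnE0 \<psi>0_upper by (simp add: \<beta>_def)
    qed
    have normG_r: "norm (G z) \<le> exp Y" if z: "norm z \<le> r" for z
    proof -
      have "norm (G z) \<le> X / W * exp ((R1 + r) / (R1 - r) * ln (W / norm (E 0)))"
      proof (rule holomorphic_quotient_bound[where A = E and H = G and \<rho> = R2 and R' = R3 and z = z])
        show "E holomorphic_on ball 0 R3" unfolding E_def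
          by (intro holomorphic_intros holP hol\<eta> \<psi>(1)) auto
        show "G holomorphic_on ball 0 R3" by (rule holomorphic_on_subset[OF holG]) (use R r1 in auto)
        fix w :: complex assume w: "norm w = R2"
        show "norm (E w) \<le> W" using normE w by simp
        show "norm (E w * G w) \<le> X" using EG[of w] normX[of w] w R by simp
      qed (use E0 z R in auto)
      also have "\<dots> \<le> 1 * exp (16 * t * ln (W / norm (E 0)))"
      proof (intro mult_mono)
        have "(R1 + r) / (R1 - r) \<le> 4 * r / (\<delta> / 4)" using R \<delta> r1 by (intro frac_le) auto
        also have "\<dots> = 16 * (r / \<delta>)" by simp
        finally have "(R1 + r) / (R1 - r) \<le> 16 * t" using \<delta> by simp
        thus "exp ((R1 + r) / (R1 - r) * ln (W / norm (E 0))) \<le> exp (16 * t * ln (W / norm (E 0)))"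
          by (subst exp_le_cancel_iff) (rule mult_right_mono[OF _ lnW(1)])
        show "X / W \<le> 1" using XW W0 by simp
      qed auto
      also have "\<dots> \<le> exp Y" using lnW t by (simp add: Y_def mult_left_mono)
      finally show ?thesis .
    qed
    have Y0: "Y \<ge> 0" unfolding Y_def using lnW t by (intro mult_nonneg_nonneg) auto
    have bY: "b r \<le> 2 + Y"
    proof -
      have "max_modulus F r \<le> 1 + exp Y"
      proof (rule max_modulus_le)
        fix z :: complex assume z: "norm z \<le> r"
        have "norm (P z * G z) \<le> 1 * exp Y"
          unfolding norm_mult using normP[of z] normG_r[OF z] z R by (intro mult_mono) auto
        thus "norm (F z) \<le> 1 + exp Y"
          using norm_triangle_ineq[of 1 "A z"] AP[of z] by (simp add: A_def)
      qed (simp add: add_nonneg_nonneg)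
      hence "exp (b r) \<le> 4 + exp Y" by (simp add: expb)
      also have "\<dots> \<le> exp 2 * exp Y"
      proof -
        have "(5 :: real) \<le> exp 2" using exp_lower_Taylor_quadratic[of 2] by simp
        moreover have "1 \<le> exp Y" using Y0 by simp
        ultimately have "4 * exp Y + exp Y \<le> exp 2 * exp Y" by (simp flip: distrib_right)
        thus ?thesis using \<open>1 \<le> exp Y\<close> by linarith
      qed
      also have "\<dots> = exp (2 + Y)" by (simp add: exp_add)
      finally show ?thesis by simp
    qed

    define w where "w = r powr q"
    have w: "w \<ge> 1" "r \<le> w"
    proof -
      show "w \<ge> 1" unfolding w_def using r1 q by (intro ge_one_powr_ge_zero) auto
      have "r powr 1 \<le> r powr q" using r1 q by (intro powr_mono) auto
      thus "r \<le> w" using r1 by (simp add: w_def)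
    qed
    \<comment> \<open>Each zero costs a logarithm of r in the bound for Re (\<psi> 0); the gap q - p
      absorbs it.\<close>
    have nw: "real n * ln (4 * r / \<kappa>) \<le> K1 * K3 * w"
    proof -
      have s1: "1 \<le> r powr (q - p)" using r1 q by (intro ge_one_powr_ge_zero) auto
      have "ln (4 * r / \<kappa>) = ln (4 / \<kappa>) + ln r" using r1 \<kappa> by (simp add: ln_mult ln_div)
      also have "\<dots> \<le> ln (4 / \<kappa>) * r powr (q - p) + r powr (q - p) / (q - p)"
        using s1 \<kappa> r1 q by (intro add_mono ln_powr_bound) (auto simp: mult_le_cancel_left1)
      also have "\<dots> = K3 * r powr (q - p)" by (simp add: K3_def distrib_right)
      finally have "ln (4 * r / \<kappa>) \<le> K3 * r powr (q - p)" .
      hence "real n * ln (4 * r / \<kappa>) \<le> K1 * r powr p * (K3 * r powr (q - p))"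
        using nK1 \<kappa> r1 nonneg by (intro mult_mono) auto
      also have "\<dots> = K1 * K3 * (r powr p * r powr (q - p))" by simp
      also have "r powr p * r powr (q - p) = w" by (simp add: w_def flip: powr_add)
      finally show ?thesis .
    qed
    \<comment> \<open>A single monomial dominating every term of W. Only its logarithm matters, so
      powers of r and t are harmless and b4 enters merely through ln b4.\<close>
    define V where "V = r powr (p + 1) * t ^ 3 * b4"
    have rp: "r powr p \<ge> 1" "r powr (p + 1) = r powr p * r"
      using r1 p by (auto simp: powr_add intro: ge_one_powr_ge_zero)
    have V: "r * t \<le> V" "r * t\<^sup>2 * b4 \<le> V" "r * t\<^sup>2 * (r powr p * t) \<le> V" "r * t\<^sup>2 \<le> V" "1 \<le> V"
    proof -
      have t3: "t \<le> t ^ 3" "t\<^sup>2 \<le> t ^ 3" "1 \<le> t ^ 3" "0 \<le> t"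
        using t power_increasing[of 1 3 t] power_increasing[of 2 3 t] by (auto intro: one_le_power)
      have rr: "r \<le> r powr (p + 1)" using rp r1 by (simp add: mult_le_cancel_right1)
      have "r * t * 1 \<le> V" unfolding V_def using rr t3 b4 r1 by (intro mult_mono) auto
      thus "r * t \<le> V" by simp
      show "r * t\<^sup>2 * b4 \<le> V" unfolding V_def using rr t3 b4 r1 by (intro mult_mono) auto
      have "r powr (p + 1) * t ^ 3 * 1 \<le> V" unfolding V_def using b4 r1 t3 by (intro mult_left_mono) auto
      thus "r * t\<^sup>2 * (r powr p * t) \<le> V" by (simp add: rp power3_eq_cube power2_eq_square mult_ac)
      have "r * t\<^sup>2 * 1 \<le> V" unfolding V_def using rr t3 b4 r1 by (intro mult_mono) auto
      thus "r * t\<^sup>2 \<le> V" by simp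
      have "1 * 1 * 1 \<le> V" unfolding V_def using rr t3 b4 r1 by (intro mult_mono) auto
      thus "1 \<le> V" by simp
    qed
    have WV: "W \<le> K2 * V"
    proof -
      have "ln (16 * t) \<le> 16 * t" using ln_le_minus_one[of "16 * t"] t by simp
      hence "real n * ln (16 * t) \<le> K1 * r powr p * (16 * t)"
        using nK1 t nonneg by (intro mult_mono) auto
      hence "S \<le> b4 + 16 * K1 * (r powr p * t)" by (simp add: S_def)
      hence "W \<le> 3 * r * (4 * t + 256 * t\<^sup>2 * (b4 + 16 * K1 * (r powr p * t) + \<alpha>)) + X"
        unfolding W_def using r1 by (intro add_right_mono mult_left_mono add_left_mono) auto
      also have "\<dots> = 12 * (r * t) + 768 * (r * t\<^sup>2 * b4) + 12288 * K1 * (r * t\<^sup>2 * (r powr p * t)) +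
          768 * \<alpha> * (r * t\<^sup>2) + (real m * 1 + 768 * (r * t\<^sup>2 * b4) + 768 * \<phi>0 * (r * t\<^sup>2))"
        by (simp add: X_def algebra_simps)
      also have "\<dots> \<le> 12 * V + 768 * V + 12288 * K1 * V + 768 * \<alpha> * V + (real m * V + 768 * V + 768 * \<phi>0 * V)"
        using V nonneg by (intro add_mono mult_left_mono) auto
      also have "\<dots> = K2 * V" by (simp add: K2_def algebra_simps)
      finally show ?thesis .
    qed
    have lnb4: "ln b4 \<ge> 0" using b4 by simp
    have lnW': "ln W \<le> \<bar>ln K2\<bar> + (p + 1) * w + 3 * t + ln b4"
    proof -
      have "ln W \<le> ln (K2 * V)" using WV W0 by (intro ln_mono) auto
      also have "\<dots> = ln K2 + ln V" using V nonneg by (simp add: ln_mult)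
      also have "ln V = (p + 1) * ln r + 3 * ln t + ln b4"
        using r1 t b4 by (simp add: V_def ln_mult ln_powr ln_realpow)
      also have "\<dots> \<le> (p + 1) * w + 3 * t + ln b4"
        using ln_le_minus_one[of r] ln_le_minus_one[of t] r1 t w p
        by (intro add_mono mult_left_mono) auto
      finally show ?thesis using abs_ge_self[of "ln K2"] by linarith
    qed
    have "ln W + \<beta> + \<alpha> + real n * ln (4 * r / \<kappa>) \<le> t * (K4 * w + ln b4)"
    proof -
      have tw: "1 \<le> t * w" "w \<le> t * w" "t \<le> t * w" "ln b4 \<le> t * ln b4"
        using t w lnb4 mult_mono[of 1 t 1 w] by (auto simp: mult_le_cancel_right1 mult_le_cancel_left1)
      have "ln W + \<beta> + \<alpha> + real n * ln (4 * r / \<kappa>) \<le>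
          \<bar>ln K2\<bar> * 1 + (p + 1) * w + 3 * t + ln b4 + \<beta> * 1 + \<alpha> * 1 + K1 * K3 * w"
        using lnW' nw by linarith
      also have "\<dots> \<le> \<bar>ln K2\<bar> * (t * w) + (p + 1) * (t * w) + 3 * (t * w) + t * ln b4 +
          \<beta> * (t * w) + \<alpha> * (t * w) + K1 * K3 * (t * w)"
        using tw nonneg p by (intro add_mono mult_left_mono) auto
      also have "\<dots> = t * (K4 * w + ln b4)" by (simp add: K4_def algebra_simps)
      finally show ?thesis .
    qed
    hence "Y \<le> 16 * t * (t * (K4 * w + ln b4))" unfolding Y_def using t by (intro mult_left_mono) auto
    also have "\<dots> = 16 * (t\<^sup>2 * (K4 * w + ln b4))" by (simp add: power2_eq_square)
    also have "\<dots> \<le> 16 * (t\<^sup>2 * ((1 + K4) * (w + ln b4)))"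
      using nonneg w lnb4 by (intro mult_left_mono) (auto simp: algebra_simps)
    finally have "Y \<le> 16 * (1 + K4) * (t\<^sup>2 * (w + ln b4))" by (simp only: mult_ac)
    moreover have "2 \<le> 2 * (t\<^sup>2 * (w + ln b4))"
      using mult_mono[of 1 "t\<^sup>2" 1 "w + ln b4"] t w lnb4 one_le_power[of t 2] by simp
    ultimately have "b r \<le> K * (t\<^sup>2 * (w + ln b4))" using bY by (simp add: K_def distrib_right)
    thus "b r \<le> K * t\<^sup>2 * (r powr q + ln (b (r + r / t)))"
      by (simp add: w_def b4_def R4_def \<delta>_def mult.assoc)
  qed
qed

lemma deriv_shift:
  assumes "\<phi> holomorphic_on UNIV"
  shows "deriv (\<lambda>z. \<phi> (z + s)) z = deriv \<phi> (z + s :: complex)"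
proof -
  have "(\<phi> has_field_derivative deriv \<phi> (z + s)) (at (z + s))"
    using assms by (auto intro: holomorphic_derivI)
  hence "((\<lambda>z. \<phi> (z + s)) has_field_derivative deriv \<phi> (z + s)) (at z)"
    by (simp add: DERIV_shift)
  thus ?thesis by (rule DERIV_imp_deriv)
qed

lemma growth_of_exp_unit_center:
  fixes a :: complex and m :: nat and \<phi> F D H :: "complex \<Rightarrow> complex"
  assumes hol\<phi>: "\<phi> holomorphic_on UNIV" and F: "\<And>z. F z = (z - a) ^ m * exp (\<phi> z)"
    and D: "growth_at_most p D" and p: "0 \<le> p" and H: "H holomorphic_on UNIV"
    and eq: "\<And>z. D z = (F z - 1) * H z" and D0: "D 0 \<noteq> 0"
    and nz: "of_nat m + (0 - a) * deriv \<phi> 0 \<noteq> 0" and q: "p < q" "1 \<le> q"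
  shows "growth_at_most q F"
proof -
  have holF: "F holomorphic_on UNIV" unfolding F by (intro holomorphic_intros hol\<phi>)
  have contF: "continuous_on UNIV F" by (rule holomorphic_on_imp_continuous_on[OF holF])
  \<comment> \<open>As exp 1 \<le> 3, b is at least 1 and ln b is non-negative.\<close>
  define b where "b = (\<lambda>r. ln (3 + max_modulus F r))"
  obtain K where K: "K > 0"
    "\<And>r t. norm a + 1 \<le> r \<Longrightarrow> 1 \<le> t \<Longrightarrow> b r \<le> K * t\<^sup>2 * (r powr q + ln (b (r + r / t)))"
    unfolding b_def using growth_of_exp_unit_step[OF hol\<phi> F D p H eq D0 refl nz q] by blast
  note pos = max_modulus_nonneg[OF contF]
  have b1: "1 \<le> b r" for r
  proof -
    have "exp 1 \<le> 3 + max_modulus F r" using exp_le pos[of r] by linarith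
    thus ?thesis unfolding b_def by (subst ln_ge_iff) (auto intro: less_le_trans[OF exp_gt_zero])
  qed
  have mono: "b r \<le> b s" if "r \<le> s" for r s
    unfolding b_def using max_modulus_mono[OF contF that] pos[of r] by (intro ln_mono) auto
  obtain C where C: "\<And>r. norm a + 1 \<le> r \<Longrightarrow> b r \<le> C * r powr q"
    by (rule powr_bound_of_ln_inequality[of b "norm a + 1" K q, OF b1 mono _ K(1) _ K(2)]) (use q in auto)
  show ?thesis
  proof (rule growth_at_most_from_large[OF holF])
    fix z :: complex assume z: "norm a + 1 \<le> norm z"
    have "norm (F z) \<le> exp (b (norm z))"
      using norm_le_max_modulus[OF contF, of z "norm z"] pos[of "norm z"] by (simp add: b_def)
    also have "\<dots> \<le> exp (\<bar>C\<bar> * (1 + norm z) powr q)"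
    proof -
      have "b (norm z) \<le> C * norm z powr q" by (rule C[OF z])
      also have "\<dots> \<le> \<bar>C\<bar> * norm z powr q" by (intro mult_right_mono) auto
      also have "\<dots> \<le> \<bar>C\<bar> * (1 + norm z) powr q" using q by (intro mult_left_mono powr_mono2) auto
      finally show ?thesis by simp
    qed
    finally show "norm (F z) \<le> exp (\<bar>C\<bar> * (1 + norm z) powr q)" .
  qed (use q in auto)
qed

text \<open>A translation moves a point where neither D nor \<eta> = m + (z - a) \<phi>' vanishes to
  the centre. If \<eta> vanishes identically, its value at a gives m = 0, hence \<phi>' = 0 off a,
  and F is constant.\<close>

lemma growth_of_exp_unit:
  fixes a :: complex and m :: nat and \<phi> F D H :: "complex \<Rightarrow> complex"
  assumes hol\<phi>: "\<phi> holomorphic_on UNIV" and F: "\<And>z. F z = (z - a) ^ m * exp (\<phi> z)"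
    and D: "growth_at_most p D" and p: "0 \<le> p" and H: "H holomorphic_on UNIV"
    and eq: "\<And>z. D z = (F z - 1) * H z" and D0: "D z0 \<noteq> 0" and q: "p < q" "1 \<le> q"
  shows "growth_at_most q F"
proof -
  define \<eta> where "\<eta> = (\<lambda>z. of_nat m + (z - a) * deriv \<phi> z)"
  show ?thesis
  proof (cases "\<forall>z. \<eta> z = 0")
    case True
    have m: "m = 0" using True[rule_format, of a] by (simp add: \<eta>_def)
    have "deriv \<phi> z = 0" if "z \<noteq> a" for z
      using True[rule_format, of z] that m by (simp add: \<eta>_def)
    hence "\<forall>z\<in>UNIV - {a}. (\<phi> has_field_derivative 0) (at z)"
      using holomorphic_derivI[OF hol\<phi> open_UNIV] by (metis DiffD2 UNIV_I singletonI)
    then obtain c where "\<And>z. \<phi> z = c"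
      using DERIV_zero_connected_constant[of UNIV "{a}" \<phi>] holomorphic_on_imp_continuous_on[OF hol\<phi>]
      by (metis UNIV_I connected_UNIV finite.emptyI finite.insertI open_UNIV)
    hence "F = (\<lambda>_. exp c)" using F m by auto
    thus ?thesis using q by (simp add: growth_at_most_const)
  next
    case False
    then obtain z1 where z1: "\<eta> z1 \<noteq> 0" by blast
    have hol\<eta>: "\<eta> holomorphic_on UNIV" unfolding \<eta>_def by (intro holomorphic_intros hol\<phi>) auto
    have "\<forall>\<^sub>F w in at 0. D w \<noteq> 0 \<and> w \<in> UNIV"
      by (rule non_zero_neighbour_alt[where \<beta> = z0]) (use growth_at_most_imp_holomorphic[OF D] D0 in auto)
    moreover have "\<forall>\<^sub>F w in at 0. \<eta> w \<noteq> 0 \<and> w \<in> UNIV"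
      by (rule non_zero_neighbour_alt[where \<beta> = z1]) (use hol\<eta> z1 in auto)
    ultimately have "\<forall>\<^sub>F w in at 0. D w \<noteq> 0 \<and> \<eta> w \<noteq> 0" by eventually_elim auto
    then obtain s where s: "D s \<noteq> 0" "\<eta> s \<noteq> 0"
      using eventually_happens[of _ "at (0::complex)"] by auto
    have "growth_at_most q (\<lambda>z. F (z + s))"
    proof (rule growth_of_exp_unit_center[where a = "a - s" and m = m and \<phi> = "\<lambda>z. \<phi> (z + s)" and p = p
          and D = "\<lambda>z. D (z + s)" and H = "\<lambda>z. H (z + s)"])
      show "(\<lambda>z. \<phi> (z + s)) holomorphic_on UNIV" "(\<lambda>z. H (z + s)) holomorphic_on UNIV"
        by (auto intro!: entire_compose[OF hol\<phi>] entire_compose[OF H] holomorphic_intros)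
      show "F (z + s) = (z - (a - s)) ^ m * exp (\<phi> (z + s))" for z
        by (simp add: F algebra_simps)
      show "of_nat m + (0 - (a - s)) * deriv (\<lambda>z. \<phi> (z + s)) 0 \<noteq> 0"
        using s(2) by (simp add: deriv_shift[OF hol\<phi>] \<eta>_def)
    qed (use s p q eq growth_at_most_shift[OF D p] in auto)
    from growth_at_most_shift[OF this, of "- s"] q show ?thesis by simp
  qed
qed

section \<open>Liouville-type consequences of growth bounds\<close>

lemma sublinear_entire_constant:
  assumes f: "f holomorphic_on UNIV" and le: "\<And>z. norm (f z) \<le> C * (1 + norm z) powr s" and s: "s < 1"
    and C: "C \<ge> 0"
  obtains c where "\<And>z. f z = c"
proof -
  have "deriv f z = 0" for z
  proof -
    define R where "R = 1 + norm z"
    have R: "R > 0" by (simp add: R_def add_pos_nonneg)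
    \<comment> \<open>A negative s is raised to 0 so that the power is monotone in its base.\<close>
    define s' where "s' = max s 0"
    have bound: "norm (deriv f z) \<le> C * (R + r) powr s' / r" if r: "r > 0" for r
    proof -
      have "norm ((deriv ^^ 1) f z) \<le> fact 1 * (C * (R + r) powr s') / r ^ 1"
      proof (rule Cauchy_inequality[OF holomorphic_on_subset[OF f]])
        show "continuous_on (cball z r) f"
          by (rule holomorphic_on_imp_continuous_on, rule holomorphic_on_subset[OF f]) auto
        fix x assume x: "norm (z - x) = r"
        have "norm (f x) \<le> C * (1 + norm x) powr s" by (rule le)
        also have "\<dots> \<le> C * (1 + norm x) powr s'"
          using C by (intro mult_left_mono powr_mono) (auto simp: s'_def)
        also have "\<dots> \<le> C * (R + r) powr s'"
          using C x norm_triangle_ineq4[of z "z - x"]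
          by (intro mult_left_mono powr_mono2) (auto simp: s'_def R_def)
        finally show "norm (f x) \<le> C * (R + r) powr s'" .
      qed (use r in auto)
      thus ?thesis by simp
    qed
    have s': "s' < 1" "s' \<ge> 0" using s by (auto simp: s'_def)
    have "((\<lambda>r::real. (R + r) powr s' / r) \<longlongrightarrow> 0) at_top" using R s' by real_asymp
    hence "((\<lambda>r::real. C * ((R + r) powr s' / r)) \<longlongrightarrow> 0) at_top" by (rule tendsto_mult_right_zero)
    moreover have "\<forall>\<^sub>F r in at_top. norm (deriv f z) \<le> C * ((R + r) powr s' / r)"
      using eventually_gt_at_top[of 0] by eventually_elim (use bound in auto)
    ultimately have "norm (deriv f z) \<le> 0" by (intro tendsto_lowerbound) auto
    thus ?thesis by simp
  qed
  hence "(f has_field_derivative 0) (at z)" for z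
    using holomorphic_derivI[OF f open_UNIV, of z] by simp
  hence "\<forall>z\<in>UNIV - {}. (f has_field_derivative 0) (at z)" by blast
  then obtain c where "\<And>z. f z = c"
    using DERIV_zero_connected_constant[of UNIV "{}" f] holomorphic_on_imp_continuous_on[OF f]
    by (metis UNIV_I connected_UNIV finite.emptyI open_UNIV)
  thus thesis by (rule that)
qed

text \<open>The growth of exp \<phi> bounds only Re \<phi>, and only from above; Borel-Caratheodory
  converts this into a bound of order q - 1 for |\<phi>'|, and q < 2 makes \<phi>' sublinear, hence
  constant.\<close>

lemma affine_of_growth_exp:
  assumes \<phi>: "\<phi> holomorphic_on UNIV" and growth: "growth_at_most q (\<lambda>z. exp (\<phi> z))" and q: "1 \<le> q" "q < 2"
  obtains \<alpha> \<beta> where "\<And>z. \<phi> z = \<alpha> * z + \<beta>"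
proof -
  obtain C where C: "C \<ge> 0" "\<And>z. norm (exp (\<phi> z)) \<le> exp (C * (1 + norm z) powr q)"
    using growth_at_mostE[OF growth] by blast
  define C' where "C' = 16 * (C * 3 powr q + \<bar>Re (\<phi> 0)\<bar>)"
  have C': "C' \<ge> 0" using C by (simp add: C'_def)
  have hol': "deriv \<phi> holomorphic_on UNIV" by (rule holomorphic_deriv[OF \<phi> open_UNIV])
  have bound: "norm (deriv \<phi> z) \<le> C' * (1 + norm z) powr (q - 1)" for z
  proof -
    define r where "r = 1 + norm z"
    have r: "r \<ge> 1" "norm z \<le> r" by (simp_all add: r_def)
    have rq: "r powr q \<ge> 1" using r q by (intro ge_one_powr_ge_zero) auto
    have "norm (deriv \<phi> z) \<le> 8 * (2 * r) * (C * 3 powr q * r powr q - Re (\<phi> 0)) / (2 * r - r)\<^sup>2"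
    proof (rule Borel_Caratheodory_deriv)
      show "\<phi> holomorphic_on ball 0 (2 * r)" by (rule holomorphic_on_subset[OF \<phi>]) auto
      fix w :: complex assume w: "norm w < 2 * r"
      have "Re (\<phi> w) \<le> C * (1 + norm w) powr q" using C(2)[of w] by simp
      also have "\<dots> \<le> C * (3 * r) powr q"
        using C(1) w r q by (intro mult_left_mono powr_mono2) auto
      finally show "Re (\<phi> w) \<le> C * 3 powr q * r powr q" by (simp add: powr_mult mult.assoc)
    qed (use r in auto)
    also have "\<dots> = 16 * (C * 3 powr q * r powr q - Re (\<phi> 0)) / r"
      using r by (simp add: power2_eq_square)
    also have "\<dots> \<le> 16 * (C * 3 powr q * r powr q + \<bar>Re (\<phi> 0)\<bar> * r powr q) / r"
    proof -
      have "\<bar>Re (\<phi> 0)\<bar> * 1 \<le> \<bar>Re (\<phi> 0)\<bar> * r powr q" by (rule mult_left_mono[OF rq]) simp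
      hence "- Re (\<phi> 0) \<le> \<bar>Re (\<phi> 0)\<bar> * r powr q" by linarith
      thus ?thesis using r by (intro divide_right_mono mult_left_mono) auto
    qed
    also have "\<dots> = C' * (r powr q / r)" by (simp add: C'_def algebra_simps add_divide_distrib)
    also have "r powr q / r = r powr (q - 1)" using r by (simp add: powr_diff)
    finally show ?thesis by (simp add: r_def)
  qed
  obtain \<alpha> where \<alpha>: "\<And>z. deriv \<phi> z = \<alpha>"
    by (rule sublinear_entire_constant[OF hol' bound _ C']) (use q in auto)
  have "((\<lambda>z. \<phi> z - \<alpha> * z) has_field_derivative 0) (at z)" for z
    using holomorphic_derivI[OF \<phi> open_UNIV, of z] by (auto intro!: derivative_eq_intros simp: \<alpha>)
  hence "\<forall>z\<in>UNIV - {}. ((\<lambda>z. \<phi> z - \<alpha> * z) has_field_derivative 0) (at z)" by blast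
  moreover have "continuous_on UNIV (\<lambda>z. \<phi> z - \<alpha> * z)"
    by (intro continuous_intros holomorphic_on_imp_continuous_on[OF \<phi>])
  ultimately obtain c where "\<And>z. \<phi> z - \<alpha> * z = c"
    using DERIV_zero_connected_constant[of UNIV "{}" "\<lambda>z. \<phi> z - \<alpha> * z"]
    by (metis UNIV_I connected_UNIV finite.emptyI open_UNIV)
  hence "\<phi> z = \<alpha> * z + c" for z by (metis add.commute diff_add_cancel)
  thus thesis by (rule that)
qed

text \<open>Phragmen-Lindelof on the half-planes to the right and to the left of the line, whose
  critical order 1 exceeds p, makes h bounded; Liouville does the rest.\<close>

lemma constant_of_bounded_on_vertical_line:
  assumes h: "growth_at_most p h" and p: "0 \<le> p" "p < 1"
    and le: "\<And>s. Re s = c \<Longrightarrow> norm (h s) \<le> M"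
  shows "h constant_on UNIV"
proof -
  \<comment> \<open>P < 1 keeps |P Arg w| below pi / 2 by a fixed amount on the closed half-plane,
    so its cosine stays away from 0.\<close>
  define P where "P = (p + 1) / 2"
  have P: "p < P" "P < 1" "P > 0" using p by (auto simp: P_def)
  define M' where "M' = max M 1"
  define S where "S = {w :: complex. 0 \<le> Re w}"
  have closedS: "closed S" unfolding S_def by (intro closed_Collect_le continuous_intros)
  have half: "norm (h (of_real c + u * w)) \<le> M'" if w: "0 \<le> Re w" and u: "u = 1 \<or> u = -1" for u w
  proof -
    have g: "growth_at_most p (\<lambda>w. h (u * w + of_real c))" by (rule growth_at_most_affine_comp[OF h p(1)])
    then obtain C where C: "\<And>w. norm (h (u * w + of_real c)) \<le> exp (C * (1 + norm w) powr p)"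
      by (elim growth_at_mostE) auto
    have "norm (h (u * w + of_real c)) \<le> M'"
    proof (rule Phragmen_Lindelof[where f = "\<lambda>w. h (u * w + of_real c)" and S = S and c = "cos (P * (pi / 2))"
          and P = P and p = p and C = C])
      show "cos (P * (pi / 2)) > 0"
      proof -
        have "P * (pi / 2) < 1 * (pi / 2)" using P by (intro mult_strict_right_mono) auto
        moreover have "0 < P * (pi / 2)" using P by simp
        ultimately show ?thesis by (intro cos_gt_zero_pi) linarith+
      qed
      show "cos (P * (pi / 2)) \<le> cos (P * Arg w)" if "w \<in> S" "w \<noteq> 0" for w
      proof -
        have "\<bar>Arg w\<bar> \<le> pi / 2" using Re_Ln_pos_le[OF that(2)] that by (simp add: Arg_eq_Im_Ln S_def)
        hence "\<bar>P * Arg w\<bar> \<le> P * (pi / 2)" using P by (simp add: abs_mult mult_left_mono)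
        moreover have "P * (pi / 2) \<le> 1 * pi" using P by (intro mult_mono) auto
        ultimately have "cos (P * (pi / 2)) \<le> cos \<bar>P * Arg w\<bar>" by (intro cos_monotone_0_pi_le) auto
        thus ?thesis by simp
      qed
      fix w assume w: "w \<in> frontier S"
      have "Re w \<ge> 0" using w closedS frontier_subset_closed by (auto simp: S_def)
      moreover have "\<not> Re w > 0"
      proof
        assume *: "Re w > 0"
        have "open {w. 0 < Re w}" by (intro open_Collect_less continuous_intros)
        moreover have "{w. 0 < Re w} \<subseteq> S" by (auto simp: S_def)
        ultimately have "w \<in> interior S" using * by (auto simp: interior_def)
        thus False using w by (simp add: frontier_def)
      qed
      ultimately have "Re (u * w + of_real c) = c" using u by auto
      from le[OF this] show "norm (h (u * w + of_real c)) \<le> M'" by (simp add: M'_def)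
    qed (use closedS P p C w growth_at_most_imp_holomorphic[OF g]
          in \<open>auto simp: S_def M'_def intro: holomorphic_on_imp_continuous_on\<close>)
    thus ?thesis by (simp add: add.commute)
  qed
  have "norm (h s) \<le> M'" for s
    using half[of "s - of_real c" 1] half[of "of_real c - s" "-1"] by (cases "Re s \<ge> c") auto
  hence "bounded (range h)" by (auto simp: bounded_iff)
  thus ?thesis using Liouville_theorem growth_at_most_imp_holomorphic[OF h] by blast
qed

section \<open>The uniqueness theorem\<close>

lemma entire_factor_zero_power:
  assumes f: "f holomorphic_on UNIV" and nz: "f z0 \<noteq> 0"
  obtains n :: nat and u where "u holomorphic_on UNIV" "u a \<noteq> 0" "\<And>z. f z = (z - a) ^ n * u z"
proof -
  define n where "n = nat (zorder f a)"
  define g where "g = zor_poly f a"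
  obtain r where r: "r > 0" "g holomorphic_on cball a r"
      "\<And>w. w \<in> cball a r \<Longrightarrow> f w = g w * (w - a) ^ n \<and> g w \<noteq> 0"
    using zorder_exist_zero[OF f open_UNIV connected_UNIV UNIV_I[of a]] nz unfolding n_def g_def by blast
  define u where "u = (\<lambda>z. if z = a then g a else f z / (z - a) ^ n)"
  have "u holomorphic_on - {a} \<union> ball a r"
  proof (rule holomorphic_on_Un)
    have "(\<lambda>z. f z / (z - a) ^ n) holomorphic_on - {a}"
      by (intro holomorphic_intros holomorphic_on_subset[OF f]) auto
    thus "u holomorphic_on - {a}" by (rule holomorphic_transform) (auto simp: u_def)
    have "g holomorphic_on ball a r" by (rule holomorphic_on_subset[OF r(2)]) auto
    thus "u holomorphic_on ball a r" by (rule holomorphic_transform) (use r(3) in \<open>auto simp: u_def\<close>)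
  qed auto
  moreover have "- {a} \<union> ball a r = UNIV" using r(1) by auto
  moreover have "u a \<noteq> 0" using r(1) r(3)[of a] by (simp add: u_def)
  moreover have "f z = (z - a) ^ n * u z" for z
    using r(1) r(3)[of a] by (cases "z = a") (auto simp: u_def)
  ultimately show thesis using that[of u n] by simp
qed

text \<open>In normal form the value at a point is 0 at a pole and the limit otherwise, so it is
  determined by the values nearby, and agreement off 1 extends to 1.\<close>

lemma selberg_eqI:
  assumes "L1 \<in> extended_selberg_class" "L2 \<in> extended_selberg_class"
    and eq: "\<And>s. s \<noteq> 1 \<Longrightarrow> L1 s = L2 s"
  shows "L1 = L2"
proof
  fix s
  have nice: "(is_pole L1 s \<and> L1 s = 0) \<or> L1 \<midarrow>s\<rightarrow> L1 s" "(is_pole L2 s \<and> L2 s = 0) \<or> L2 \<midarrow>s\<rightarrow> L2 s"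
    using assms(1,2) unfolding extended_selberg_class_def nicely_meromorphic_on_def by auto
  have ev: "\<forall>\<^sub>F w in at s. L1 w = L2 w"
    using eventually_neq_at_within[of 1 s UNIV] by eventually_elim (rule eq)
  have pole: "is_pole L1 s \<longleftrightarrow> is_pole L2 s" by (rule is_pole_cong[OF ev refl])
  have lim: "L1 \<midarrow>s\<rightarrow> c \<longleftrightarrow> L2 \<midarrow>s\<rightarrow> c" for c by (rule filterlim_cong[OF refl refl ev])
  show "L1 s = L2 s"
  proof (cases "is_pole L1 s")
    case True
    hence "\<not> L1 \<midarrow>s\<rightarrow> L1 s" "\<not> L2 \<midarrow>s\<rightarrow> L2 s"
      using pole by (auto simp: is_pole_def dest: not_tendsto_and_filterlim_at_infinity[OF at_neq_bot])
    thus ?thesis using nice by simp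
  next
    case False
    thus ?thesis using nice pole lim LIM_unique by metis
  qed
qed

text \<open>Off a the factor c is a local unit, so it affects neither whether the limit is 0 nor
  \<open>zorder\<close>. In the application c is the quotient of powers of w - 1 that links L - h to
  an entire function.\<close>

lemma zero_of_mult_factor:
  assumes U: "U holomorphic_on UNIV" "U z0 \<noteq> 0" and f: "\<And>w. w \<noteq> a \<Longrightarrow> f w = c w * U w"
    and c: "c holomorphic_on - {a}" "\<And>w. w \<noteq> a \<Longrightarrow> c w \<noteq> 0" and z: "z \<noteq> a"
  shows "zero_of_mult f z m \<longleftrightarrow> U z = 0 \<and> zorder U z = int m"
proof -
  have f_eq: "\<forall>\<^sub>F w in nhds z. f w = c w * U w"
    using t1_space_nhds[OF z] by eventually_elim (rule f)
  have c_an: "c analytic_on {z}" using c(1) z by (auto simp: analytic_at)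
  have U_an: "U analytic_on {z}" using U(1) by (auto simp: analytic_at)
  have ev: "\<forall>\<^sub>F w in at z. U w \<noteq> 0"
    using non_zero_neighbour_alt[OF U(1) open_UNIV connected_UNIV UNIV_I[of z] UNIV_I[of z0] U(2)]
    by eventually_elim simp
  have f_at: "\<forall>\<^sub>F w in at z. f w = c w * U w"
    using f_eq by (simp add: eventually_at_filter eventually_mono)
  have ev_c: "\<forall>\<^sub>F w in at z. c w \<noteq> 0"
    using eventually_neq_at_within[of a z UNIV] by eventually_elim (rule c(2))
  have "(\<lambda>w. c w * U w) \<midarrow>z\<rightarrow> c z * U z"
    using analytic_at_imp_isCont[OF analytic_on_mult[OF c_an U_an]] by (simp add: isCont_def)
  hence lim: "f \<midarrow>z\<rightarrow> c z * U z" using filterlim_cong[OF refl refl f_at] by blast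
  have "\<forall>\<^sub>F w in at z. f w \<noteq> 0" using f_at ev ev_c by eventually_elim simp
  hence iz: "isolated_zero f z \<longleftrightarrow> U z = 0"
    using lim LIM_unique[OF lim, of 0] c(2)[OF z] by (auto simp: isolated_zero_def)
  have "zorder f z = zorder (\<lambda>w. c w * U w) z" by (rule zorder_cong[OF f_at refl])
  also have "\<dots> = zorder c z + zorder U z"
    by (rule zorder_times_analytic[OF c_an U_an]) (use ev ev_c in \<open>eventually_elim, simp\<close>)
  also have "zorder c z = 0" by (rule zorder_eq_0I[OF c_an c(2)[OF z]])
  finally show ?thesis by (simp add: zero_of_mult_def iz)
qed

lemma entire_same_zeros_quotient_exp:
  assumes U: "U1 holomorphic_on UNIV" "U2 holomorphic_on UNIV" "U1 a \<noteq> 0" "U2 a \<noteq> 0"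
    and same: "\<And>z m. z \<noteq> a \<Longrightarrow> (U1 z = 0 \<and> zorder U1 z = int m) \<longleftrightarrow> (U2 z = 0 \<and> zorder U2 z = int m)"
  obtains \<phi> where "\<phi> holomorphic_on UNIV" "\<And>z. U1 z = exp (\<phi> z) * U2 z"
proof -
  have an: "U analytic_on {z}" if "U holomorphic_on UNIV" for U z using that by (auto simp: analytic_at)
  have fr: "\<exists>\<^sub>F w in at z. U w \<noteq> 0" if "U holomorphic_on UNIV" "U a \<noteq> 0" for U z
  proof -
    have "\<forall>\<^sub>F w in at z. U w \<noteq> 0 \<and> w \<in> UNIV"
      by (rule non_zero_neighbour_alt[where \<beta> = a]) (use that in auto)
    thus ?thesis by (intro eventually_frequently) (auto elim: eventually_mono)
  qed
  have nn: "zorder U z \<ge> 0" if "U holomorphic_on UNIV" "U a \<noteq> 0" for U z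
    by (rule zorder_ge_0[OF an fr]) (use that in auto)
  \<comment> \<open>Taking the actual order for m turns the equivalence for all m into equality of
    the zero sets, and below of the orders; at a both functions are non-zero.\<close>
  have zero: "U1 z = 0 \<longleftrightarrow> U2 z = 0" for z
    using same[of z "nat (zorder U1 z)"] same[of z "nat (zorder U2 z)"] nn[OF U(1,3), of z] nn[OF U(2,4), of z] U(3,4)
    by (cases "z = a") auto
  have ord: "zorder U2 z = zorder U1 z" for z
  proof (cases "U1 z = 0")
    case True
    hence "z \<noteq> a" using U by auto
    thus ?thesis using same[of z "nat (zorder U1 z)"] nn[OF U(1,3), of z] True by simp
  next
    case False
    thus ?thesis using zero[of z] zorder_eq_0I[OF an[OF U(1)]] zorder_eq_0I[OF an[OF U(2)]] by simp
  qed
  obtain q where q: "q holomorphic_on UNIV" "\<And>z. z \<in> UNIV \<Longrightarrow> q z \<noteq> 0" "\<And>z. z \<in> UNIV \<Longrightarrow> U1 z = q z * U2 z"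
    using holomorphic_zorder_factorization[OF U(1) open_UNIV connected_UNIV U(2)] zero ord by metis
  obtain \<phi> where "\<phi> holomorphic_on UNIV" "\<And>z. q z = exp (\<phi> z)"
    using simply_connected_eq_holomorphic_log[OF open_UNIV] q(1,2)
    by (metis UNIV_I convex_UNIV convex_imp_simply_connected)
  thus thesis using q(3) that by auto
qed

text \<open>Unboundedness on the line yields points with |h| \<ge> n; as h is bounded on compact
  sets, their imaginary parts must leave every bounded interval.\<close>

lemma norm_tendsto_infinity_on_line:
  assumes h: "growth_at_most p h" and p: "0 \<le> p" "p < 1" and nc: "\<not> h constant_on UNIV"
  obtains s :: "nat \<Rightarrow> complex" where "\<And>n. Re (s n) = c" "\<And>n. real n \<le> norm (h (s n))"
    "filterlim (\<lambda>n. \<bar>Im (s n)\<bar>) at_top sequentially"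
proof -
  have "\<exists>s. Re s = c \<and> real n \<le> norm (h s)" for n
    using constant_of_bounded_on_vertical_line[OF h p, of c "real n"] nc by (meson less_imp_le not_le)
  then obtain s where s: "\<And>n. Re (s n) = c" "\<And>n. real n \<le> norm (h (s n))" by metis
  have "filterlim (\<lambda>n. \<bar>Im (s n)\<bar>) at_top sequentially"
    unfolding filterlim_at_top
  proof
    fix T :: real
    have "compact (h ` cball 0 (\<bar>c\<bar> + \<bar>T\<bar>))"
      by (intro compact_continuous_image holomorphic_on_imp_continuous_on growth_at_most_imp_holomorphic[OF h]) auto
    then obtain M where M: "\<And>z. norm z \<le> \<bar>c\<bar> + \<bar>T\<bar> \<Longrightarrow> norm (h z) \<le> M"
      using compact_imp_bounded bounded_iff by (metis (no_types, opaque_lifting) image_eqI mem_cball_0)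
    obtain N where N: "M < real N" using reals_Archimedean2 by blast
    show "\<forall>\<^sub>F n in sequentially. T \<le> \<bar>Im (s n)\<bar>"
    proof (rule eventually_sequentiallyI[of N], rule ccontr)
      fix n assume n: "N \<le> n" and "\<not> T \<le> \<bar>Im (s n)\<bar>"
      hence "norm (s n) \<le> \<bar>c\<bar> + \<bar>T\<bar>" using cmod_le[of "s n"] s(1)[of n] by simp
      from M[OF this] s(2)[of n] N n show False by simp
    qed
  qed
  thus thesis using s that by blast
qed

text \<open>On Re s = c, ln |F s| = m ln |s - 1| + (c Re \<alpha> + Re \<beta>) - Im \<alpha> Im s.
  This tends to 0 while |Im s| tends to infinity, so the linear term, the logarithmic term and the
  constant vanish in turn. The lines c = 2 and c = 3 then give Re \<alpha> = 0, and the limit itself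
  exp \<beta> = 1.\<close>

lemma unit_constant_of_limits_on_lines:
  assumes F: "\<And>z. F z = (z - 1) ^ m * exp (\<alpha> * z + \<beta>)"
    and lim: "\<And>c. c \<ge> 2 \<Longrightarrow> \<exists>s :: nat \<Rightarrow> complex. (\<forall>n. Re (s n) = c) \<and>
      filterlim (\<lambda>n. \<bar>Im (s n)\<bar>) at_top sequentially \<and> (\<lambda>n. F (s n)) \<longlonglongrightarrow> 1"
  shows "F z = 1"
proof -
  have key: "Im \<alpha> = 0 \<and> m = 0 \<and> Re \<alpha> * c + Re \<beta> = 0" if c: "c \<ge> 2" for c
  proof -
    obtain s where s: "\<And>n. Re (s n) = c" "filterlim (\<lambda>n. \<bar>Im (s n)\<bar>) at_top sequentially"
        "(\<lambda>n. F (s n)) \<longlonglongrightarrow> 1" using lim[OF c] by blast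
    define x where "x = (\<lambda>n. \<bar>Im (s n)\<bar>)"
    have x: "filterlim x at_top sequentially" using s(2) by (simp add: x_def)
    define l where "l = (\<lambda>n. ln (norm (s n - 1)))"
    define u where "u = (\<lambda>n. ln (norm (F (s n))))"
    define k where "k = Re \<alpha> * c + Re \<beta>"
    have "(\<lambda>n. ln (norm (F (s n)))) \<longlonglongrightarrow> ln (norm (1 :: complex))"
      by (intro tendsto_intros s) auto
    hence u: "u \<longlonglongrightarrow> 0" by (simp add: u_def)
    have s1: "s n \<noteq> 1" for n using s(1)[of n] c by auto
    have ueq: "u n = real m * l n + k - Im \<alpha> * Im (s n)" for n
    proof -
      have "norm (F (s n)) = norm (s n - 1) ^ m * exp (Re (\<alpha> * s n + \<beta>))"
        by (simp only: F norm_mult norm_power norm_exp_eq_Re)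
      thus ?thesis using s1[of n] s(1)[of n]
        by (simp add: u_def l_def k_def ln_mult ln_realpow)
    qed
    have l_upper: "l n \<le> ln (c + x n)" for n
    proof -
      have "norm (s n - 1) \<le> c + x n" using cmod_le[of "s n - 1"] s(1)[of n] c by (simp add: x_def)
      thus ?thesis unfolding l_def using s1[of n] by (intro ln_mono) auto
    qed
    have l_lower: "ln (x n) \<le> l n" if "x n > 0" for n
      unfolding l_def using that abs_Im_le_cmod[of "s n - 1"] by (intro ln_mono) (auto simp: x_def)
    have u1: "\<forall>\<^sub>F n in sequentially. \<bar>u n\<bar> < 1"
      using tendstoD[OF u, of 1] by (simp add: dist_real_def)
    have Im: "Im \<alpha> = 0"
    proof -
      have "((\<lambda>y::real. ln (c + y) / y) \<longlongrightarrow> 0) at_top" using c by real_asymp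
      from filterlim_compose[OF this x] have "(\<lambda>n. ln (c + x n) / x n) \<longlonglongrightarrow> 0" .
      moreover have "(\<lambda>n. 1 / x n) \<longlonglongrightarrow> 0"
        by (intro tendsto_divide_0[OF tendsto_const] filterlim_at_top_imp_at_infinity x)
      ultimately have "(\<lambda>n. real m * (ln (c + x n) / x n) + (\<bar>k\<bar> + 1) * (1 / x n)) \<longlonglongrightarrow>
          real m * 0 + (\<bar>k\<bar> + 1) * 0"
        by (intro tendsto_intros)
      moreover have "\<forall>\<^sub>F n in sequentially. \<bar>Im \<alpha>\<bar> \<le> real m * (ln (c + x n) / x n) + (\<bar>k\<bar> + 1) * (1 / x n)"
        using u1 filterlim_at_top_dense[THEN iffD1, OF x, rule_format, of 1]
      proof eventually_elim
        case (elim n)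
        have "0 \<le> l n" using l_lower[of n] elim ln_ge_zero[of "x n"] by linarith
        hence ml: "0 \<le> real m * l n" by simp
        have "\<bar>Im \<alpha>\<bar> * x n = \<bar>real m * l n + k - u n\<bar>" using ueq[of n] by (simp add: x_def flip: abs_mult)
        also have "\<dots> \<le> real m * l n + \<bar>k\<bar> + 1" using elim ml by linarith
        also have "\<dots> \<le> real m * ln (c + x n) + \<bar>k\<bar> + 1" using l_upper[of n] by (simp add: mult_left_mono)
        finally have "\<bar>Im \<alpha>\<bar> \<le> (real m * ln (c + x n) + \<bar>k\<bar> + 1) / x n" using elim by (simp add: field_simps)
        thus ?case by (simp add: add_divide_distrib)
      qed
      ultimately have "\<bar>Im \<alpha>\<bar> \<le> real m * 0 + (\<bar>k\<bar> + 1) * 0" by (intro tendsto_lowerbound) auto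
      thus ?thesis by simp
    qed
    have m: "m = 0"
    proof (rule ccontr)
      assume "m \<noteq> 0"
      hence m1: "1 \<le> real m" by simp
      have "filterlim (\<lambda>n. ln (x n)) at_top sequentially" by (rule filterlim_compose[OF ln_at_top x])
      hence "\<forall>\<^sub>F n in sequentially. ln (x n) > \<bar>k\<bar> + 1" by (simp add: filterlim_at_top_dense)
      hence "\<forall>\<^sub>F n in sequentially. False"
        using u1 filterlim_at_top_dense[THEN iffD1, OF x, rule_format, of 1]
      proof eventually_elim
        case (elim n)
        have "\<bar>k\<bar> + 1 < l n" using elim l_lower[of n] by linarith
        hence "1 * l n \<le> real m * l n" using m1 by (intro mult_right_mono) auto
        thus False using ueq[of n] Im elim \<open>\<bar>k\<bar> + 1 < l n\<close> by simp
      qed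
      thus False by simp
    qed
    have "u = (\<lambda>_. k)" using ueq Im m by auto
    hence "k = 0" using u by (simp add: LIMSEQ_const_iff)
    thus ?thesis using Im m by (simp add: k_def)
  qed
  have 2: "Im \<alpha> = 0" "m = 0" "Re \<alpha> * 2 + Re \<beta> = 0" "Re \<alpha> * 3 + Re \<beta> = 0" using key[of 2] key[of 3] by auto
  hence "\<alpha> = 0" by (simp add: complex_eq_iff)
  hence const: "F w = exp \<beta>" for w using 2 by (simp add: F)
  obtain s where "(\<lambda>n. F (s n)) \<longlonglongrightarrow> 1" using lim[of 2] by auto
  hence "exp \<beta> = 1" by (simp add: const LIMSEQ_const_iff)
  thus ?thesis by (simp add: const)
qed

lemma growth_order_le_1I:
  assumes "\<And>q. 1 < q \<Longrightarrow> growth_at_most q f"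
  shows "growth_order f \<le> 1"
proof (rule ereal_le_epsilon2)
  fix e :: real assume e: "e > 0"
  have "growth_at_most (1 + e / 2) f" using e by (intro assms) simp
  hence "growth_order f \<le> ereal (1 + e)"
    by (rule growth_at_most_imp_growth_order_le) (use e in auto)
  thus "growth_order f \<le> 1 + ereal e" by (simp add: one_ereal_def)
qed

lemma growth_at_most_less_1:
  assumes f: "f holomorphic_on UNIV" and "growth_order f < 1"
  obtains p where "0 \<le> p" "p < 1" "growth_at_most p f"
proof -
  obtain p where p: "growth_order f < ereal p" "ereal p < 1" using ereal_dense2[OF assms(2)] by blast
  have "growth_order f < ereal (max p 0)" using p(1) by (rule less_le_trans) simp
  hence "growth_at_most (max p 0) f" by (rule growth_order_less_imp_growth_at_most[OF f]) auto
  moreover have "max p 0 < 1" using p(2) by (simp add: one_ereal_def)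
  ultimately show thesis using that[of "max p 0"] by simp
qed

lemma growth_at_most_cancel_power:
  assumes "growth_at_most p (\<lambda>z. (z - a) ^ K * h z)" "h holomorphic_on UNIV" "p > 0"
  shows "growth_at_most p h"
  by (rule growth_at_most_quotient[where A = "\<lambda>z. (z - a) ^ K" and a = "a + 1", OF _ assms(1,2)])
     (use assms(3) in \<open>auto intro: growth_at_most_linear_power\<close>)

lemma exp_unit_quotient_impossible:
  assumes h: "h holomorphic_on UNIV" "\<not> h constant_on UNIV" "growth_order h \<noteq> 1"
    and L: "L1 \<in> extended_selberg_class" "L2 \<in> extended_selberg_class"
    and G1: "\<And>q. 1 < q \<Longrightarrow> growth_at_most q G1" "\<And>s. s \<noteq> 1 \<Longrightarrow> G1 s = (s - 1) ^ K * L1 s"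
    and G2: "\<And>q. 1 < q \<Longrightarrow> growth_at_most q G2" "\<And>s. s \<noteq> 1 \<Longrightarrow> G2 s = (s - 1) ^ K * L2 s"
    and \<phi>: "\<phi> holomorphic_on UNIV"
    and quot: "\<And>s. G1 s - (s - 1) ^ K * h s = (s - 1) ^ m * exp (\<phi> s) * (G2 s - (s - 1) ^ K * h s)"
    and ne: "G1 z0 \<noteq> G2 z0"
  shows False
proof -
  define F where "F = (\<lambda>z. (z - 1) ^ m * exp (\<phi> z))"
  define D where "D = (\<lambda>z. G1 z - G2 z)"
  define V where "V = (\<lambda>z. G2 z - (z - 1) ^ K * h z)"
  have holG: "G2 holomorphic_on UNIV" using growth_at_most_imp_holomorphic[OF G2(1)[of 2]] by simp
  have holV: "V holomorphic_on UNIV" unfolding V_def by (intro holomorphic_intros holG h)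
  have D: "growth_at_most q D" if "1 < q" for q
    unfolding D_def using that by (intro growth_at_most_diff G1 G2) auto
  have eq: "D z = (F z - 1) * V z" for z
    using quot[of z] unfolding D_def F_def V_def by (simp add: algebra_simps)
  have D0: "D z0 \<noteq> 0" using ne by (simp add: D_def)
  hence F0: "F z0 - 1 \<noteq> 0" using eq[of z0] by auto
  \<comment> \<open>The zeros of F - 1 are counted with the intermediate exponent (1 + q) / 2, since
    \<open>growth_of_exp_unit\<close> raises the exponent strictly.\<close>
  have F: "growth_at_most q F" if q: "1 < q" for q
    by (rule growth_of_exp_unit[OF \<phi> _ D[of "(1 + q) / 2"] _ holV eq D0]) (use q in \<open>auto simp: F_def\<close>)
  have V: "growth_at_most q V" if q: "1 < q" for q
    by (rule growth_at_most_quotient[where A = "\<lambda>z. F z - 1" and a = z0, OF _ D[OF q] holV eq F0])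
       (use q in \<open>auto intro!: growth_at_most_diff F growth_at_most_const\<close>)
  have "growth_at_most q h" if q: "1 < q" for q
  proof (rule growth_at_most_cancel_power)
    have "growth_at_most q (\<lambda>z. G2 z - V z)" using q by (intro growth_at_most_diff G2 V) auto
    thus "growth_at_most q (\<lambda>z. (z - 1) ^ K * h z)" by (simp add: V_def)
  qed (use q h in auto)
  hence "growth_order h \<le> 1" by (rule growth_order_le_1I)
  hence "growth_order h < 1" using h(3) by simp
  then obtain p where p: "0 \<le> p" "p < 1" "growth_at_most p h" by (rule growth_at_most_less_1[OF h(1)])
  \<comment> \<open>Any exponent strictly between 1 and 2 makes \<phi> affine; exp \<phi> is the
    quotient of F by (z - 1)^m.\<close>
  have "growth_at_most (3 / 2) (\<lambda>z. exp (\<phi> z))"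
  proof (rule growth_at_most_quotient[where A = "\<lambda>z. (z - 1) ^ m" and a = 2])
    show "growth_at_most (3 / 2) F" by (rule F) simp
  qed (use \<phi> in \<open>auto intro!: growth_at_most_linear_power holomorphic_intros simp: F_def\<close>)
  then obtain \<alpha> \<beta> where \<phi>_eq: "\<And>z. \<phi> z = \<alpha> * z + \<beta>"
    by (rule affine_of_growth_exp[OF \<phi>]) auto
  obtain B1 B2 where B: "\<And>s. Re s \<ge> 2 \<Longrightarrow> norm (L1 s) \<le> B1" "\<And>s. Re s \<ge> 2 \<Longrightarrow> norm (L2 s) \<le> B2"
    using selberg_bounded_right L by metis
  \<comment> \<open>On Re s = c the product (F - 1) (L2 - h) = L1 - L2 is bounded, while |L2 - h|
    \<ge> n - B2 at the n-th point; this drives F - 1 to 0.\<close>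
  have lim: "\<exists>s :: nat \<Rightarrow> complex. (\<forall>n. Re (s n) = c) \<and>
      filterlim (\<lambda>n. \<bar>Im (s n)\<bar>) at_top sequentially \<and> (\<lambda>n. F (s n)) \<longlonglongrightarrow> 1" if c: "c \<ge> 2" for c
  proof -
    obtain s where s: "\<And>n. Re (s n) = c" "\<And>n. real n \<le> norm (h (s n))"
        "filterlim (\<lambda>n. \<bar>Im (s n)\<bar>) at_top sequentially"
      using norm_tendsto_infinity_on_line[OF p(3,1,2) h(2), of c] by metis
    have "\<forall>\<^sub>F n in sequentially. norm (F (s n) - 1) \<le> (B1 + B2) / (real n - B2)"
    proof -
      obtain N where N: "B2 < real N" using reals_Archimedean2 by blast
      show ?thesis
      proof (rule eventually_sequentiallyI[of N])
        fix n assume n: "N \<le> n"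
        have nB: "real n - B2 > 0" using N n by simp
        have s1: "s n \<noteq> 1" using s(1)[of n] c by auto
        have B1: "norm (L1 (s n)) \<le> B1" and B2: "norm (L2 (s n)) \<le> B2" using B s(1)[of n] c by auto
        have "(s n - 1) ^ K * (L1 (s n) - L2 (s n)) = (s n - 1) ^ K * ((F (s n) - 1) * (L2 (s n) - h (s n)))"
          using eq[of "s n"] G1(2)[OF s1] G2(2)[OF s1] unfolding D_def V_def by (simp add: algebra_simps)
        hence "L1 (s n) - L2 (s n) = (F (s n) - 1) * (L2 (s n) - h (s n))" using s1 by simp
        hence "norm (F (s n) - 1) * norm (L2 (s n) - h (s n)) = norm (L1 (s n) - L2 (s n))"
          by (simp add: norm_mult)
        also have "\<dots> \<le> B1 + B2" using norm_triangle_ineq4[of "L1 (s n)" "L2 (s n)"] B1 B2 by simp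
        finally have 1: "norm (F (s n) - 1) * norm (L2 (s n) - h (s n)) \<le> B1 + B2" .
        have "real n - B2 \<le> norm (L2 (s n) - h (s n))"
          using norm_triangle_ineq2[of "h (s n)" "L2 (s n)"] s(2)[of n] B2 by (simp add: norm_minus_commute)
        hence "norm (F (s n) - 1) * (real n - B2) \<le> norm (F (s n) - 1) * norm (L2 (s n) - h (s n))"
          by (intro mult_left_mono) auto
        thus "norm (F (s n) - 1) \<le> (B1 + B2) / (real n - B2)"
          using 1 nB by (simp add: pos_le_divide_eq)
      qed
    qed
    moreover have "(\<lambda>n. (B1 + B2) / (real n - B2)) \<longlonglongrightarrow> 0" by real_asymp
    ultimately have "(\<lambda>n. F (s n) - 1) \<longlonglongrightarrow> 0" by (rule Lim_null_comparison)
    hence "(\<lambda>n. F (s n)) \<longlonglongrightarrow> 1" by (simp add: LIM_zero_iff)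
    thus ?thesis using s by blast
  qed
  have "F z0 = 1"
    by (rule unit_constant_of_limits_on_lines[OF _ lim]) (simp_all add: F_def \<phi>_eq)
  thus False using F0 by simp
qed

text \<open>Guarantees that the zero at 1 of this function has finite order and can be split off. If
  L were h off 1, then h would have order at most 1, hence less than 1, and would be bounded on Re s
  = 2, hence constant.\<close>

lemma selberg_ne_entire_of_order_ne_1:
  assumes h: "h holomorphic_on UNIV" "\<not> h constant_on UNIV" "growth_order h \<noteq> 1"
    and L: "L \<in> extended_selberg_class"
    and G: "\<And>q. 1 < q \<Longrightarrow> growth_at_most q G" "\<And>s. s \<noteq> 1 \<Longrightarrow> G s = (s - 1) ^ K * L s"
  shows "\<exists>z. G z - (z - 1) ^ K * h z \<noteq> 0"
proof (rule ccontr)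
  assume "\<not> ?thesis"
  hence eq: "\<And>z. G z = (z - 1) ^ K * h z" by simp
  have "growth_at_most q h" if q: "1 < q" for q
    using G(1)[OF q] q h by (intro growth_at_most_cancel_power[of q 1 K h]) (auto simp flip: eq)
  hence "growth_order h \<le> 1" by (rule growth_order_le_1I)
  hence "growth_order h < 1" using h(3) by simp
  then obtain p where p: "0 \<le> p" "p < 1" "growth_at_most p h" by (rule growth_at_most_less_1[OF h(1)])
  obtain B where B: "\<And>s. Re s \<ge> 2 \<Longrightarrow> norm (L s) \<le> B" using selberg_bounded_right[OF L] by blast
  have "norm (h s) \<le> B" if "Re s = 2" for s
  proof -
    have s1: "s \<noteq> 1" using that by auto
    hence "h s = L s" using eq[of s] G(2)[OF s1] by simp
    thus ?thesis using B[of s] that by simp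
  qed
  from constant_of_bounded_on_vertical_line[OF p(3,1,2) this] h(2) show False by blast
qed

theorem theorem1:
  fixes h L1 L2 :: "complex \<Rightarrow> complex"
  assumes "h holomorphic_on UNIV" and "\<not> h constant_on UNIV"
    and "growth_order h \<noteq> 1"
    and "L1 \<in> extended_selberg_class" and "L2 \<in> extended_selberg_class"
    and "same_zeros_with_mult (\<lambda>s. L1 s - h s) (\<lambda>s. L2 s - h s)"
  shows "L1 = L2"
proof (rule ccontr)
  assume ne: "L1 \<noteq> L2"
  note h = assms(1-3) and L = assms(4,5)
  obtain k1 g1 where g1: "\<And>p. 1 < p \<Longrightarrow> growth_at_most p g1" "\<And>s. s \<noteq> 1 \<Longrightarrow> g1 s = (s - 1) ^ k1 * L1 s"
    using selberg_continuation_growth[OF L(1)] by metis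
  obtain k2 g2 where g2: "\<And>p. 1 < p \<Longrightarrow> growth_at_most p g2" "\<And>s. s \<noteq> 1 \<Longrightarrow> g2 s = (s - 1) ^ k2 * L2 s"
    using selberg_continuation_growth[OF L(2)] by metis
  \<comment> \<open>A common exponent clears the poles of both functions, so that h is multiplied by
    the same power in both cases.\<close>
  define K where "K = k1 + k2"
  define G1 where "G1 = (\<lambda>s. (s - 1) ^ k2 * g1 s)"
  define G2 where "G2 = (\<lambda>s. (s - 1) ^ k1 * g2 s)"
  have G1: "growth_at_most q G1" if "1 < q" for q
    unfolding G1_def using that by (intro growth_at_most_mult growth_at_most_linear_power g1) auto
  have G2: "growth_at_most q G2" if "1 < q" for q
    unfolding G2_def using that by (intro growth_at_most_mult growth_at_most_linear_power g2) auto
  have G1': "G1 s = (s - 1) ^ K * L1 s" if "s \<noteq> 1" for s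
    using g1(2)[OF that] by (simp add: G1_def K_def power_add mult_ac)
  have G2': "G2 s = (s - 1) ^ K * L2 s" if "s \<noteq> 1" for s
    using g2(2)[OF that] by (simp add: G2_def K_def power_add mult_ac)
  obtain z0 where z0: "G1 z0 \<noteq> G2 z0"
  proof -
    have "\<exists>s. s \<noteq> 1 \<and> L1 s \<noteq> L2 s" using selberg_eqI[OF L] ne by blast
    then obtain s where "s \<noteq> 1" "L1 s \<noteq> L2 s" by blast
    thus thesis using G1'[of s] G2'[of s] that[of s] by simp
  qed
  have holG: "G1 holomorphic_on UNIV" "G2 holomorphic_on UNIV"
    using growth_at_most_imp_holomorphic[OF G1[of 2]] growth_at_most_imp_holomorphic[OF G2[of 2]] by simp_all
  \<comment> \<open>At 1 the order of vanishing after multiplication by (z - 1)^K need not be the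
    multiplicity of a zero of L - h, since L may have a pole there. This factor is therefore split
    off, and the exponents n1 and n2 are kept apart.\<close>
  have factor: "\<exists>n U. U holomorphic_on UNIV \<and> U 1 \<noteq> 0 \<and> (\<forall>z. G z - (z - 1) ^ K * h z = (z - 1) ^ n * U z)"
    if G: "G holomorphic_on UNIV" "\<exists>z. G z - (z - 1) ^ K * h z \<noteq> 0" for G
  proof -
    have hol: "(\<lambda>z. G z - (z - 1) ^ K * h z) holomorphic_on UNIV" by (intro holomorphic_intros G h)
    obtain z where "G z - (z - 1) ^ K * h z \<noteq> 0" using G(2) by blast
    from entire_factor_zero_power[OF hol this, of 1] show ?thesis by blast
  qed
  obtain n1 U1 where U1: "U1 holomorphic_on UNIV" "U1 1 \<noteq> 0"
      "\<And>z. G1 z - (z - 1) ^ K * h z = (z - 1) ^ n1 * U1 z"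
    using factor[OF holG(1) selberg_ne_entire_of_order_ne_1[OF h L(1) G1 G1']] by auto
  obtain n2 U2 where U2: "U2 holomorphic_on UNIV" "U2 1 \<noteq> 0"
      "\<And>z. G2 z - (z - 1) ^ K * h z = (z - 1) ^ n2 * U2 z"
    using factor[OF holG(2) selberg_ne_entire_of_order_ne_1[OF h L(2) G2 G2']] by auto
  have zero: "zero_of_mult (\<lambda>s. L s - h s) z m \<longleftrightarrow> U z = 0 \<and> zorder U z = int m"
    if G: "\<And>s. s \<noteq> 1 \<Longrightarrow> G s = (s - 1) ^ K * L s" and U: "U holomorphic_on UNIV" "U 1 \<noteq> 0"
      "\<And>z. G z - (z - 1) ^ K * h z = (z - 1) ^ n * U z" and z: "z \<noteq> 1" for G L U n z m
  proof (rule zero_of_mult_factor[OF U(1,2) _ _ _ z])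
    fix w :: complex assume w: "w \<noteq> 1"
    have "(w - 1) ^ K * (L w - h w) = (w - 1) ^ n * U w"
      using U(3)[of w] G[OF w] by (simp add: right_diff_distrib)
    thus "L w - h w = (w - 1) ^ n / (w - 1) ^ K * U w" using w by (simp add: field_simps)
  qed (auto intro!: holomorphic_intros)
  have same: "(U1 z = 0 \<and> zorder U1 z = int m) \<longleftrightarrow> (U2 z = 0 \<and> zorder U2 z = int m)" if "z \<noteq> 1" for z m
    using zero[OF G1' U1 that, of m] zero[OF G2' U2 that, of m] assms(6)
    unfolding same_zeros_with_mult_def by blast
  obtain \<phi> where \<phi>: "\<phi> holomorphic_on UNIV" "\<And>z. U1 z = exp (\<phi> z) * U2 z"
    using entire_same_zeros_quotient_exp[OF U1(1) U2(1) U1(2) U2(2) same] by metis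
  show False
  proof (cases "n2 \<le> n1")
    case True
    have "(z - 1) ^ n1 = (z - 1) ^ (n1 - n2) * (z - 1) ^ n2" for z :: complex
      using True by (simp flip: power_add)
    hence "G1 z - (z - 1) ^ K * h z = (z - 1) ^ (n1 - n2) * exp (\<phi> z) * (G2 z - (z - 1) ^ K * h z)" for z
      by (simp add: U1(3) U2(3) \<phi>(2))
    from exp_unit_quotient_impossible[OF h L G1 G1' G2 G2' \<phi>(1) this z0] show False .
  next
    case False
    have "(z - 1) ^ n2 = (z - 1) ^ (n2 - n1) * (z - 1) ^ n1" for z :: complex
      using False by (simp flip: power_add)
    hence "G2 z - (z - 1) ^ K * h z = (z - 1) ^ (n2 - n1) * exp (- \<phi> z) * (G1 z - (z - 1) ^ K * h z)" for z
      by (simp add: U1(3) U2(3) \<phi>(2) exp_minus)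
    moreover have "(\<lambda>z. - \<phi> z) holomorphic_on UNIV" by (intro holomorphic_intros \<phi>)
    ultimately show False
      using exp_unit_quotient_impossible[OF h L(2,1) G2 G2' G1 G1' _ _ z0[symmetric]] by blast
  qed
qed

end
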